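(* Let a compact Lie group $G$ act on manifolds $M$ and $N$, and let $f,g\colon M\to N$ be $G$-homotopic equivariant maps, i.e. there exists a smooth $G$-equivariant homotopy $F\colon M\times\mathbb R\to N$ such that $F(\cdot,0)=f$ and $F(\cdot,1)=g$, where the $G$-action is extended to $M\times\mathbb R$ trivially on the second factor. Then $f^*=g^*\colon H^*_G(N)\to H^*_G(M)$.
   Context: Manifolds and actions are smooth. For a compact Lie group $G$ with Lie algebra $\mathfrak g$ acting on $M$, and $X\in\mathfrak g$, let $\overline X_p=\frac{d}{dt}|_{t=0}\exp(tX)\cdot p$. The Cartan complex is $C_G(M)=(S(\mathfrak g^* )\otimes\Omega(M))^G$, i.e. polynomial maps $\omega:\mathfrak g\to\Omega(M)$ (with real-valued forms) with $\omega(\mathrm{Ad}_aX)=(a^{-1})^*(\omega(X))$ for all $a\in G$, with differential $(d_G\omega)(X)=d(\omega(X))-i_{\overline X}(\omega(X))$ and grading $C^n_G(M)=\bigoplus_{2k+l=n}(S^k(\mathfrak g^* )\otimes\Omega^l(M))^G$. Equivariant cohomology is $H^*_G(M)=H^*(C_G(M),d_G)$. A smooth $G$-equivariant map $f:M\to N$ induces $f^*:H^*_G(N)\to H^*_G(M)$ via $(f^*\omega)(X)=f^*(\omega(X))$. *)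

theory Defs
  imports "HOL-Analysis.Analysis" "HOL-Algebra.Group_Action" "HOL-Algebra.Coset"
begin

section \<open>Smooth manifolds\<close>

text \<open>
  The model space of a manifold is a finite-dimensional real normed space rather than a type of
  class \<open>euclidean_space\<close>: the latter class excludes dimension 0, hence finite groups.
\<close>

primrec Ck_on ::
  "nat \<Rightarrow> 'a::real_normed_vector set \<Rightarrow> ('a \<Rightarrow> 'b::real_normed_vector) \<Rightarrow> bool"
where
  "Ck_on 0 S f \<longleftrightarrow> continuous_on S f"
| "Ck_on (Suc k) S f \<longleftrightarrow>
     (\<forall>x\<in>S. f differentiable (at x)) \<and> (\<forall>v. Ck_on k S (\<lambda>x. frechet_derivative f (at x) v))"

text \<open>Used for open subsets \<open>S\<close> of finite-dimensional spaces only.\<close>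

definition smooth_on ::
  "'a::real_normed_vector set \<Rightarrow> ('a \<Rightarrow> 'b::real_normed_vector) \<Rightarrow> bool" where
  "smooth_on S f \<longleftrightarrow> (\<forall>k. Ck_on k S f)"

type_synonym ('a, 'e) chart = "'a set \<times> ('a \<Rightarrow> 'e)"

record ('a, 'e) manifold =
  mtop :: "'a topology"
  atlas :: "('a, 'e) chart set"

abbreviation points :: "('a, 'e) manifold \<Rightarrow> 'a set" where
  "points M \<equiv> topspace (mtop M)"

abbreviation chart_dom :: "('a, 'e) chart \<Rightarrow> 'a set" where
  "chart_dom \<equiv> fst"

abbreviation chart_inv :: "('a, 'e) chart \<Rightarrow> 'e \<Rightarrow> 'a" where
  "chart_inv c \<equiv> inv_into (chart_dom c) (snd c)"

definition charts_at :: "('a, 'e) manifold \<Rightarrow> 'a \<Rightarrow> ('a, 'e) chart set" where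
  "charts_at M p = {c \<in> atlas M. p \<in> chart_dom c}"

definition transition :: "('a, 'e) chart \<Rightarrow> ('a, 'e) chart \<Rightarrow> 'e \<Rightarrow> 'e" where
  "transition c c' = (\<lambda>x. snd c' (chart_inv c x))"

definition smooth_manifold :: "('a, 'e::real_normed_vector) manifold \<Rightarrow> bool" where
  "smooth_manifold M \<longleftrightarrow>
     (\<exists>B::'e set. finite B \<and> span B = UNIV) \<and>
     Hausdorff_space (mtop M) \<and> second_countable (mtop M) \<and>
     (\<Union>c\<in>atlas M. chart_dom c) = points M \<and>
     (\<forall>c\<in>atlas M. openin (mtop M) (chart_dom c) \<and> open (snd c ` chart_dom c) \<and>
        homeomorphic_map (subtopology (mtop M) (chart_dom c)) (top_of_set (snd c ` chart_dom c)) (snd c)) \<and>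
     (\<forall>c\<in>atlas M. \<forall>c'\<in>atlas M. smooth_on (snd c ` (chart_dom c \<inter> chart_dom c')) (transition c c'))"

definition smooth_map ::
  "('a, 'e::real_normed_vector) manifold \<Rightarrow> ('b, 'f::real_normed_vector) manifold
    \<Rightarrow> ('a \<Rightarrow> 'b) \<Rightarrow> bool" where
  "smooth_map M N f \<longleftrightarrow>
     continuous_map (mtop M) (mtop N) f \<and>
     (\<forall>c\<in>atlas M. \<forall>c'\<in>atlas N.
        smooth_on (snd c ` (chart_dom c \<inter> f -` chart_dom c')) (\<lambda>x. snd c' (f (chart_inv c x))))"

definition prod_manifold ::
  "('a, 'e::real_normed_vector) manifold \<Rightarrow> ('b, 'f::real_normed_vector) manifold
    \<Rightarrow> ('a \<times> 'b, 'e \<times> 'f) manifold" where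
  "prod_manifold M N =
     \<lparr>mtop = prod_topology (mtop M) (mtop N),
      atlas = {(chart_dom c \<times> chart_dom c', map_prod (snd c) (snd c')) | c c'. c \<in> atlas M \<and> c' \<in> atlas N}\<rparr>"

definition real_line :: "(real, real) manifold" where
  "real_line = \<lparr>mtop = euclidean, atlas = {(UNIV, id)}\<rparr>"


section \<open>Tangent vectors\<close>

text \<open>
  A tangent vector at \<open>p\<close> is the family of its coordinate vectors in all charts around \<open>p\<close>; the
  coordinate vectors are related by the derivatives of the transition maps. To make the
  representation unique, the family vanishes on all other arguments.
\<close>

type_synonym ('a, 'e) tangent = "('a, 'e) chart \<Rightarrow> 'e"

definition tangent_space ::
  "('a, 'e::real_normed_vector) manifold \<Rightarrow> 'a \<Rightarrow> ('a, 'e) tangent set" where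
  "tangent_space M p =
     {v. (\<forall>c\<in>charts_at M p. \<forall>c'\<in>charts_at M p.
            v c' = frechet_derivative (transition c c') (at (snd c p)) (v c)) \<and>
         (\<forall>c. c \<notin> charts_at M p \<longrightarrow> v c = 0)}"

definition lincomb ::
  "real \<Rightarrow> ('a, 'e::real_normed_vector) tangent \<Rightarrow> real \<Rightarrow> ('a, 'e) tangent \<Rightarrow> ('a, 'e) tangent"
where
  "lincomb a u b v = (\<lambda>c. a *\<^sub>R u c + b *\<^sub>R v c)"

text \<open>The tangent vector at \<open>p\<close> whose coordinate vector in the chart \<open>c\<close> is \<open>\<xi>\<close>.\<close>

definition coord_vec ::
  "('a, 'e::real_normed_vector) manifold \<Rightarrow> ('a, 'e) chart \<Rightarrow> 'a \<Rightarrow> 'e \<Rightarrow> ('a, 'e) tangent" where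
  "coord_vec M c p \<xi> = (\<lambda>c'. if c' \<in> charts_at M p
     then frechet_derivative (transition c c') (at (snd c p)) \<xi> else 0)"

text \<open>
  An arbitrary chart around \<open>p\<close>. It is used below only in expressions that, by the chain rule, do
  not depend on the chart.
\<close>

definition chart_at :: "('a, 'e) manifold \<Rightarrow> 'a \<Rightarrow> ('a, 'e) chart" where
  "chart_at M p = (SOME c. c \<in> charts_at M p)"

definition differential ::
  "('a, 'e::real_normed_vector) manifold \<Rightarrow> ('b, 'f::real_normed_vector) manifold
    \<Rightarrow> ('a \<Rightarrow> 'b) \<Rightarrow> 'a \<Rightarrow> ('a, 'e) tangent \<Rightarrow> ('b, 'f) tangent" where
  "differential M N f p v = (\<lambda>c'. if c' \<in> charts_at N (f p)
     then let c = chart_at M p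
          in frechet_derivative (\<lambda>x. snd c' (f (chart_inv c x))) (at (snd c p)) (v c)
     else 0)"

definition velocity ::
  "('a, 'e::real_normed_vector) manifold \<Rightarrow> (real \<Rightarrow> 'a) \<Rightarrow> real \<Rightarrow> ('a, 'e) tangent" where
  "velocity M \<gamma> t = (\<lambda>c. if c \<in> charts_at M (\<gamma> t)
     then vector_derivative (\<lambda>s. snd c (\<gamma> s)) (at t) else 0)"


section \<open>Differential forms\<close>

text \<open>
  An element of \<open>\<Omega>(M)\<close> is a function of a point and a list of tangent vectors at that point, whose
  restriction to lists of length \<open>l\<close> is its component of degree \<open>l\<close>. The value is 0 if the
  arguments are not a point of \<open>M\<close> and tangent vectors at that point.
\<close>

type_synonym ('a, 'e) form = "'a \<Rightarrow> ('a, 'e) tangent list \<Rightarrow> real"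

definition local_form ::
  "('a, 'e::real_normed_vector) manifold \<Rightarrow> ('a, 'e) chart \<Rightarrow> ('a, 'e) form
    \<Rightarrow> 'e \<Rightarrow> 'e list \<Rightarrow> real" where
  "local_form M c \<omega> x \<xi>s =
     \<omega> (chart_inv c x) (map (coord_vec M c (chart_inv c x)) \<xi>s)"

definition forms :: "('a, 'e::real_normed_vector) manifold \<Rightarrow> nat \<Rightarrow> ('a, 'e) form set" where
  "forms M l =
     {\<omega>. (\<forall>p vs. \<omega> p vs \<noteq> 0 \<longrightarrow> p \<in> points M \<and> set vs \<subseteq> tangent_space M p \<and> length vs = l) \<and>
         (\<forall>p\<in>points M. \<forall>us vs v w a b.
            set us \<union> set vs \<union> {v, w} \<subseteq> tangent_space M p \<longrightarrow>
            \<omega> p (us @ lincomb a v b w # vs) = a * \<omega> p (us @ v # vs) + b * \<omega> p (us @ w # vs)) \<and>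
         (\<forall>p\<in>points M. \<forall>vs. \<not> distinct vs \<longrightarrow> \<omega> p vs = 0) \<and>
         (\<forall>c\<in>atlas M. \<forall>\<xi>s. smooth_on (snd c ` chart_dom c) (\<lambda>x. local_form M c \<omega> x \<xi>s))}"

text \<open>
  In a chart, with \<open>v\<^sub>0, \<dots>, v\<^sub>l\<close> extended to vector fields with constant coefficients,
  \<open>d\<omega>(v\<^sub>0, \<dots>, v\<^sub>l) = \<Sum>\<^sub>i (-1)\<^sup>i v\<^sub>i(\<omega>(v\<^sub>0, \<dots>, v\<^sub>i\<^sub>-\<^sub>1, v\<^sub>i\<^sub>+\<^sub>1, \<dots>, v\<^sub>l))\<close>.
\<close>

definition ext_deriv ::
  "('a, 'e::real_normed_vector) manifold \<Rightarrow> ('a, 'e) form \<Rightarrow> ('a, 'e) form" where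
  "ext_deriv M \<omega> = (\<lambda>p vs. if p \<in> points M \<and> set vs \<subseteq> tangent_space M p
     then let c = chart_at M p
          in \<Sum>i<length vs. (-1) ^ i *
               frechet_derivative
                 (\<lambda>x. local_form M c \<omega> x (map (\<lambda>v. v c) (take i vs @ drop (Suc i) vs)))
                 (at (snd c p)) ((vs ! i) c)
     else 0)"

definition interior_product ::
  "('a \<Rightarrow> ('a, 'e) tangent) \<Rightarrow> ('a, 'e) form \<Rightarrow> ('a, 'e) form" where
  "interior_product Y \<omega> = (\<lambda>p vs. \<omega> p (Y p # vs))"

definition pullback ::
  "('a, 'e::real_normed_vector) manifold \<Rightarrow> ('b, 'f::real_normed_vector) manifold
    \<Rightarrow> ('a \<Rightarrow> 'b) \<Rightarrow> ('b, 'f) form \<Rightarrow> ('a, 'e) form" where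
  "pullback M N f \<omega> = (\<lambda>p vs. if p \<in> points M \<and> set vs \<subseteq> tangent_space M p
     then \<omega> (f p) (map (differential M N f p) vs) else 0)"


section \<open>Lie groups and smooth actions\<close>

text \<open>A Lie group is given by its group structure \<open>G\<close> and its manifold structure \<open>L\<close>.\<close>

definition lie_group :: "'g monoid \<Rightarrow> ('g, 'k::real_normed_vector) manifold \<Rightarrow> bool" where
  "lie_group G L \<longleftrightarrow>
     group G \<and> smooth_manifold L \<and> points L = carrier G \<and>
     smooth_map (prod_manifold L L) L (\<lambda>(a, b). a \<otimes>\<^bsub>G\<^esub> b) \<and>
     smooth_map L L (\<lambda>a. inv\<^bsub>G\<^esub> a)"

definition compact_lie_group ::
  "'g monoid \<Rightarrow> ('g, 'k::real_normed_vector) manifold \<Rightarrow> bool" where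
  "compact_lie_group G L \<longleftrightarrow> lie_group G L \<and> compact_space (mtop L)"

definition lie_algebra ::
  "'g monoid \<Rightarrow> ('g, 'k::real_normed_vector) manifold \<Rightarrow> ('g, 'k) tangent set" where
  "lie_algebra G L = tangent_space L \<one>\<^bsub>G\<^esub>"

definition one_parameter_subgroup ::
  "'g monoid \<Rightarrow> ('g, 'k::real_normed_vector) manifold \<Rightarrow> (real \<Rightarrow> 'g) \<Rightarrow> bool" where
  "one_parameter_subgroup G L \<gamma> \<longleftrightarrow>
     smooth_map real_line L \<gamma> \<and> (\<forall>s t. \<gamma> (s + t) = \<gamma> s \<otimes>\<^bsub>G\<^esub> \<gamma> t)"

definition lie_exp ::
  "'g monoid \<Rightarrow> ('g, 'k::real_normed_vector) manifold \<Rightarrow> ('g, 'k) tangent \<Rightarrow> 'g" where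
  "lie_exp G L X =
     (THE a. \<exists>\<gamma>. one_parameter_subgroup G L \<gamma> \<and> velocity L \<gamma> 0 = X \<and> a = \<gamma> 1)"

definition Ad ::
  "'g monoid \<Rightarrow> ('g, 'k::real_normed_vector) manifold \<Rightarrow> 'g
    \<Rightarrow> ('g, 'k) tangent \<Rightarrow> ('g, 'k) tangent" where
  "Ad G L a = differential L L (\<lambda>b. a \<otimes>\<^bsub>G\<^esub> b \<otimes>\<^bsub>G\<^esub> inv\<^bsub>G\<^esub> a) \<one>\<^bsub>G\<^esub>"

definition smooth_action ::
  "'g monoid \<Rightarrow> ('g, 'k::real_normed_vector) manifold
    \<Rightarrow> ('a, 'e::real_normed_vector) manifold \<Rightarrow> ('g \<Rightarrow> 'a \<Rightarrow> 'a) \<Rightarrow> bool" where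
  "smooth_action G L M \<phi> \<longleftrightarrow>
     group_action G (points M) \<phi> \<and> smooth_map (prod_manifold L M) M (\<lambda>(a, p). \<phi> a p)"

definition equivariant_map ::
  "'g monoid \<Rightarrow> ('a, 'e::real_normed_vector) manifold \<Rightarrow> ('g \<Rightarrow> 'a \<Rightarrow> 'a)
    \<Rightarrow> ('b, 'f::real_normed_vector) manifold \<Rightarrow> ('g \<Rightarrow> 'b \<Rightarrow> 'b) \<Rightarrow> ('a \<Rightarrow> 'b) \<Rightarrow> bool" where
  "equivariant_map G M \<phi> N \<psi> f \<longleftrightarrow>
     smooth_map M N f \<and> (\<forall>a\<in>carrier G. \<forall>p\<in>points M. f (\<phi> a p) = \<psi> a (f p))"

text \<open>The action on \<open>M \<times> \<real>\<close> that is trivial on the second factor.\<close>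

definition line_action ::
  "('a, 'e::real_normed_vector) manifold \<Rightarrow> ('g \<Rightarrow> 'a \<Rightarrow> 'a)
    \<Rightarrow> 'g \<Rightarrow> 'a \<times> real \<Rightarrow> 'a \<times> real" where
  "line_action M \<phi> a = (\<lambda>(p, t) \<in> points M \<times> UNIV. (\<phi> a p, t))"

definition equivariantly_homotopic ::
  "'g monoid \<Rightarrow> ('a, 'e::real_normed_vector) manifold \<Rightarrow> ('g \<Rightarrow> 'a \<Rightarrow> 'a)
    \<Rightarrow> ('b, 'f::real_normed_vector) manifold \<Rightarrow> ('g \<Rightarrow> 'b \<Rightarrow> 'b)
    \<Rightarrow> ('a \<Rightarrow> 'b) \<Rightarrow> ('a \<Rightarrow> 'b) \<Rightarrow> bool" where
  "equivariantly_homotopic G M \<phi> N \<psi> f g \<longleftrightarrow>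
     (\<exists>F. equivariant_map G (prod_manifold M real_line) (line_action M \<phi>) N \<psi> F \<and>
          (\<forall>p\<in>points M. F (p, 0) = f p \<and> F (p, 1) = g p))"

definition fundamental_field ::
  "'g monoid \<Rightarrow> ('g, 'k::real_normed_vector) manifold
    \<Rightarrow> ('a, 'e::real_normed_vector) manifold \<Rightarrow> ('g \<Rightarrow> 'a \<Rightarrow> 'a)
    \<Rightarrow> ('g, 'k) tangent \<Rightarrow> 'a \<Rightarrow> ('a, 'e) tangent" where
  "fundamental_field G L M \<phi> X p =
     velocity M (\<lambda>t. \<phi> (lie_exp G L (\<lambda>c. t *\<^sub>R X c)) p) 0"


section \<open>The Cartan complex\<close>

definition lie_dual ::
  "'g monoid \<Rightarrow> ('g, 'k::real_normed_vector) manifold \<Rightarrow> (('g, 'k) tangent \<Rightarrow> real) set" where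
  "lie_dual G L =
     {\<mu>. \<forall>X\<in>lie_algebra G L. \<forall>Y\<in>lie_algebra G L. \<forall>a b.
        \<mu> (lincomb a X b Y) = a * \<mu> X + b * \<mu> Y}"

text \<open>
  \<open>S\<^sup>k(\<gg>\<^sup>*)\<close>, as the polynomial functions on the Lie algebra that are sums of products of \<open>k\<close> linear
  functionals. Functions on the Lie algebra are extended by 0 to the whole type.
\<close>

definition sym_power ::
  "'g monoid \<Rightarrow> ('g, 'k::real_normed_vector) manifold \<Rightarrow> nat
    \<Rightarrow> (('g, 'k) tangent \<Rightarrow> real) set" where
  "sym_power G L k =
     {P. \<exists>(m::nat) \<mu>. (\<forall>j<m. \<forall>i<k. \<mu> j i \<in> lie_dual G L) \<and>
        P = (\<lambda>X. if X \<in> lie_algebra G L then \<Sum>j<m. \<Prod>i<k. \<mu> j i X else 0)}"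

type_synonym ('g, 'k, 'a, 'e) cochain = "('g, 'k) tangent \<Rightarrow> ('a, 'e) form"

definition sym_forms ::
  "'g monoid \<Rightarrow> ('g, 'k::real_normed_vector) manifold
    \<Rightarrow> ('a, 'e::real_normed_vector) manifold \<Rightarrow> nat \<Rightarrow> nat \<Rightarrow> ('g, 'k, 'a, 'e) cochain set" where
  "sym_forms G L M k l =
     {\<alpha>. \<exists>(m::nat) P \<omega>. (\<forall>j<m. P j \<in> sym_power G L k \<and> \<omega> j \<in> forms M l) \<and>
        \<alpha> = (\<lambda>X p vs. \<Sum>j<m. P j X * \<omega> j p vs)}"

definition invariant_sym_forms ::
  "'g monoid \<Rightarrow> ('g, 'k::real_normed_vector) manifold
    \<Rightarrow> ('a, 'e::real_normed_vector) manifold \<Rightarrow> ('g \<Rightarrow> 'a \<Rightarrow> 'a)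
    \<Rightarrow> nat \<Rightarrow> nat \<Rightarrow> ('g, 'k, 'a, 'e) cochain set" where
  "invariant_sym_forms G L M \<phi> k l =
     {\<alpha> \<in> sym_forms G L M k l. \<forall>a\<in>carrier G. \<forall>X\<in>lie_algebra G L.
        \<alpha> (Ad G L a X) = pullback M M (\<phi> (inv\<^bsub>G\<^esub> a)) (\<alpha> X)}"

text \<open>The degree is an integer, so that the cochains of degree \<open>-1\<close> are just 0.\<close>

definition cochains ::
  "'g monoid \<Rightarrow> ('g, 'k::real_normed_vector) manifold
    \<Rightarrow> ('a, 'e::real_normed_vector) manifold \<Rightarrow> ('g \<Rightarrow> 'a \<Rightarrow> 'a)
    \<Rightarrow> int \<Rightarrow> ('g, 'k, 'a, 'e) cochain set" where
  "cochains G L M \<phi> n =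
     {\<alpha>. \<exists>\<beta>. (\<forall>k l. \<beta> k l \<in> invariant_sym_forms G L M \<phi> k l) \<and>
        \<alpha> = (\<lambda>X p vs. \<Sum>(k, l) \<in> {(k, l). 2 * int k + int l = n}. \<beta> k l X p vs)}"

definition cartan_differential ::
  "'g monoid \<Rightarrow> ('g, 'k::real_normed_vector) manifold
    \<Rightarrow> ('a, 'e::real_normed_vector) manifold \<Rightarrow> ('g \<Rightarrow> 'a \<Rightarrow> 'a)
    \<Rightarrow> ('g, 'k, 'a, 'e) cochain \<Rightarrow> ('g, 'k, 'a, 'e) cochain" where
  "cartan_differential G L M \<phi> \<alpha> = (\<lambda>X p vs.
     ext_deriv M (\<alpha> X) p vs - interior_product (fundamental_field G L M \<phi> X) (\<alpha> X) p vs)"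


section \<open>Equivariant cohomology\<close>

definition cocycles ::
  "'g monoid \<Rightarrow> ('g, 'k::real_normed_vector) manifold
    \<Rightarrow> ('a, 'e::real_normed_vector) manifold \<Rightarrow> ('g \<Rightarrow> 'a \<Rightarrow> 'a)
    \<Rightarrow> int \<Rightarrow> ('g, 'k, 'a, 'e) cochain monoid" where
  "cocycles G L M \<phi> n =
     \<lparr>carrier = {\<alpha> \<in> cochains G L M \<phi> n. cartan_differential G L M \<phi> \<alpha> = (\<lambda>X p vs. 0)},
      mult = (\<lambda>\<alpha> \<beta> X p vs. \<alpha> X p vs + \<beta> X p vs),
      one = (\<lambda>X p vs. 0)\<rparr>"

definition coboundaries ::
  "'g monoid \<Rightarrow> ('g, 'k::real_normed_vector) manifold
    \<Rightarrow> ('a, 'e::real_normed_vector) manifold \<Rightarrow> ('g \<Rightarrow> 'a \<Rightarrow> 'a)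
    \<Rightarrow> int \<Rightarrow> ('g, 'k, 'a, 'e) cochain set" where
  "coboundaries G L M \<phi> n = cartan_differential G L M \<phi> ` cochains G L M \<phi> (n - 1)"

definition equivariant_cohomology ::
  "'g monoid \<Rightarrow> ('g, 'k::real_normed_vector) manifold
    \<Rightarrow> ('a, 'e::real_normed_vector) manifold \<Rightarrow> ('g \<Rightarrow> 'a \<Rightarrow> 'a)
    \<Rightarrow> int \<Rightarrow> ('g, 'k, 'a, 'e) cochain set monoid" where
  "equivariant_cohomology G L M \<phi> n = cocycles G L M \<phi> n Mod coboundaries G L M \<phi> n"

definition cochain_pullback ::
  "('a, 'e::real_normed_vector) manifold \<Rightarrow> ('b, 'f::real_normed_vector) manifold
    \<Rightarrow> ('a \<Rightarrow> 'b) \<Rightarrow> ('g, 'k, 'b, 'f) cochain \<Rightarrow> ('g, 'k, 'a, 'e) cochain" where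
  "cochain_pullback M N f \<alpha> = (\<lambda>X. pullback M N f (\<alpha> X))"

text \<open>
  The class of \<open>\<alpha>\<close> is sent to the class of \<open>f\<^sup>*\<alpha>\<close>; as the latter does not depend on the
  representative, the union below is over a constant family.
\<close>

definition cohomology_pullback ::
  "'g monoid \<Rightarrow> ('g, 'k::real_normed_vector) manifold
    \<Rightarrow> ('a, 'e::real_normed_vector) manifold \<Rightarrow> ('g \<Rightarrow> 'a \<Rightarrow> 'a)
    \<Rightarrow> ('b, 'f::real_normed_vector) manifold \<Rightarrow> ('g \<Rightarrow> 'b \<Rightarrow> 'b) \<Rightarrow> ('a \<Rightarrow> 'b)
    \<Rightarrow> int \<Rightarrow> ('g, 'k, 'b, 'f) cochain set \<Rightarrow> ('g, 'k, 'a, 'e) cochain set" where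
  "cohomology_pullback G L M \<phi> N \<psi> f n =
     (\<lambda>K \<in> carrier (equivariant_cohomology G L N \<psi> n).
        \<Union>\<alpha>\<in>K. coboundaries G L M \<phi> n #>\<^bsub>cocycles G L M \<phi> n\<^esub> cochain_pullback M N f \<alpha>)"

end

theory Submission
  imports Defs
begin

text \<open>
  Let \<open>F\<close> be the homotopy. The homotopy operator sends a cochain \<open>\<alpha>\<close> to
  \<open>H \<alpha> = \<integral>\<^sub>0\<^sup>1 i\<^bsub>\<partial>/\<partial>t\<^esub> (F\<^sup>* \<alpha>) dt\<close>, a form on \<open>M\<close> that is integrated along the fibres of
  \<open>M \<times> \<real> \<rightarrow> M\<close>. In a chart, differentiation under the integral and the fundamental theorem of
  calculus give \<open>d H + H d = g\<^sup>* - f\<^sup>*\<close>. The fundamental field of \<open>M \<times> \<real>\<close> has no \<open>\<partial>/\<partial>t\<close>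
  component, so contraction with it anticommutes with \<open>H\<close>, and the same formula holds for the
  Cartan differential. As \<open>F\<close> is equivariant and \<open>\<partial>/\<partial>t\<close> is invariant, \<open>H\<close> preserves invariance.

  The fundamental fields are defined by the exponential map. That they are related under
  equivariant maps requires that \<open>t \<mapsto> exp (t X)\<close> is a smooth curve, i.e. the existence and
  uniqueness of one-parameter subgroups, which follow from the Picard theorem for left-invariant
  vector fields in a chart around the unit.

  A representative of a class differs from a cocycle by some \<open>d \<eta>\<close>. Since pullbacks commute with
  the differential, it is not necessary to know that \<open>d \<eta>\<close> is itself a cocycle.
\<close>

section \<open>Finite-dimensional normed spaces\<close>

text \<open>The model spaces are only known to be spanned by a finite set: they carry no given
  basis, their type does not supply completeness, and they may have dimension 0. Finite dimension
  therefore enters as \<open>coordinates\<close>, a basis \<open>b\<close> with bounded dual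
  functionals \<open>u\<close>. Expanding a moving vector in \<open>b\<close> reduces statements
  about moving directions to finitely many fixed ones; composition of smooth maps, smoothness of
  pulled-back forms and the product rule are obtained in this way. The second obstacle is that
  differentials and exterior derivatives are defined by an arbitrarily chosen chart. That
  \<open>ext_deriv\<close> does not depend on it is the case of the identity map in the
  compatibility of the local formula with pullbacks, \<open>lext_pull\<close>. Signs: d/dt occupies
  the first argument, so exchanging it with a fundamental field Y gives H i_Y = - i_Y H. For a
  cocycle, d \<alpha> = i_Y \<alpha>, hence H d \<alpha> = - i_Y H \<alpha>, and d H + H d applied
  to \<alpha> becomes (d - i_Y) H \<alpha>, the Cartan differential of H \<alpha>.\<close>

definition coordinates :: "nat \<Rightarrow> (nat \<Rightarrow> 'a::real_normed_vector) \<Rightarrow> (nat \<Rightarrow> 'a \<Rightarrow> real) \<Rightarrow> bool" where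
  "coordinates n b u \<longleftrightarrow> (\<forall>i<n. bounded_linear (u i)) \<and> (\<forall>x. (\<Sum>i<n. u i x *\<^sub>R b i) = x) \<and>
     (\<forall>i<n. \<forall>j<n. u i (b j) = (if i = j then 1 else 0))"

text \<open>This is the equivalence of norms in finite dimension. In the induction step, the bound
  for \<open>B\<close> makes the coefficients of a convergent sequence in \<open>span B\<close>
  Cauchy, so its limit lies in \<open>span B\<close> again. Hence \<open>a\<close> keeps a positive
  distance \<open>d\<close> from that subspace, and \<open>1 / d\<close> bounds the coefficient of
  \<open>a\<close>.\<close>

lemma coefficients_bounded:
  fixes B :: "'a::real_normed_vector set"
  assumes "finite B" "independent B"
  shows "\<exists>C>0. \<forall>w. \<forall>b\<in>B. \<bar>w b\<bar> \<le> C * norm (\<Sum>b\<in>B. w b *\<^sub>R b)"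
  using assms
proof (induction B rule: finite_induct)
  case empty
  then show ?case by (auto intro: exI[of _ 1])
next
  case (insert a B)
  then have iB: "independent B" and aB: "a \<notin> span B"
    by (auto simp: independent_insert)
  from insert.IH[OF iB] obtain C where C: "C > 0"
    "\<And>w b. b \<in> B \<Longrightarrow> \<bar>w b\<bar> \<le> C * norm (\<Sum>b\<in>B. w b *\<^sub>R b)" by blast
  have "\<exists>d>0. \<forall>y\<in>span B. d \<le> norm (a + y)"
  proof (rule ccontr)
    assume neg: "\<not> ?thesis"
    have "\<exists>y\<in>span B. norm (a + y) < inverse (real (Suc n))" for n
    proof -
      have "inverse (real (Suc n)) > 0" by simp
      then show ?thesis using neg by (meson not_le_imp_less)
    qed
    then obtain y where y: "\<And>n. y n \<in> span B" "\<And>n. norm (a + y n) < inverse (real (Suc n))" by metis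
    have "(\<lambda>n. norm (a + y n)) \<longlonglongrightarrow> 0"
      by (rule Lim_null_comparison[OF _ LIMSEQ_inverse_real_of_nat])
        (use y(2) in \<open>auto intro!: always_eventually less_imp_le\<close>)
    then have "(\<lambda>n. a + y n) \<longlonglongrightarrow> 0" by (simp add: tendsto_norm_zero_iff)
    then have "(\<lambda>n. (a + y n) - a) \<longlonglongrightarrow> 0 - a" by (intro tendsto_intros)
    then have ylim: "y \<longlonglongrightarrow> - a" by simp
    have "\<forall>n. \<exists>w. y n = (\<Sum>b\<in>B. w b *\<^sub>R b)"
      using y(1) span_finite[OF insert.hyps(1)] by auto
    then obtain w where w: "\<And>n. y n = (\<Sum>b\<in>B. w n b *\<^sub>R b)" by metis
    have Cau: "Cauchy (\<lambda>n. w n b)" if b: "b \<in> B" for b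
    proof (rule metric_CauchyI)
      fix e :: real assume e: "e > 0"
      have "Cauchy y" using ylim LIMSEQ_imp_Cauchy by blast
      then obtain M where M: "\<And>m n. m \<ge> M \<Longrightarrow> n \<ge> M \<Longrightarrow> dist (y m) (y n) < e / C"
        using e C(1) metric_CauchyD[of y "e / C"] by auto
      show "\<exists>M. \<forall>m\<ge>M. \<forall>n\<ge>M. dist (w m b) (w n b) < e"
      proof (intro exI[of _ M] allI impI)
        fix m n assume mn: "m \<ge> M" "n \<ge> M"
        have "(\<Sum>b\<in>B. (w m b - w n b) *\<^sub>R b) = y m - y n"
          by (simp add: w scaleR_diff_left sum_subtractf)
        then have "\<bar>w m b - w n b\<bar> \<le> C * dist (y m) (y n)"
          using C(2)[OF b, of "\<lambda>b. w m b - w n b"] by (simp add: dist_norm)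
        also have "\<dots> < C * (e / C)" using M[OF mn] C(1) by (intro mult_strict_left_mono)
        finally show "dist (w m b) (w n b) < e" using C(1) by (simp add: dist_real_def)
      qed
    qed
    define l where "l b = lim (\<lambda>n. w n b)" for b
    have l: "\<And>b. b \<in> B \<Longrightarrow> (\<lambda>n. w n b) \<longlonglongrightarrow> l b"
      using real_Cauchy_convergent[OF Cau] by (simp add: l_def convergent_LIMSEQ_iff)
    have "y \<longlonglongrightarrow> (\<Sum>b\<in>B. l b *\<^sub>R b)"
      unfolding w[abs_def] by (intro tendsto_sum tendsto_scaleR l tendsto_const)
    then have "- a = (\<Sum>b\<in>B. l b *\<^sub>R b)" using ylim LIMSEQ_unique by blast
    then have "- a \<in> span B" by (simp add: span_sum span_scale span_base)
    then show False using aB span_neg[of "-a" B] by simp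
  qed
  then obtain d where d: "d > 0" "\<And>y. y \<in> span B \<Longrightarrow> d \<le> norm (a + y)" by blast
  \<comment> \<open>\<open>1 / d\<close> serves for the coefficient of \<open>a\<close>. For the
    others the multiple of \<open>a\<close> is first subtracted, which costs the factor
    \<open>1 + norm a / d\<close>. The sum of the two bounds covers both cases.\<close>
  define C' where "C' = 1 / d + C * (1 + norm a / d)"
  have C'1: "1 / d \<le> C'" and C'2: "C * (1 + norm a / d) \<le> C'" "C' > 0"
    using C(1) d(1) by (auto simp: C'_def intro!: add_pos_pos mult_pos_pos add_pos_nonneg
        mult_nonneg_nonneg)
  show ?case
  proof (intro exI[of _ C'] conjI C'2 allI ballI)
    fix w c assume c: "c \<in> insert a B"
    define y where "y = (\<Sum>b\<in>B. w b *\<^sub>R b)"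
    have yB: "y \<in> span B" unfolding y_def by (simp add: span_sum span_scale span_base)
    have s: "(\<Sum>b\<in>insert a B. w b *\<^sub>R b) = w a *\<^sub>R a + y"
      using insert.hyps by (simp add: y_def)
    have wa: "\<bar>w a\<bar> * d \<le> norm (w a *\<^sub>R a + y)"
    proof (cases "w a = 0")
      case False
      have "\<bar>w a\<bar> * d \<le> \<bar>w a\<bar> * norm (a + (1 / w a) *\<^sub>R y)"
        using d(2)[of "(1 / w a) *\<^sub>R y"] yB by (intro mult_left_mono) (auto simp: span_scale)
      also have "\<dots> = norm (w a *\<^sub>R (a + (1 / w a) *\<^sub>R y))" by simp
      also have "w a *\<^sub>R (a + (1 / w a) *\<^sub>R y) = w a *\<^sub>R a + y"
        using False by (simp add: scaleR_add_right)
      finally show ?thesis .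
    qed auto
    then have wa': "\<bar>w a\<bar> \<le> (1 / d) * norm (w a *\<^sub>R a + y)" using d(1) by (simp add: field_simps)
    show "\<bar>w c\<bar> \<le> C' * norm (\<Sum>b\<in>insert a B. w b *\<^sub>R b)"
    proof (cases "c = a")
      case True
      then show ?thesis
        unfolding s using wa' mult_right_mono[OF C'1 norm_ge_zero] order_trans by blast
    next
      case False
      then have "\<bar>w c\<bar> \<le> C * norm y" using C(2) c unfolding y_def by blast
      also have "norm y \<le> norm (w a *\<^sub>R a + y) + norm (w a *\<^sub>R a)"
        by (metis add_diff_cancel_left' norm_triangle_ineq4)
      also have "norm (w a *\<^sub>R a) \<le> (1 / d) * norm (w a *\<^sub>R a + y) * norm a"
        using mult_right_mono[OF wa' norm_ge_zero] by simp
      finally have "\<bar>w c\<bar> \<le> C * (1 + norm a / d) * norm (w a *\<^sub>R a + y)"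
        using C(1) by (simp add: field_simps)
      then show ?thesis unfolding s using mult_right_mono[OF C'2(1) norm_ge_zero] order_trans
          by blast
    qed
  qed
qed

text \<open>The functionals are the coefficients with respect to a maximal independent subset of the
  spanning set; \<open>coefficients_bounded\<close> makes them bounded.\<close>

lemma finite_span_coordinates:
  fixes B :: "'a::real_normed_vector set"
  assumes "finite B" "span B = UNIV"
  shows "\<exists>n b (u :: nat \<Rightarrow> 'a \<Rightarrow> real). coordinates n b u"
proof -
  obtain B' where B': "B' \<subseteq> B" "independent B'" "B \<subseteq> span B'"
    using maximal_independent_subset[of B] by blast
  then have fin: "finite B'" using assms(1) finite_subset by blast
  have sp: "span B' = UNIV" using assms(2) B'(3) by (metis span_mono span_span top.extremum_uniqueI)
  obtain C where C: "C > 0" "\<And>w b. b \<in> B' \<Longrightarrow> \<bar>w b\<bar> \<le> C * norm (\<Sum>b\<in>B'. w b *\<^sub>R b)"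
    using coefficients_bounded[OF fin B'(2)] by blast
  have rep: "(\<Sum>b\<in>B'. representation B' x b *\<^sub>R b) = x" for x
    using real_vector.sum_representation_eq[OF B'(2) _ fin subset_refl, of x] sp by simp
  obtain h where h: "bij_betw h {0..<card B'} B'" using ex_bij_betw_nat_finite[OF fin] by blast
  have hB: "h i \<in> B'" if "i < card B'" for i using h that by (auto simp: bij_betw_def)
  have "coordinates (card B') h (\<lambda>i x. representation B' x (h i))"
    unfolding coordinates_def
  proof (intro conjI allI impI)
    fix i assume i: "i < card B'"
    show "bounded_linear (\<lambda>x. representation B' x (h i))"
    proof (rule bounded_linear_intro[where K = C])
      show "norm (representation B' x (h i)) \<le> norm x * C" for x
        using C(2)[OF hB[OF i], of "representation B' x"] rep[of x] by (simp add: mult.commute)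
    qed (use B'(2) sp in \<open>auto simp: real_vector.representation_add
        real_vector.representation_scale\<close>)
  next
    fix x
    have "(\<Sum>i<card B'. representation B' x (h i) *\<^sub>R h i) = (\<Sum>b\<in>B'. representation B' x b *\<^sub>R b)"
      using sum.reindex_bij_betw[OF h, of "\<lambda>b. representation B' x b *\<^sub>R b"]
          by (simp add: atLeast0LessThan)
    then show "(\<Sum>i<card B'. representation B' x (h i) *\<^sub>R h i) = x" using rep by simp
  next
    fix i j assume ij: "i < card B'" "j < card B'"
    have "h i = h j \<longleftrightarrow> i = j" using h ij by (auto simp: bij_betw_def inj_on_def)
    then show "representation B' (h j) (h i) = (if i = j then 1 else 0)"
      using real_vector.representation_basis[OF B'(2) hB[OF ij(2)]] by auto
  qed
  then show ?thesis by blast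
qed

lemma coordinates_bounded_linear: "coordinates n b u \<Longrightarrow> i < n \<Longrightarrow> bounded_linear (u i)"
  by (simp add: coordinates_def)

lemma coordinates_sum: "coordinates n b u \<Longrightarrow> (\<Sum>i<n. u i x *\<^sub>R b i) = x"
  by (simp add: coordinates_def)

lemma coordinates_linear_apply:
  assumes "coordinates n b u" "linear f"
  shows "f x = (\<Sum>i<n. u i x *\<^sub>R f (b i))"
proof -
  have "f x = f (\<Sum>i<n. u i x *\<^sub>R b i)" using coordinates_sum[OF assms(1)] by simp
  also have "\<dots> = (\<Sum>i<n. u i x *\<^sub>R f (b i))" by (simp add: linear_sum[OF assms(2)]
      linear_scale[OF assms(2)])
  finally show ?thesis .
qed

lemma coordinates_norm_bound:
  assumes "coordinates n b u"
  shows "\<exists>K>0. \<forall>x. (\<Sum>i<n. \<bar>u i x\<bar>) \<le> K * norm x"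
proof -
  have "\<exists>K\<ge>0. \<forall>x. \<bar>u i x\<bar> \<le> norm x * K" if "i < n" for i
    using bounded_linear.nonneg_bounded[OF coordinates_bounded_linear[OF assms that]] by simp
  then obtain K where K: "\<And>i x. i < n \<Longrightarrow> \<bar>u i x\<bar> \<le> norm x * K i" "\<And>i. i < n \<Longrightarrow> K i \<ge> 0" by metis
  \<comment> \<open>The summand 1 keeps the constant positive in dimension 0 as well, where the sum
    of the \<open>K i\<close> is empty.\<close>
  have "(\<Sum>i<n. \<bar>u i x\<bar>) \<le> ((\<Sum>i<n. K i) + 1) * norm x" for x
  proof -
    have "(\<Sum>i<n. \<bar>u i x\<bar>) \<le> (\<Sum>i<n. norm x * K i)" using K(1) by (intro sum_mono) auto
    also have "\<dots> \<le> ((\<Sum>i<n. K i) + 1) * norm x" by (simp add: sum_distrib_left distrib_left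
        distrib_right mult.commute)
    finally show ?thesis .
  qed
  moreover have "(\<Sum>i<n. K i) + 1 > 0" using sum_nonneg[of "{..<n}" K] K(2)
      by (simp add: add_nonneg_pos)
  ultimately show ?thesis by blast
qed


section \<open>Smooth functions\<close>

abbreviation fderiv :: "('a::real_normed_vector \<Rightarrow> 'b::real_normed_vector) \<Rightarrow> 'a \<Rightarrow> 'a \<Rightarrow> 'b" where
  "fderiv f x \<equiv> frechet_derivative f (at x)"

lemma fderiv_has: "f differentiable (at x) \<Longrightarrow> (f has_derivative fderiv f x) (at x)"
  by (simp add: frechet_derivative_works)

lemma fderiv_eq: "(f has_derivative f') (at x) \<Longrightarrow> fderiv f x = f'"
  by (simp add: frechet_derivative_at[symmetric])

lemma has_derivative_cong_open:
  "open S \<Longrightarrow> x \<in> S \<Longrightarrow> (\<And>y. y \<in> S \<Longrightarrow> f y = g y) \<Longrightarrow>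
     (f has_derivative f') (at x) \<longleftrightarrow> (g has_derivative f') (at x)"
  by (metis has_derivative_transform_within_open)

lemma fderiv_cong_open:
  assumes "open S" "x \<in> S" "\<And>y. y \<in> S \<Longrightarrow> f y = g y"
  shows "fderiv f x = fderiv g x"
  using has_derivative_cong_open[OF assms] unfolding frechet_derivative_def by simp

lemma differentiable_cong_open:
  assumes "open S" "x \<in> S" "\<And>y. y \<in> S \<Longrightarrow> f y = g y"
  shows "f differentiable (at x) \<longleftrightarrow> g differentiable (at x)"
  using has_derivative_cong_open[OF assms] unfolding differentiable_def by simp

lemma linear_fderiv: "f differentiable (at x) \<Longrightarrow> linear (fderiv f x)"
  by (rule linear_frechet_derivative)

lemma fderiv_compose:
  assumes "g differentiable (at x)" "f differentiable (at (g x))"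
  shows "fderiv (\<lambda>x. f (g x)) x v = fderiv f (g x) (fderiv g x v)"
  using frechet_derivative_compose[OF assms] by (simp add: o_def fun_eq_iff)

lemma differentiable_compose2:
  "g differentiable (at x) \<Longrightarrow> f differentiable (at (g x)) \<Longrightarrow> (\<lambda>x. f (g x)) differentiable (at x)"
  using differentiable_chain_at[of g x f] by (simp add: o_def)

section \<open>Closure properties of C^k functions\<close>

lemma Ck_on_cong:
  assumes "open S" "\<And>x. x \<in> S \<Longrightarrow> f x = g x" "Ck_on k S f"
  shows "Ck_on k S g"
  using assms(2,3)
proof (induction k arbitrary: f g)
  case 0
  then show ?case using continuous_on_cong[of S S f g] by simp
next
  case (Suc k)
  have "g differentiable (at x)" if "x \<in> S" for x
    using Suc.prems differentiable_cong_open[OF assms(1) that, of f g] that by auto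
  moreover have "Ck_on k S (\<lambda>x. fderiv g x v)" for v
    by (rule Suc.IH[of "\<lambda>x. fderiv f x v"])
      (use Suc.prems fderiv_cong_open[OF assms(1), of _ f g] in auto)
  ultimately show ?case by simp
qed

lemma Ck_on_subset: "Ck_on k S f \<Longrightarrow> T \<subseteq> S \<Longrightarrow> Ck_on k T f"
  by (induction k arbitrary: f) (auto intro: continuous_on_subset)

lemma Ck_on_Suc_imp: "Ck_on (Suc k) S f \<Longrightarrow> Ck_on k S f"
proof (induction k arbitrary: f)
  case 0
  then show ?case
    by (auto intro!: continuous_at_imp_continuous_on differentiable_imp_continuous_within)
next
  case (Suc k)
  then show ?case by (metis Ck_on.simps(2))
qed

text \<open>Derivatives in \<open>Ck_on\<close> are taken in the whole space and not within
  \<open>S\<close>, so only the continuity at the last order refers to a set, and there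
  neighbourhoods suffice.\<close>

lemma Ck_on_local:
  assumes "\<And>x. x \<in> S \<Longrightarrow> \<exists>T. open T \<and> x \<in> T \<and> Ck_on k T f"
  shows "Ck_on k S f"
  using assms
proof (induction k arbitrary: f)
  case 0
  then show ?case
    by (auto intro!: continuous_at_imp_continuous_on simp: continuous_on_eq_continuous_at)
      (meson continuous_on_eq_continuous_at)
next
  case (Suc k)
  then show ?case by (metis Ck_on.simps(2))
qed

lemma Ck_on_const: "Ck_on k S (\<lambda>x. c)"
  by (induction k arbitrary: c) auto

lemma Ck_on_linear: "bounded_linear L \<Longrightarrow> Ck_on k S L"
proof (cases k)
  case 0
  assume "bounded_linear L"
  then show ?thesis using 0 by (simp add: linear_continuous_on)
next
  case (Suc m)
  assume L: "bounded_linear L"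
  have d: "(L has_derivative L) (at x)" for x
    using L by (simp add: bounded_linear_imp_has_derivative)
  then have "fderiv L x = L" for x by (rule fderiv_eq)
  then show ?thesis using Suc d by (auto simp: Ck_on_const differentiable_def)
qed

lemma Ck_on_bounded_linear_compose:
  assumes "bounded_linear L" "open S" "Ck_on k S f"
  shows "Ck_on k S (\<lambda>x. L (f x))"
  using assms(3)
proof (induction k arbitrary: f)
  case 0
  then show ?case using bounded_linear.continuous_on[OF assms(1)] by simp
next
  case (Suc k)
  have d: "((\<lambda>x. L (f x)) has_derivative (\<lambda>v. L (fderiv f x v))) (at x)" if "x \<in> S" for x
    by (intro bounded_linear.has_derivative[OF assms(1)] fderiv_has) (use Suc.prems that in auto)
  have "Ck_on k S (\<lambda>x. fderiv (\<lambda>x. L (f x)) x v)" for v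
    by (rule Ck_on_cong[OF assms(2), of "\<lambda>x. L (fderiv f x v)"])
      (use Suc fderiv_eq[OF d] in auto)
  then show ?case using d by (auto simp: differentiable_def)
qed

lemma Ck_on_add:
  assumes "open S" "Ck_on k S f" "Ck_on k S g"
  shows "Ck_on k S (\<lambda>x. f x + g x)"
  using assms(2,3)
proof (induction k arbitrary: f g)
  case 0
  then show ?case by (auto intro: continuous_on_add)
next
  case (Suc k)
  have d: "((\<lambda>x. f x + g x) has_derivative (\<lambda>v. fderiv f x v + fderiv g x v)) (at x)" if "x \<in> S"
      for x
    by (intro has_derivative_add fderiv_has) (use Suc.prems that in auto)
  have "Ck_on k S (\<lambda>x. fderiv (\<lambda>x. f x + g x) x v)" for v
    by (rule Ck_on_cong[OF assms(1), of "\<lambda>x. fderiv f x v + fderiv g x v"])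
      (use Suc fderiv_eq[OF d] in auto)
  then show ?case using d by (auto simp: differentiable_def)
qed

lemma Ck_on_sum:
  assumes "open S" "\<And>i. i \<in> I \<Longrightarrow> Ck_on k S (f i)"
  shows "Ck_on k S (\<lambda>x. \<Sum>i\<in>I. f i x)"
  using assms(2)
  by (induction I rule: infinite_finite_induct) (auto intro: Ck_on_const Ck_on_add[OF assms(1)])

lemma Ck_on_bilinear:
  assumes "bounded_bilinear B" "open S" "Ck_on k S f" "Ck_on k S g"
  shows "Ck_on k S (\<lambda>x. B (f x) (g x))"
  using assms(3,4)
proof (induction k arbitrary: f g)
  case 0
  then show ?case using bounded_bilinear.continuous_on[OF assms(1)] by simp
next
  case (Suc k)
  have d: "((\<lambda>x. B (f x) (g x)) has_derivative (\<lambda>v. B (f x) (fderiv g x v)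
      + B (fderiv f x v) (g x))) (at x)"
    if "x \<in> S" for x
    by (intro bounded_bilinear.FDERIV[OF assms(1)] fderiv_has) (use Suc.prems that in auto)
  have "Ck_on k S (\<lambda>x. fderiv (\<lambda>x. B (f x) (g x)) x v)" for v
    by (rule Ck_on_cong[OF assms(2), of "\<lambda>x. B (f x) (fderiv g x v) + B (fderiv f x v) (g x)"])
      (use fderiv_eq[OF d] Suc.prems Ck_on_Suc_imp[OF Suc.prems(1)] Ck_on_Suc_imp[OF Suc.prems(2)]
        in \<open>auto intro!: Ck_on_add[OF assms(2)] Suc.IH\<close>)
  then show ?case using d by (auto simp: differentiable_def)
qed

text \<open>\<open>Ck_on\<close> asks for derivatives in fixed directions, whereas the chain rule
  differentiates \<open>g\<close> in the direction \<open>fderiv f x v\<close>, which moves with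
  \<open>x\<close>. Expanded in a basis, this direction becomes finitely many fixed ones with C^k
  coefficients, and the induction hypothesis applies to the derivatives of \<open>g\<close> along
  the basis vectors.\<close>

lemma Ck_on_compose:
  fixes f :: "'a::real_normed_vector \<Rightarrow> 'b::real_normed_vector"
      and g :: "'b \<Rightarrow> 'c::real_normed_vector"
    and u :: "nat \<Rightarrow> 'b \<Rightarrow> real"
  assumes c: "coordinates n b u" and "open S" "open T" "f ` S \<subseteq> T" "Ck_on k S f" "Ck_on k T g"
  shows "Ck_on k S (\<lambda>x. g (f x))"
  using assms(5,6)
proof (induction k arbitrary: g)
  case 0
  then show ?case using assms(4) continuous_on_compose2 by auto
next
  case (Suc k)
  have df: "f differentiable (at x)" and dg: "g differentiable (at (f x))" if "x \<in> S" for x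
    using Suc.prems assms(4) that by auto
  have e: "fderiv (\<lambda>x. g (f x)) x v = (\<Sum>i<n. u i (fderiv f x v) *\<^sub>R fderiv g (f x) (b i))"
    if "x \<in> S" for x v
    unfolding fderiv_compose[OF df[OF that] dg[OF that]]
    by (rule coordinates_linear_apply[OF c linear_fderiv[OF dg[OF that]]])
  have "Ck_on k S (\<lambda>x. fderiv (\<lambda>x. g (f x)) x v)" for v
  proof (rule Ck_on_cong[OF assms(2)])
    show "Ck_on k S (\<lambda>x. \<Sum>i<n. u i (fderiv f x v) *\<^sub>R fderiv g (f x) (b i))"
      by (intro Ck_on_sum[OF assms(2)] Ck_on_bilinear[OF bounded_bilinear_scaleR assms(2)]
          Ck_on_bounded_linear_compose[OF coordinates_bounded_linear[OF c] assms(2)] Suc.IH)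
        (use Suc.prems Ck_on_Suc_imp in auto)
  qed (use e in auto)
  then show ?case using differentiable_compose2[OF df dg] by simp
qed

section \<open>Closure properties of smooth functions\<close>

lemma smooth_on_cong: "open S \<Longrightarrow> (\<And>x. x \<in> S \<Longrightarrow> f x = g x) \<Longrightarrow> smooth_on S f \<Longrightarrow> smooth_on S g"
  unfolding smooth_on_def using Ck_on_cong by blast

lemma smooth_on_subset: "smooth_on S f \<Longrightarrow> T \<subseteq> S \<Longrightarrow> smooth_on T f"
  unfolding smooth_on_def using Ck_on_subset by blast

lemma smooth_on_local:
  "(\<And>x. x \<in> S \<Longrightarrow> \<exists>T. open T \<and> x \<in> T \<and> smooth_on T f) \<Longrightarrow> smooth_on S f"
  unfolding smooth_on_def by (meson Ck_on_local)

lemma smooth_on_const: "smooth_on S (\<lambda>x. c)"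
  unfolding smooth_on_def using Ck_on_const by blast

lemma smooth_on_linear: "bounded_linear L \<Longrightarrow> smooth_on S L"
  unfolding smooth_on_def using Ck_on_linear by blast

lemma smooth_on_ident: "smooth_on S (\<lambda>x. x)"
  using smooth_on_linear[OF bounded_linear_ident] .

lemma smooth_on_linear_compose:
  "bounded_linear L \<Longrightarrow> open S \<Longrightarrow> smooth_on S f \<Longrightarrow> smooth_on S (\<lambda>x. L (f x))"
  unfolding smooth_on_def using Ck_on_bounded_linear_compose by blast

lemma smooth_on_add: "open S \<Longrightarrow> smooth_on S f \<Longrightarrow> smooth_on S g \<Longrightarrow> smooth_on S (\<lambda>x. f x + g x)"
  unfolding smooth_on_def using Ck_on_add by blast

lemma smooth_on_sum:
  "open S \<Longrightarrow> (\<And>i. i \<in> I \<Longrightarrow> smooth_on S (f i)) \<Longrightarrow> smooth_on S (\<lambda>x. \<Sum>i\<in>I. f i x)"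
  unfolding smooth_on_def using Ck_on_sum[of S I] by blast

lemma smooth_on_scaleR:
  "open S \<Longrightarrow> smooth_on S f \<Longrightarrow> smooth_on S g \<Longrightarrow> smooth_on S (\<lambda>x. f x *\<^sub>R g x)"
  unfolding smooth_on_def using Ck_on_bilinear[OF bounded_bilinear_scaleR] by blast

lemma smooth_on_compose:
  fixes f :: "'a::real_normed_vector \<Rightarrow> 'b::real_normed_vector" and u :: "nat \<Rightarrow> 'b \<Rightarrow> real"
  shows
  "coordinates n b u \<Longrightarrow> open S \<Longrightarrow> open T \<Longrightarrow> f ` S \<subseteq> T \<Longrightarrow> smooth_on S f \<Longrightarrow> smooth_on T g
     \<Longrightarrow> smooth_on S (\<lambda>x. g (f x))"
  unfolding smooth_on_def using Ck_on_compose[of n b u S T f _ g] by simp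

lemma smooth_on_Pair:
  assumes "open S" "smooth_on S f" "smooth_on S g"
  shows "smooth_on S (\<lambda>x. (f x, g x))"
proof -
  have "smooth_on S (\<lambda>x. (f x, 0) + (0, g x))"
    by (intro smooth_on_add assms
        smooth_on_linear_compose[where L = "\<lambda>y. (y, 0)"] smooth_on_linear_compose[where L =
            "\<lambda>y. (0, y)"])
      (auto intro!: bounded_linear_Pair bounded_linear_ident bounded_linear_zero)
  then show ?thesis by simp
qed

lemma smooth_on_fst: "open S \<Longrightarrow> smooth_on S f \<Longrightarrow> smooth_on S (\<lambda>x. fst (f x))"
  by (rule smooth_on_linear_compose[OF bounded_linear_fst])

lemma smooth_on_snd: "open S \<Longrightarrow> smooth_on S f \<Longrightarrow> smooth_on S (\<lambda>x. snd (f x))"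
  by (rule smooth_on_linear_compose[OF bounded_linear_snd])

lemma smooth_on_differentiable: "smooth_on S f \<Longrightarrow> x \<in> S \<Longrightarrow> f differentiable (at x)"
  unfolding smooth_on_def by (metis Ck_on.simps(2))

lemma smooth_on_fderiv: "smooth_on S f \<Longrightarrow> smooth_on S (\<lambda>x. fderiv f x v)"
  unfolding smooth_on_def by (metis Ck_on.simps(2))

lemma smooth_on_continuous: "smooth_on S f \<Longrightarrow> continuous_on S f"
  unfolding smooth_on_def by (metis Ck_on.simps(1))

section \<open>Mean value arguments and the symmetry of second derivatives\<close>

lemma has_vector_derivative_along:
  assumes "f differentiable (at (p + s *\<^sub>R v))"
  shows "((\<lambda>s. f (p + s *\<^sub>R v)) has_vector_derivative fderiv f (p + s *\<^sub>R v) v) (at s)"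
proof -
  have "((\<lambda>s. p + s *\<^sub>R v) has_derivative (\<lambda>h. h *\<^sub>R v)) (at s)"
    by (auto intro!: derivative_eq_intros)
  from diff_chain_at[OF this fderiv_has[OF assms]]
  show ?thesis
    unfolding has_vector_derivative_def o_def
    by (simp add: linear_scale[OF linear_fderiv[OF assms]])
qed

lemma has_real_derivative_along:
  fixes f :: "'a::real_normed_vector \<Rightarrow> real"
  assumes "f differentiable (at (p + s *\<^sub>R v))"
  shows "((\<lambda>s. f (p + s *\<^sub>R v)) has_real_derivative fderiv f (p + s *\<^sub>R v) v) (at s)"
  using has_vector_derivative_along[OF assms] by (simp add:
      has_real_derivative_iff_has_vector_derivative)

text \<open>The mean value theorem is applied twice: along \<open>u\<close> to the increment of
  \<open>f\<close> in the direction \<open>v\<close>, then along \<open>v\<close> to the derivative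
  of \<open>f\<close> in the direction \<open>u\<close>. The bound on \<open>h\<close> keeps the
  parallelogram spanned by \<open>h *\<^sub>R u\<close> and \<open>h *\<^sub>R v\<close> inside the
  ball.\<close>

lemma second_difference_mvt:
  fixes f :: "'a::real_normed_vector \<Rightarrow> real"
  assumes f: "smooth_on S f" and h: "h > 0" "h * (norm u + norm v) < d" and S: "ball x d \<subseteq> S"
  shows "\<exists>y\<in>ball x d. f (x + h *\<^sub>R u + h *\<^sub>R v) - f (x + h *\<^sub>R u) - f (x + h *\<^sub>R v) + f x
    = h * h * fderiv (\<lambda>y. fderiv f y u) y v"
proof -
  have ib: "x + s *\<^sub>R u + t *\<^sub>R v \<in> ball x d" if "0 \<le> s" "s \<le> h" "0 \<le> t" "t \<le> h" for s t
  proof -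
    have "norm (s *\<^sub>R u + t *\<^sub>R v) \<le> s * norm u + t * norm v"
      using that norm_triangle_ineq[of "s *\<^sub>R u" "t *\<^sub>R v"] by simp
    also have "\<dots> \<le> h * (norm u + norm v)"
      using that by (simp add: distrib_left add_mono mult_right_mono)
    finally have "norm (s *\<^sub>R u + t *\<^sub>R v) < d" using h(2) by simp
    then have "dist (x + (s *\<^sub>R u + t *\<^sub>R v)) x < d" by (simp add: dist_norm)
    then show ?thesis by (simp add: dist_commute add.assoc)
  qed
  have df: "f differentiable (at y)" "(\<lambda>y. fderiv f y u) differentiable (at y)" if "y \<in> ball x d"
      for y
    using S that f smooth_on_differentiable smooth_on_fderiv by blast+
  define g where "g = (\<lambda>s. f (x + s *\<^sub>R u + h *\<^sub>R v) - f (x + s *\<^sub>R u))"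
  have "(g has_real_derivative fderiv f (x + s *\<^sub>R u + h *\<^sub>R v) u - fderiv f (x
      + s *\<^sub>R u) u) (at s)"
    if "0 \<le> s" "s \<le> h" for s
    unfolding g_def
    using has_real_derivative_along[of f "x + h *\<^sub>R v" s u] has_real_derivative_along[of f x s u]
      df(1)[OF ib[OF that, of h]] df(1)[OF ib[OF that, of 0]] h(1)
    by (auto intro!: DERIV_diff simp: add_ac)
  from MVT2[OF h(1) this]
  obtain s where s: "0 < s" "s < h"
    "g h - g 0 = h * (fderiv f (x + s *\<^sub>R u + h *\<^sub>R v) u - fderiv f (x + s *\<^sub>R u) u)"
    by auto
  have "((\<lambda>t. fderiv f (x + s *\<^sub>R u + t *\<^sub>R v) u) has_real_derivative
      fderiv (\<lambda>y. fderiv f y u) (x + s *\<^sub>R u + t *\<^sub>R v) v) (at t)" if "0 \<le> t" "t \<le> h" for t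
    using has_real_derivative_along[of "\<lambda>y. fderiv f y u"
        "x + s *\<^sub>R u" t v] df(2)[OF ib[of s t]] s that
    by auto
  from MVT2[OF h(1) this]
  obtain t where t: "0 < t" "t < h" "fderiv f (x + s *\<^sub>R u + h *\<^sub>R v) u - fderiv f (x + s *\<^sub>R u) u
     = h * fderiv (\<lambda>y. fderiv f y u) (x + s *\<^sub>R u + t *\<^sub>R v) v"
    by auto
  show ?thesis
    by (rule bexI[of _ "x + s *\<^sub>R u + t *\<^sub>R v"])
      (use s t ib[of s t] in \<open>auto simp: g_def algebra_simps\<close>)
qed

text \<open>The second difference is symmetric in \<open>u\<close> and \<open>v\<close>, so the two
  mixed derivatives take a common value at points \<open>y\<close> and \<open>z\<close> arbitrarily
  close to \<open>x\<close>. If they differed at \<open>x\<close>, continuity would keep their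
  values near \<open>x\<close> apart.\<close>

lemma fderiv_symmetric_real:
  fixes f :: "'a::real_normed_vector \<Rightarrow> real"
  assumes S: "open S" "x \<in> S" and f: "smooth_on S f"
  shows "fderiv (\<lambda>y. fderiv f y u) x v = fderiv (\<lambda>y. fderiv f y v) x u"
proof (rule ccontr)
  define a where "a = (\<lambda>y. fderiv (\<lambda>y. fderiv f y u) y v)"
  define b where "b = (\<lambda>y. fderiv (\<lambda>y. fderiv f y v) y u)"
  assume "\<not> ?thesis"
  then have e: "\<bar>a x - b x\<bar> / 2 > 0" by (simp add: a_def b_def)
  have "continuous (at x) a" "continuous (at x) b"
    using smooth_on_continuous[OF smooth_on_fderiv[OF smooth_on_fderiv[OF f]]] S
    unfolding a_def b_def by (auto simp: continuous_on_eq_continuous_at)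
  then have "\<exists>d1>0. \<forall>y. dist y x < d1 \<longrightarrow> dist (a y) (a x) < \<bar>a x - b x\<bar> / 2"
    "\<exists>d2>0. \<forall>y. dist y x < d2 \<longrightarrow> dist (b y) (b x) < \<bar>a x - b x\<bar> / 2"
    using e unfolding continuous_at_eps_delta by blast+
  then obtain d1 d2 where d12: "d1 > 0" "\<And>y. dist y x < d1 \<Longrightarrow> dist (a y) (a x) < \<bar>a x - b x\<bar> / 2"
    "d2 > 0" "\<And>y. dist y x < d2 \<Longrightarrow> dist (b y) (b x) < \<bar>a x - b x\<bar> / 2"
    by auto
  obtain d3 where d3: "d3 > 0" "ball x d3 \<subseteq> S" using S open_contains_ball by blast
  define d where "d = min d1 (min d2 d3)"
  have d: "d > 0" "ball x d \<subseteq> S" using d12 d3 by (auto simp: d_def)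
  \<comment> \<open>The summand 1 avoids a division by 0 when both directions vanish, and the factor
    2 makes the required inequality strict.\<close>
  define h where "h = d / (2 * (norm u + norm v + 1))"
  have pos: "norm u + norm v + 1 > 0" by (simp add: add_nonneg_pos)
  have h: "h > 0" using d(1) pos by (simp add: h_def)
  have "h * (norm u + norm v) \<le> h * (norm u + norm v + 1)" using h by simp
  also have "\<dots> = d / 2" unfolding h_def using pos by (simp only: times_divide_eq_left)
      (simp add: field_simps)
  finally have h: "h > 0" "h * (norm u + norm v) < d" using d(1) h by auto
  obtain y where y: "y \<in> ball x d"
    "f (x + h *\<^sub>R u + h *\<^sub>R v) - f (x + h *\<^sub>R u) - f (x + h *\<^sub>R v) + f x = h * h * a y"
    using second_difference_mvt[OF f h d(2)] unfolding a_def by blast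
  obtain z where z: "z \<in> ball x d"
    "f (x + h *\<^sub>R v + h *\<^sub>R u) - f (x + h *\<^sub>R v) - f (x + h *\<^sub>R u) + f x = h * h * b z"
    using second_difference_mvt[OF f h(1) _ d(2), of v u] h(2) unfolding b_def
        by (auto simp: add.commute)
  have "h * h * a y = h * h * b z" using y(2) z(2) by (simp add: algebra_simps)
  then have "a y = b z" using h(1) by simp
  moreover have "dist (a y) (a x) < \<bar>a x - b x\<bar> / 2" "dist (b z) (b x) < \<bar>a x - b x\<bar> / 2"
    using d12(2)[of y] d12(4)[of z] y(1) z(1) by (auto simp: d_def dist_commute)
  ultimately show False by (auto simp: dist_real_def abs_if split: if_splits)
qed

lemma fderiv_bounded_linear_compose:
  "bounded_linear L \<Longrightarrow> f differentiable (at x) \<Longrightarrow> fderiv (\<lambda>y. L (f y)) x v = L (fderiv f x v)"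
  using bounded_linear.has_derivative[OF _ fderiv_has] fderiv_eq by fastforce

lemma fderiv_symmetric:
  fixes f :: "'a::real_normed_vector \<Rightarrow> 'b::real_normed_vector" and w :: "nat \<Rightarrow> 'b \<Rightarrow> real"
  assumes c: "coordinates n b w" and S: "open S" "x \<in> S" and f: "smooth_on S f"
  shows "fderiv (\<lambda>y. fderiv f y u) x v = fderiv (\<lambda>y. fderiv f y v) x u"
proof -
  have wi: "w i (fderiv (\<lambda>y. fderiv f y u) x v) = fderiv (\<lambda>y. fderiv (\<lambda>y. w i (f y)) y u) x v"
    if "i < n" for i u v
  proof -
    note L = coordinates_bounded_linear[OF c that]
    have "fderiv (\<lambda>y. fderiv (\<lambda>y. w i (f y)) y u) x v = fderiv (\<lambda>y. w i (fderiv f y u)) x v"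
      by (subst fderiv_cong_open[OF S, of _ "\<lambda>y. w i (fderiv f y u)"])
        (auto simp: fderiv_bounded_linear_compose[OF L] smooth_on_differentiable[OF f])
    also have "\<dots> = w i (fderiv (\<lambda>y. fderiv f y u) x v)"
      using fderiv_bounded_linear_compose[OF L smooth_on_differentiable[OF smooth_on_fderiv[OF f]
          S(2)]] .
    finally show ?thesis by simp
  qed
  have "fderiv (\<lambda>y. fderiv f y u) x v = (\<Sum>i<n. w i (fderiv (\<lambda>y. fderiv f y u) x v) *\<^sub>R b i)"
    using coordinates_sum[OF c] by simp
  also have "\<dots> = (\<Sum>i<n. w i (fderiv (\<lambda>y. fderiv f y v) x u) *\<^sub>R b i)"
    using wi fderiv_symmetric_real[OF S smooth_on_linear_compose[OF coordinates_bounded_linear[OF c]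
        S(1) f]]
    by (intro sum.cong) auto
  also have "\<dots> = fderiv (\<lambda>y. fderiv f y v) x u" using coordinates_sum[OF c] by simp
  finally show ?thesis .
qed

section \<open>Differentiation under the integral sign\<close>

lemma continuous_on_slice:
  assumes "smooth_on (U \<times> UNIV) h" "x \<in> U"
  shows "continuous_on T (\<lambda>t. h (x, t))"
  by (rule continuous_on_compose2[OF smooth_on_continuous[OF assms(1)]])
    (use assms(2) in \<open>auto intro!: continuous_intros\<close>)

text \<open>At a fixed \<open>t\<close>, the mean value theorem on the segment from \<open>x\<close>
  to \<open>y\<close> turns the error of the linear approximation into a difference of derivatives
  at two points. It suffices to bound this difference uniformly in \<open>t\<close>, which
  compactness of the interval allows for one direction at a time; the basis makes finitely many
  directions enough.\<close>

lemma has_derivative_integral_param: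
  fixes h :: "'a::real_normed_vector \<times> real \<Rightarrow> real" and u :: "nat \<Rightarrow> 'a \<Rightarrow> real"
  assumes c: "coordinates n b u" and U: "open U" "x \<in> U" and h: "smooth_on (U \<times> UNIV) h"
  shows "((\<lambda>x. integral {0..1} (\<lambda>t. h (x, t))) has_derivative
    (\<lambda>v. integral {0..1} (\<lambda>t. fderiv h (x, t) (v, 0)))) (at x)"
  unfolding has_derivative_at_alt
proof (intro conjI allI impI)
  have dh: "h differentiable (at (y, t))" if "y \<in> U" for y t
    using smooth_on_differentiable[OF h] that by auto
  have lin: "linear (\<lambda>v. fderiv h (y, t) (v, 0))" if "y \<in> U" for y t
    using linear_compose[OF bounded_linear.linear[OF bounded_linear_Pair[OF bounded_linear_ident
        bounded_linear_zero]]
        linear_fderiv[OF dh[OF that]], of t]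
    by (simp add: o_def)
  have exp: "fderiv h (y, t) (v, 0) = (\<Sum>i<n. u i v * fderiv h (y, t) (b i, 0))" if "y \<in> U" for y t v
    unfolding real_scaleR_def[symmetric] by (rule coordinates_linear_apply[OF c lin[OF that]])
  have cont: "continuous_on T (\<lambda>t. fderiv h (x, t) v)" for v T
    using continuous_on_slice[OF smooth_on_fderiv[OF h] U(2)] .
  have "integral {0..1} (\<lambda>t. fderiv h (x, t) (v, 0))
      = (\<Sum>i<n. u i v * integral {0..1} (\<lambda>t. fderiv h (x, t) (b i, 0)))" for v
  proof -
    have "integral {0..1} (\<lambda>t. fderiv h (x, t) (v, 0))
        = integral {0..1} (\<lambda>t. \<Sum>i<n. u i v * fderiv h (x, t) (b i, 0))"
      by (intro Henstock_Kurzweil_Integration.integral_cong exp U)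
    also have "\<dots> = (\<Sum>i<n. integral {0..1} (\<lambda>t. u i v * fderiv h (x, t) (b i, 0)))"
      by (rule integral_sum) (auto intro!: integrable_continuous_real continuous_intros cont)
    finally show ?thesis by simp
  qed
  then have "(\<lambda>v. integral {0..1} (\<lambda>t. fderiv h (x, t) (v, 0)))
      = (\<lambda>v. \<Sum>i<n. u i v * integral {0..1} (\<lambda>t. fderiv h (x, t) (b i, 0)))" by blast
  then show "bounded_linear (\<lambda>v. integral {0..1} (\<lambda>t. fderiv h (x, t) (v, 0)))"
    using coordinates_bounded_linear[OF c]
    by (auto intro!: bounded_linear_sum bounded_linear_mult_const)
  fix e :: real assume e: "e > 0"
  obtain K where K: "K > 0" "\<And>v. (\<Sum>i<n. \<bar>u i v\<bar>) \<le> K * norm v"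
    using coordinates_norm_bound[OF c] by blast
  \<comment> \<open>The tolerance is divided by \<open>K\<close> because the coordinates of the
    displacement are summed up later, and their sum is at most \<open>K\<close> times its
    norm.\<close>
  have "\<exists>X. x \<in> X \<and> open X \<and> (\<forall>y\<in>X\<inter>U. \<forall>t\<in>{0..1}.
      dist (fderiv h (y, t) (b i, 0)) (fderiv h (x, t) (b i, 0)) \<le> e / K)" for i
  proof -
    have "continuous_on (U \<times> {0..1}) (\<lambda>z. fderiv h z (b i, 0))"
      by (rule continuous_on_subset[OF smooth_on_continuous[OF smooth_on_fderiv[OF h]]]) auto
    from continuous_on_prod_compactE[OF this compact_Icc U(2), of "e / K"] e K(1)
    show ?thesis by (metis divide_pos_pos)
  qed
  then obtain X where X: "\<And>i. x \<in> X i" "\<And>i. open (X i)" "\<And>i y t. y \<in> X i \<Longrightarrow> y \<in> U \<Longrightarrow> t \<in> {0..1} \<Longrightarrow>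
      dist (fderiv h (y, t) (b i, 0)) (fderiv h (x, t) (b i, 0)) \<le> e / K" by (metis IntI)
  have "open (U \<inter> (\<Inter>i<n. X i))" using X(2) U(1) by auto
  then obtain d where d: "d > 0" "ball x d \<subseteq> U \<inter> (\<Inter>i<n. X i)"
    using X(1) U(2) open_contains_ball[of "U \<inter> (\<Inter>i<n. X i)"]
        by (metis (no_types, lifting) INT_I IntI)
  show "\<exists>d>0. \<forall>y. norm (y - x) < d \<longrightarrow> norm (integral {0..1} (\<lambda>t. h (y, t))
      - integral {0..1} (\<lambda>t. h (x, t))
      - integral {0..1} (\<lambda>t. fderiv h (x, t) (y - x, 0))) \<le> e * norm (y - x)"
  proof (intro exI[of _ d] conjI d(1) allI impI)
    fix y assume y: "norm (y - x) < d"
    define w where "w = y - x"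
    have seg: "x + s *\<^sub>R w \<in> ball x d" if "0 \<le> s" "s \<le> 1" for s
    proof -
      have "norm (s *\<^sub>R w) \<le> norm w" using that by (simp add: mult_left_le_one_le)
      then show ?thesis using y by (simp add: w_def dist_norm)
    qed
    have yU: "y \<in> U" using seg[of 1] d(2) by (auto simp: w_def)
    have pt: "norm (h (y, t) - h (x, t) - fderiv h (x, t) (w, 0)) \<le> e * norm w" if t: "t \<in> {0..1}"
        for t
    proof -
      have "((\<lambda>s. h (x + s *\<^sub>R w, t)) has_real_derivative fderiv h (x + s *\<^sub>R w, t) (w, 0)) (at s)"
        if "0 \<le> s" "s \<le> 1" for s
        using has_real_derivative_along[of h "(x, t)" s "(w, 0)"] dh seg[OF that] d(2) by auto
      from MVT2[OF zero_less_one this] obtain s where s: "0 < s" "s < 1"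
        "h (y, t) - h (x, t) = fderiv h (x + s *\<^sub>R w, t) (w, 0)" by (auto simp: w_def)
      define z where "z = x + s *\<^sub>R w"
      have z: "z \<in> U" "\<And>i. i < n \<Longrightarrow> z \<in> X i" using seg[of s] s d(2) by (auto simp: z_def)
      have "h (y, t) - h (x, t) - fderiv h (x, t) (w, 0)
          = (\<Sum>i<n. u i w * (fderiv h (z, t) (b i, 0) - fderiv h (x, t) (b i, 0)))"
        unfolding s(3) z_def[symmetric] exp[OF z(1), of t w] exp[OF U(2), of t w]
        by (simp add: sum_subtractf right_diff_distrib)
      also have "norm \<dots> \<le> (\<Sum>i<n. \<bar>u i w\<bar> * (e / K))"
        using X(3)[OF z(2) z(1) t]
        by (intro sum_norm_le) (simp add: abs_mult dist_real_def mult_left_mono del: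
            times_divide_eq_right)
      also have "\<dots> = (\<Sum>i<n. \<bar>u i w\<bar>) * (e / K)" by (rule sum_distrib_right[symmetric])
      also have "\<dots> \<le> (K * norm w) * (e / K)" using K e by (intro mult_right_mono) auto
      also have "\<dots> = e * norm w" using K by simp
      finally show ?thesis .
    qed
    have ci: "continuous_on {0..1} (\<lambda>t. h (y, t))" "continuous_on {0..1} (\<lambda>t. h (x, t))"
      using continuous_on_slice[OF h] yU U(2) by auto
    have "integral {0..1} (\<lambda>t. h (y, t)) - integral {0..1} (\<lambda>t. h (x, t))
      - integral {0..1} (\<lambda>t. fderiv h (x, t) (w, 0))
      = integral {0..1} (\<lambda>t. h (y, t) - h (x, t) - fderiv h (x, t) (w, 0))"
      by (simp add: integral_diff integrable_diff integrable_continuous_real ci cont)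
    also have "norm \<dots> \<le> (e * norm w) * (1 - 0)"
      by (rule integral_bound) (use pt in \<open>auto intro!: continuous_intros ci cont\<close>)
    finally show "norm (integral {0..1} (\<lambda>t. h (y, t)) - integral {0..1} (\<lambda>t. h (x, t))
      - integral {0..1} (\<lambda>t. fderiv h (x, t) (y - x, 0))) \<le> e * norm (y - x)"
      by (simp add: w_def)
  qed
qed

text \<open>The derivative in the direction \<open>v\<close> is an integral of the same kind, with
  the integrand differentiated in the direction \<open>(v, 0)\<close>. The induction on the order
  therefore runs over all integrands at once.\<close>

lemma smooth_on_integral_param:
  fixes h :: "'a::real_normed_vector \<times> real \<Rightarrow> real" and u :: "nat \<Rightarrow> 'a \<Rightarrow> real"
  assumes c: "coordinates n b u" and U: "open U" and h: "smooth_on (U \<times> UNIV) h"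
  shows "smooth_on U (\<lambda>x. integral {0..1} (\<lambda>t. h (x, t)))"
  unfolding smooth_on_def
proof
  fix k
  show "Ck_on k U (\<lambda>x. integral {0..1} (\<lambda>t. h (x, t)))"
    using h
  proof (induction k arbitrary: h)
    case 0
    have "(\<lambda>x. integral {0..1} (\<lambda>t. h (x, t))) differentiable (at x)" if "x \<in> U" for x
      using has_derivative_integral_param[OF c U that 0] differentiable_def by blast
    then show ?case
      by (auto intro!: continuous_at_imp_continuous_on differentiable_imp_continuous_within)
  next
    case (Suc k)
    note d = has_derivative_integral_param[OF c U _ Suc.prems]
    have "Ck_on k U (\<lambda>x. fderiv (\<lambda>x. integral {0..1} (\<lambda>t. h (x, t))) x v)" for v
      by (rule Ck_on_cong[OF U _ Suc.IH[OF smooth_on_fderiv[OF Suc.prems], of "(v, 0)"]])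
        (simp add: fderiv_eq[OF d])
    then show ?case using differentiableI[OF d] by simp
  qed
qed

section \<open>Alternating forms on open sets\<close>

text \<open>The lists have arbitrary length, so such an \<open>A\<close> is a family of alternating
  forms with one member for each degree. This matches the values of cochains, which mix
  degrees.\<close>

definition alternating_form :: "('a::real_vector list \<Rightarrow> real) \<Rightarrow> bool" where
  "alternating_form A \<longleftrightarrow>
     (\<forall>us vs v w a b. A (us @ (a *\<^sub>R v + b *\<^sub>R w) # vs) = a * A (us @ v # vs)
         + b * A (us @ w # vs)) \<and>
     (\<forall>vs. \<not> distinct vs \<longrightarrow> A vs = 0)"

definition form_on :: "'a::real_normed_vector set \<Rightarrow> ('a \<Rightarrow> 'a list \<Rightarrow> real) \<Rightarrow> bool" where
  "form_on V W \<longleftrightarrow> open V \<and> (\<forall>y\<in>V. alternating_form (W y)) \<and> (\<forall>\<xi>s. smooth_on V (\<lambda>y. W y \<xi>s))"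

definition pull :: "('a::real_normed_vector \<Rightarrow> 'b::real_normed_vector) \<Rightarrow> ('b \<Rightarrow> 'b list \<Rightarrow> real)
    \<Rightarrow> 'a \<Rightarrow> 'a list \<Rightarrow> real" where
  "pull h W x \<xi>s = W (h x) (map (fderiv h x) \<xi>s)"

definition omit :: "nat \<Rightarrow> 'a list \<Rightarrow> 'a list" where
  "omit i xs = take i xs @ drop (Suc i) xs"

text \<open>The exterior derivative in a single chart; the entries of the list act as constant
  vector fields.\<close>

definition lext :: "('a::real_normed_vector \<Rightarrow> 'a list \<Rightarrow> real) \<Rightarrow> 'a \<Rightarrow> 'a list \<Rightarrow> real" where
  "lext W x \<xi>s = (\<Sum>i<length \<xi>s. (-1) ^ i * fderiv (\<lambda>y. W y (omit i \<xi>s)) x (\<xi>s ! i))"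

lemma omit_map: "omit i (map f xs) = map f (omit i xs)"
  by (simp add: omit_def take_map drop_map)

lemma length_omit: "i < length xs \<Longrightarrow> length (omit i xs) = length xs - 1"
  by (simp add: omit_def)

lemma alternating_form_linear: "alternating_form A \<Longrightarrow> linear (\<lambda>v. A (us @ v # vs))"
proof (rule linearI)
  fix v w :: 'a and r :: real
  assume A: "alternating_form A"
  then have e: "A (us @ (a *\<^sub>R v + b *\<^sub>R w) # vs) = a * A (us @ v # vs) + b * A (us @ w # vs)"
      for a b
    unfolding alternating_form_def by blast
  show "A (us @ (v + w) # vs) = A (us @ v # vs) + A (us @ w # vs)" using e[of 1 1] by simp
  show "A (us @ (r *\<^sub>R v) # vs) = r *\<^sub>R A (us @ v # vs)" using e[of r 0] by simp
qed

lemma alternating_form_coordinates: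
  "coordinates n b u \<Longrightarrow> alternating_form A \<Longrightarrow> A (us @ v # vs) = (\<Sum>i<n. u i v * A (us @ b i # vs))"
  using coordinates_linear_apply[OF _ alternating_form_linear] by simp

lemma alternating_form_swap:
  assumes "alternating_form A"
  shows "A (us @ v # w # vs) = - A (us @ w # v # vs)"
proof -
  note l = linear_add[OF alternating_form_linear[OF assms]]
  have z: "A (us @ v # v # vs) = 0" for v using assms unfolding alternating_form_def by simp
  have "0 = A (us @ (v + w) # (v + w) # vs)" using z by simp
  also have "\<dots> = A (us @ v # (v + w) # vs) + A (us @ w # (v + w) # vs)" by (rule l)
  also have "A (us @ v # (v + w) # vs) = A (us @ v # v # vs) + A (us @ v # w # vs)"
    using l[of "us @ [v]" v w vs] by simp
  also have "A (us @ w # (v + w) # vs) = A (us @ w # v # vs) + A (us @ w # w # vs)"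
    using l[of "us @ [w]" v w vs] by simp
  finally show ?thesis using z by simp
qed

lemma alternating_form_move:
  assumes "alternating_form A"
  shows "A (us @ ws @ v # vs) = (-1) ^ length ws * A (us @ v # ws @ vs)"
proof (induction ws arbitrary: us)
  case (Cons w ws)
  show ?case
    using Cons[of "us @ [w]"] alternating_form_swap[OF assms, of us w v "ws @ vs"] by simp
qed simp

section \<open>Forms with moving arguments\<close>

lemma form_onD:
  assumes "form_on V W"
  shows "open V" "y \<in> V \<Longrightarrow> alternating_form (W y)" "smooth_on V (\<lambda>y. W y \<xi>s)"
  using assms by (auto simp: form_on_def)

text \<open>\<open>form_on\<close> speaks of constant arguments only. The moving arguments are
  replaced one after the other by basis vectors with smooth coefficients, and \<open>us\<close>
  collects the constant arguments obtained so far.\<close>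

lemma smooth_on_form_apply:
  fixes h :: "'a::real_normed_vector \<Rightarrow> 'b::real_normed_vector" and u :: "nat \<Rightarrow> 'b \<Rightarrow> real"
  assumes c: "coordinates n b u" and W: "form_on V W" and S: "open S" "h ` S \<subseteq> V"
    and h: "smooth_on S h" and vs: "\<forall>v\<in>set vs. smooth_on S v"
  shows "smooth_on S (\<lambda>x. W (h x) (us @ map (\<lambda>v. v x) vs))"
  using vs
proof (induction vs arbitrary: us)
  case Nil
  show ?case using smooth_on_compose[OF c S(1) form_onD(1)[OF W] S(2) h form_onD(3)[OF W]] by simp
next
  case (Cons v vs)
  have "smooth_on S (\<lambda>x. \<Sum>i<n. u i (v x) *\<^sub>R W (h x) ((us @ [b i]) @ map (\<lambda>v. v x) vs))"
    by (intro smooth_on_sum smooth_on_scaleR S Cons.IH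
        smooth_on_linear_compose[OF coordinates_bounded_linear[OF c]]) (use Cons.prems in auto)
  then show ?case
    by (rule smooth_on_cong[OF S(1), rotated])
      (use alternating_form_coordinates[OF c form_onD(2)[OF W]] S(2) in auto)
qed

text \<open>The product rule for a multilinear expression. The first moving argument is expanded in
  the basis; each summand is a scalar coefficient times a case with one moving argument fewer, and
  linearity in the freed place puts the sum together again.\<close>

lemma has_derivative_form_apply:
  fixes h :: "'a::real_normed_vector \<Rightarrow> 'b::real_normed_vector" and u :: "nat \<Rightarrow> 'b \<Rightarrow> real"
  assumes c: "coordinates n b u" and W: "form_on V W" and S: "open S" "h ` S \<subseteq> V" "x \<in> S"
    and h: "h differentiable (at x)" and vs: "\<forall>v\<in>set vs. v differentiable (at x)"
  shows "((\<lambda>x. W (h x) (us @ map (\<lambda>v. v x) vs)) has_derivative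
     (\<lambda>\<xi>. fderiv (\<lambda>y. W y (us @ map (\<lambda>v. v x) vs)) (h x) (fderiv h x \<xi>) +
        (\<Sum>j<length vs. W (h x) (us @ map (\<lambda>v. v x) (take j vs) @ fderiv (vs ! j) x \<xi>
            # map (\<lambda>v. v x) (drop (Suc j) vs))))) (at x)"
  using vs
proof (induction vs arbitrary: us)
  case Nil
  have hx: "h x \<in> V" using S by auto
  have "((\<lambda>y. W y us) has_derivative fderiv (\<lambda>y. W y us) (h x)) (at (h x))"
    by (rule fderiv_has[OF smooth_on_differentiable[OF form_onD(3)[OF W] hx]])
  from diff_chain_at[OF fderiv_has[OF h] this] show ?case by (simp add: o_def)
next
  case (Cons v vs)
  let ?R = "map (\<lambda>v. v x) vs"
  have hx: "h x \<in> V" using S by auto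
  have v: "v differentiable (at x)" and vs: "\<forall>v\<in>set vs. v differentiable (at x)" using Cons.prems
      by auto
  note alt = alternating_form_coordinates[OF c form_onD(2)[OF W]]
  have dW: "(\<lambda>y. W y us) differentiable (at (h x))" for us
    by (rule smooth_on_differentiable[OF form_onD(3)[OF W] hx])
  \<comment> \<open>Here \<open>v x\<close> is frozen at the base point, so the expansion has
    constant coefficients and can be differentiated term by term.\<close>
  have e1: "fderiv (\<lambda>y. W y (us @ v x # ?R)) (h x) \<eta> =
     (\<Sum>i<n. u i (v x) * fderiv (\<lambda>y. W y ((us @ [b i]) @ ?R)) (h x) \<eta>)" for \<eta>
  proof -
    have "((\<lambda>y. \<Sum>i<n. u i (v x) * W y ((us @ [b i]) @ ?R)) has_derivative
      (\<lambda>\<eta>. \<Sum>i<n. u i (v x) * fderiv (\<lambda>y. W y ((us @ [b i]) @ ?R)) (h x) \<eta>)) (at (h x))"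
      by (intro has_derivative_sum has_derivative_mult_right fderiv_has dW)
    note fderiv_eq[OF this]
    moreover have "fderiv (\<lambda>y. W y (us @ v x # ?R)) (h x) = fderiv (\<lambda>y. \<Sum>i<n. u i (v x)
        * W y ((us @ [b i]) @ ?R)) (h x)"
      by (rule fderiv_cong_open[OF form_onD(1)[OF W] hx]) (subst alt, auto)
    ultimately show ?thesis by simp
  qed
  have e2: "(\<Sum>i<n. u i (v x) * (\<Sum>j<length vs. W (h x) ((us @ [b i]) @ map (\<lambda>v. v x) (take j vs)
      @ fderiv (vs ! j) x \<xi>
            # map (\<lambda>v. v x) (drop (Suc j) vs)))) =
      (\<Sum>j<length vs. W (h x) (us @ v x # map (\<lambda>v. v x) (take j vs) @ fderiv (vs ! j) x \<xi>
            # map (\<lambda>v. v x) (drop (Suc j) vs)))" for \<xi>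
    unfolding alt[OF hx, of us "v x"] sum_distrib_left by (subst sum.swap) simp
  have "((\<lambda>x. \<Sum>i<n. u i (v x) * W (h x) ((us @ [b i]) @ map (\<lambda>v. v x) vs)) has_derivative
     (\<lambda>\<xi>. \<Sum>i<n. u i (v x) * (fderiv (\<lambda>y. W y ((us @ [b i]) @ ?R)) (h x) (fderiv h x \<xi>) +
        (\<Sum>j<length vs. W (h x) ((us @ [b i]) @ map (\<lambda>v. v x) (take j vs) @ fderiv (vs ! j) x \<xi>
            # map (\<lambda>v. v x) (drop (Suc j) vs)))) + u i (fderiv v x \<xi>) * W (h x) ((us @ [b i])
                @ ?R))) (at x)"
    by (intro has_derivative_sum has_derivative_mult Cons.IH[OF vs]
        bounded_linear.has_derivative[OF coordinates_bounded_linear[OF c]] fderiv_has v) auto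
  also have "(\<lambda>\<xi>. \<Sum>i<n. u i (v x) * (fderiv (\<lambda>y. W y ((us @ [b i]) @ ?R)) (h x) (fderiv h x \<xi>) +
        (\<Sum>j<length vs. W (h x) ((us @ [b i]) @ map (\<lambda>v. v x) (take j vs) @ fderiv (vs ! j) x \<xi>
            # map (\<lambda>v. v x) (drop (Suc j) vs)))) + u i (fderiv v x \<xi>) * W (h x) ((us @ [b i]) @ ?R))
                =
     (\<lambda>\<xi>. fderiv (\<lambda>y. W y (us @ map (\<lambda>v. v x) (v # vs))) (h x) (fderiv h x \<xi>) +
        (\<Sum>j<length (v # vs). W (h x) (us @ map (\<lambda>v. v x) (take j (v # vs)) @ fderiv ((v # vs) ! j)
            x \<xi>
            # map (\<lambda>v. v x) (drop (Suc j) (v # vs)))))"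
  proof (rule ext)
    fix \<xi>
    have "(\<Sum>i<n. u i (fderiv v x \<xi>) * W (h x) ((us @ [b i]) @ ?R))
        = W (h x) (us @ fderiv v x \<xi> # ?R)"
      using alt[OF hx, of us "fderiv v x \<xi>" ?R] by simp
    then show "(\<Sum>i<n. u i (v x) * (fderiv (\<lambda>y. W y ((us @ [b i]) @ ?R)) (h x) (fderiv h x \<xi>) +
        (\<Sum>j<length vs. W (h x) ((us @ [b i]) @ map (\<lambda>v. v x) (take j vs) @ fderiv (vs ! j) x \<xi>
            # map (\<lambda>v. v x) (drop (Suc j) vs)))) + u i (fderiv v x \<xi>) * W (h x) ((us @ [b i]) @ ?R))
                =
     fderiv (\<lambda>y. W y (us @ map (\<lambda>v. v x) (v # vs))) (h x) (fderiv h x \<xi>) +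
        (\<Sum>j<length (v # vs). W (h x) (us @ map (\<lambda>v. v x) (take j (v # vs)) @ fderiv ((v # vs) ! j)
            x \<xi>
            # map (\<lambda>v. v x) (drop (Suc j) (v # vs))))"
      unfolding distrib_left sum.distrib e2 list.map e1[symmetric]
      by (simp add: sum.lessThan_Suc_shift del: sum.lessThan_Suc)
  qed
  finally show ?case
    by (rule has_derivative_transform_within_open[OF _ S(1) S(3)])
      (use S(2) alt in \<open>auto simp: image_subset_iff\<close>)
qed

lemma form_on_pull:
  fixes h :: "'a::real_normed_vector \<Rightarrow> 'b::real_normed_vector" and u :: "nat \<Rightarrow> 'b \<Rightarrow> real"
  assumes c: "coordinates n b u" and W: "form_on V W" and S: "open S" "h ` S \<subseteq> V"
      and h: "smooth_on S h"
  shows "form_on S (pull h W)"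
  unfolding form_on_def
proof (intro conjI ballI allI S(1))
  fix y assume y: "y \<in> S"
  then have A: "alternating_form (W (h y))" using form_onD(2)[OF W] S(2) by blast
  have lin: "linear (fderiv h y)" using linear_fderiv[OF smooth_on_differentiable[OF h y]] .
  show "alternating_form (pull h W y)"
    using A unfolding alternating_form_def pull_def
    by (simp add: linear_add[OF lin] linear_scale[OF lin] distinct_map)
next
  fix \<xi>s
  show "smooth_on S (\<lambda>y. pull h W y \<xi>s)"
    using smooth_on_form_apply[OF c W S h, of "map (\<lambda>\<xi> x. fderiv h x \<xi>) \<xi>s"
        "[]"] smooth_on_fderiv[OF h]
    by (simp add: pull_def o_def)
qed

text \<open>Think of \<open>j\<close> as a position in a list of \<open>n\<close> entries from which
  entry \<open>i\<close> has been omitted: it denotes entry \<open>j\<close> if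
  \<open>j < i\<close>, and entry \<open>j + 1\<close> otherwise. The right side collects the two
  orders in which a pair of entries \<open>i < k\<close> occurs.\<close>

lemma sum_omitted_pairs:
  fixes f :: "nat \<Rightarrow> nat \<Rightarrow> real"
  shows "(\<Sum>i<n. \<Sum>j<n - 1. f i j) = (\<Sum>k<n. \<Sum>i<k. f k i + f i (k - 1))"
proof -
  have "(\<Sum>j<n - 1. f i j) = (\<Sum>j<i. f i j) + (\<Sum>j\<in>{i..<n - 1}. f i j)" if "i < n" for i
    using sum.union_disjoint[of "{..<i}" "{i..<n - 1}" "f i"] that
    by (simp add: ivl_disj_un_one(2) ivl_disj_int_one(2))
  then have "(\<Sum>i<n. \<Sum>j<n - 1. f i j) = (\<Sum>i<n. \<Sum>j<i. f i j) + (\<Sum>i<n. \<Sum>j\<in>{i..<n - 1}. f i j)"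
    by (simp add: sum.distrib)
  also have "(\<Sum>i<n. \<Sum>j\<in>{i..<n - 1}. f i j) = (\<Sum>k<n. \<Sum>i<k. f i (k - 1))"
    unfolding sum.Sigma[OF finite_lessThan ballI[OF finite_atLeastLessThan]]
      sum.Sigma[OF finite_lessThan ballI[OF finite_lessThan]]
    by (rule sum.reindex_bij_witness[of _ "\<lambda>(k, i). (i, k - 1)" "\<lambda>(i, j). (Suc j, i)"]) auto
  finally show ?thesis by (simp add: sum.distrib)
qed

lemma list_at_length:
  assumes "length xs = m"
  shows "take m (xs @ y # ys) = xs" "(xs @ y # ys) ! m = y" "drop (Suc m) (xs @ y # ys) = ys"
  using assms by auto

text \<open>
  The second derivatives of \<open>h\<close> cancel in pairs, because they are symmetric and the form is
  alternating.
\<close>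

lemma lext_pull:
  fixes h :: "'a::real_normed_vector \<Rightarrow> 'b::real_normed_vector" and u :: "nat \<Rightarrow> 'b \<Rightarrow> real"
  assumes c: "coordinates n b u" and W: "form_on V W" and S: "open S" "h ` S \<subseteq> V" "x \<in> S"
    and h: "smooth_on S h"
  shows "lext (pull h W) x \<xi>s = lext W (h x) (map (fderiv h x) \<xi>s)"
proof -
  define D where "D = fderiv h x"
  define A where "A = W (h x)"
  define s where "s = (\<lambda>\<xi> \<eta>. fderiv (\<lambda>x. fderiv h x \<xi>) x \<eta>)"
  \<comment> \<open>The terms of the product rule in which the map itself is differentiated twice:
    \<open>i\<close> is the direction of differentiation and \<open>j\<close> a place of the
    remaining list, whose entry is replaced by a second derivative. These have to cancel.\<close>
  define T where "T = (\<lambda>i j. A (map D (take j (omit i \<xi>s)) @ s (omit i \<xi>s ! j) (\<xi>s ! i)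
     # map D (drop (Suc j) (omit i \<xi>s))))"
  have alt: "alternating_form A" using form_onD(2)[OF W] S by (auto simp: A_def)
  have sym: "s \<xi> \<eta> = s \<eta> \<xi>" for \<xi> \<eta> unfolding s_def by (rule fderiv_symmetric[OF c S(1,3) h])
  have dh: "h differentiable (at x)" by (rule smooth_on_differentiable[OF h S(3)])
  have 1: "fderiv (\<lambda>y. pull h W y (omit i \<xi>s)) x (\<xi>s ! i) =
     fderiv (\<lambda>y. W y (omit i (map D \<xi>s))) (h x) (map D \<xi>s ! i) + (\<Sum>j<length \<xi>s - 1. T i j)"
    if i: "i < length \<xi>s" for i
  proof -
    let ?vs = "map (\<lambda>\<xi> x. fderiv h x \<xi>) (omit i \<xi>s)"
    have "\<forall>v\<in>set ?vs. v differentiable (at x)"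
      using smooth_on_differentiable[OF smooth_on_fderiv[OF h] S(3)] by auto
    note fderiv_eq[OF has_derivative_form_apply[OF c W S dh this, of "[]"]]
    then have "fderiv (\<lambda>y. W (h y) (map (\<lambda>v. v y) ?vs)) x (\<xi>s ! i) =
      fderiv (\<lambda>y. W y (map (\<lambda>v. v x) ?vs)) (h x) (D (\<xi>s ! i)) +
      (\<Sum>j<length ?vs. A (map (\<lambda>v. v x) (take j ?vs) @ fderiv (?vs ! j) x (\<xi>s ! i) # map (\<lambda>v. v x)
          (drop (Suc j) ?vs)))"
      by (simp add: D_def A_def)
    also have "(\<Sum>j<length ?vs. A (map (\<lambda>v. v x) (take j ?vs) @ fderiv (?vs ! j) x (\<xi>s ! i)
        # map (\<lambda>v. v x) (drop (Suc j) ?vs)))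
       = (\<Sum>j<length \<xi>s - 1. T i j)"
      by (rule sum.cong) (auto simp: length_omit[OF i] T_def s_def D_def take_map drop_map o_def)
    finally show ?thesis using i by (simp add: pull_def[abs_def] o_def omit_map D_def)
  qed
  have 2: "(-1) ^ k * T k i + (-1) ^ i * T i (k - 1) = 0" if ik: "i < k" "k < length \<xi>s" for i k
  proof -
    define as where "as = take i \<xi>s"
    define bs where "bs = take (k - i - 1) (drop (Suc i) \<xi>s)"
    define cs where "cs = drop (Suc k) \<xi>s"
    have la: "length as = i" and lb: "length bs = k - i - 1" using ik by (auto simp: as_def bs_def)
    have "drop (Suc i) \<xi>s = bs @ drop (k - i - 1) (drop (Suc i) \<xi>s)" unfolding bs_def
        by (rule append_take_drop_id[symmetric])
    also have "drop (k - i - 1) (drop (Suc i) \<xi>s) = drop k \<xi>s" using ik by simp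
    also have "drop k \<xi>s = \<xi>s ! k # cs" using ik(2) by (simp add: cs_def Cons_nth_drop_Suc)
    finally have "\<xi>s = as @ \<xi>s ! i # bs @ \<xi>s ! k # cs"
      using id_take_nth_drop[of i \<xi>s] ik by (simp add: as_def)
    then obtain p q where xi: "\<xi>s = as @ p # bs @ q # cs" and p: "\<xi>s ! i = p" and q: "\<xi>s ! k = q"
        by blast
    have oi: "omit i \<xi>s = (as @ bs) @ q # cs" unfolding omit_def xi using la by simp
    have ok: "omit k \<xi>s = as @ p # bs @ cs"
    proof -
      have "\<xi>s = (as @ p # bs) @ q # cs" "length (as @ p # bs) = k" using xi la lb ik by auto
      then show ?thesis unfolding omit_def using list_at_length[of "as @ p # bs" k q cs] by simp
    qed
    have lab: "length (as @ bs) = k - 1" using la lb ik by simp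
    have Ti: "T i (k - 1) = A (map D as @ map D bs @ s q p # map D cs)"
      unfolding T_def oi p list_at_length[OF lab] by simp
    have Tk: "T k i = A (map D as @ s p q # map D bs @ map D cs)"
      unfolding T_def ok q list_at_length[OF la] by simp
    \<comment> \<open>By symmetry both terms contain the same second derivative. Only its place
      differs, and moving it across \<open>bs\<close> costs one sign for each of the
      \<open>k - i - 1\<close> entries.\<close>
    have "T i (k - 1) = (-1) ^ (k - i - 1) * T k i"
      unfolding Ti Tk sym[of q p] using alternating_form_move[OF alt, of "map D as" "map D bs"] lb
          by simp
    moreover have "(-1::real) ^ i * (-1) ^ (k - i - 1) = - ((-1) ^ k)"
    proof -
      have "k = Suc (i + (k - i - 1))" using ik by simp
      then have "(-1::real) ^ k = - ((-1) ^ (i + (k - i - 1)))" by (metis power_Suc mult_minus1)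
      then show ?thesis by (simp add: power_add)
    qed
    ultimately show ?thesis by (simp add: mult.assoc[symmetric])
  qed
  have "(\<Sum>i<length \<xi>s. (-1) ^ i * (\<Sum>j<length \<xi>s - 1. T i j)) = 0"
    unfolding sum_distrib_left sum_omitted_pairs by (intro sum.neutral ballI 2) auto
  then show ?thesis
    unfolding lext_def D_def[symmetric] by (simp add: 1 distrib_left sum.distrib)
qed

lemma lext_cong:
  assumes "open S" "x \<in> S" "\<And>y \<xi>s. y \<in> S \<Longrightarrow> W y \<xi>s = W' y \<xi>s"
  shows "lext W x \<xi>s = lext W' x \<xi>s"
  unfolding lext_def using fderiv_cong_open[OF assms(1,2), of "\<lambda>y. W y (omit _ \<xi>s)"
      "\<lambda>y. W' y (omit _ \<xi>s)"] assms(3)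
  by (metis (no_types, lifting))

section \<open>Charts and smooth maps\<close>

text \<open>The part of \<open>smooth_manifold\<close> on which the calculus rests, with finite
  dimension in the form of \<open>coordinates\<close>. It is this notion that is shown to pass to
  products.\<close>

definition smooth_atlas :: "('a, 'e::real_normed_vector) manifold \<Rightarrow> bool" where
  "smooth_atlas M \<longleftrightarrow>
     (\<exists>n b (u :: nat \<Rightarrow> 'e \<Rightarrow> real). coordinates n b u) \<and>
     (\<Union>c\<in>atlas M. chart_dom c) = points M \<and>
     (\<forall>c\<in>atlas M. openin (mtop M) (chart_dom c) \<and> open (snd c ` chart_dom c) \<and>
        homeomorphic_map (subtopology (mtop M) (chart_dom c)) (top_of_set (snd c ` chart_dom c))
            (snd c)) \<and>
     (\<forall>c\<in>atlas M. \<forall>c'\<in>atlas M. smooth_on (snd c ` (chart_dom c \<inter> chart_dom c')) (transition c c'))"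

lemma smooth_manifold_atlas: "smooth_manifold M \<Longrightarrow> smooth_atlas M"
  unfolding smooth_manifold_def smooth_atlas_def using finite_span_coordinates by blast

abbreviation local_rep :: "('a, 'e) chart \<Rightarrow> ('b, 'f) chart \<Rightarrow> ('a \<Rightarrow> 'b) \<Rightarrow> 'e \<Rightarrow> 'f" where
  "local_rep c c' f \<equiv> (\<lambda>x. snd c' (f (chart_inv c x)))"

abbreviation rep_dom :: "('a, 'e) chart \<Rightarrow> ('b, 'f) chart \<Rightarrow> ('a \<Rightarrow> 'b) \<Rightarrow> 'e set" where
  "rep_dom c c' f \<equiv> snd c ` (chart_dom c \<inter> f -` chart_dom c')"

lemma charts_at_iff: "c \<in> charts_at M p \<longleftrightarrow> c \<in> atlas M \<and> p \<in> chart_dom c"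
  by (auto simp: charts_at_def)

lemma chart_openin: "smooth_atlas M \<Longrightarrow> c \<in> atlas M \<Longrightarrow> openin (mtop M) (chart_dom c)"
  by (simp add: smooth_atlas_def)

lemma chart_dom_subset: "smooth_atlas M \<Longrightarrow> c \<in> atlas M \<Longrightarrow> chart_dom c \<subseteq> points M"
  using chart_openin openin_subset by blast

lemma charts_at_points: "smooth_atlas M \<Longrightarrow> c \<in> charts_at M p \<Longrightarrow> p \<in> points M"
  using chart_dom_subset unfolding charts_at_iff by blast

lemma chart_at_in: "smooth_atlas M \<Longrightarrow> p \<in> points M \<Longrightarrow> chart_at M p \<in> charts_at M p"
proof -
  assume M: "smooth_atlas M" and p: "p \<in> points M"
  have "(\<Union>c\<in>atlas M. chart_dom c) = points M" using M unfolding smooth_atlas_def by (elim conjE)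
  with p have "p \<in> (\<Union>c\<in>atlas M. chart_dom c)" by simp
  then obtain c where "c \<in> charts_at M p" unfolding charts_at_iff by (rule UN_E) simp
  then show ?thesis unfolding chart_at_def by (rule someI)
qed

lemma chart_homeo:
  "smooth_atlas M \<Longrightarrow> c \<in> atlas M \<Longrightarrow>
     homeomorphic_map (subtopology (mtop M) (chart_dom c)) (top_of_set (snd c ` chart_dom c))
         (snd c)"
  by (simp add: smooth_atlas_def)

lemma chart_inj: "smooth_atlas M \<Longrightarrow> c \<in> atlas M \<Longrightarrow> inj_on (snd c) (chart_dom c)"
  using homeomorphic_imp_injective_map[OF chart_homeo] chart_dom_subset
  by (fastforce simp: Int_absorb1)

lemma chart_inv_chart: "smooth_atlas M \<Longrightarrow> c \<in> atlas M \<Longrightarrow> p \<in> chart_dom c \<Longrightarrow> chart_inv c (snd c p) = p"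
  by (simp add: chart_inj inv_into_f_f)

lemma chart_chart_inv: "x \<in> snd c ` chart_dom c \<Longrightarrow> snd c (chart_inv c x) = x"
  by (rule f_inv_into_f)

lemma chart_inv_in: "x \<in> snd c ` chart_dom c \<Longrightarrow> chart_inv c x \<in> chart_dom c"
  by (rule inv_into_into)

lemma chart_image_open:
  assumes "smooth_atlas M" "c \<in> atlas M" "openin (mtop M) U" "U \<subseteq> chart_dom c"
  shows "open (snd c ` U)"
proof -
  have "openin (top_of_set (snd c ` chart_dom c)) (snd c ` U)"
    using homeomorphic_imp_open_map[OF chart_homeo[OF assms(1,2)]] assms(3,4)
    unfolding open_map_def by (metis openin_subtopology inf.absorb1)
  moreover have "open (snd c ` chart_dom c)" using assms by (simp add: smooth_atlas_def)
  ultimately show ?thesis by (simp add: openin_open_eq)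
qed

lemma chart_preimage_open:
  assumes "smooth_atlas M" "c \<in> atlas M" "open T"
  shows "openin (mtop M) {p \<in> chart_dom c. snd c p \<in> T}"
proof -
  have "openin (top_of_set (snd c ` chart_dom c)) (snd c ` chart_dom c \<inter> T)"
    using assms(3) by (auto simp: openin_open)
  then have "openin (subtopology (mtop M) (chart_dom c))
      {p \<in> topspace (subtopology (mtop M) (chart_dom c)). snd c p \<in> snd c ` chart_dom c \<inter> T}"
    using homeomorphic_imp_continuous_map[OF chart_homeo[OF assms(1,2)]]
    by (simp only: continuous_map_def)
  moreover have "{p \<in> topspace (subtopology (mtop M) (chart_dom c)). snd c p
      \<in> snd c ` chart_dom c \<inter> T}
      = {p \<in> chart_dom c. snd c p \<in> T}"
    using chart_dom_subset[OF assms(1,2)] by auto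
  ultimately show ?thesis
    using openin_trans_full chart_openin[OF assms(1,2)] by metis
qed

lemma smooth_atlas_coordinates:
  fixes M :: "('a, 'e::real_normed_vector) manifold"
  assumes "smooth_atlas M"
  obtains n b and u :: "nat \<Rightarrow> 'e \<Rightarrow> real" where "coordinates n b u"
  using assms by (auto simp: smooth_atlas_def)

lemma smooth_map_points: "smooth_map M N f \<Longrightarrow> p \<in> points M \<Longrightarrow> f p \<in> points N"
  unfolding smooth_map_def by (meson continuous_map_image_subset_topspace image_subset_iff)

lemma rep_dom_open':
  assumes "smooth_atlas M" "smooth_atlas N" "continuous_map (mtop M) (mtop N) f" "c \<in> atlas M"
      "c' \<in> atlas N"
  shows "open (rep_dom c c' f)"
proof (rule chart_image_open[OF assms(1,4)])
  have "openin (mtop M) {x \<in> points M. f x \<in> chart_dom c'}"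
    using assms(3) chart_openin[OF assms(2,5)] by (simp add: continuous_map_def)
  then have "openin (mtop M) (chart_dom c \<inter> {x \<in> points M. f x \<in> chart_dom c'})"
    using chart_openin[OF assms(1,4)] by blast
  moreover have "chart_dom c \<inter> {x \<in> points M. f x \<in> chart_dom c'} = chart_dom c \<inter> f -` chart_dom c'"
    using chart_dom_subset[OF assms(1,4)] by auto
  ultimately show "openin (mtop M) (chart_dom c \<inter> f -` chart_dom c')" by simp
qed auto

lemma rep_dom_open:
  assumes "smooth_atlas M" "smooth_atlas N" "smooth_map M N f" "c \<in> atlas M" "c' \<in> atlas N"
  shows "open (rep_dom c c' f)"
  using rep_dom_open' assms unfolding smooth_map_def by blast

lemma local_rep_smooth:
  assumes "smooth_map M N f" "c \<in> atlas M" "c' \<in> atlas N"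
  shows "smooth_on (rep_dom c c' f) (local_rep c c' f)"
  using assms by (simp add: smooth_map_def)

lemma rep_dom_inv:
  assumes "smooth_atlas M" "c \<in> atlas M" "x \<in> rep_dom c c' f"
  shows "chart_inv c x \<in> chart_dom c" "f (chart_inv c x) \<in> chart_dom c'" "snd c (chart_inv c x) = x"
    "x \<in> snd c ` chart_dom c"
  using assms chart_inv_chart[OF assms(1,2)] by auto

lemma in_rep_dom: "c \<in> charts_at M p \<Longrightarrow> c' \<in> charts_at N (f p) \<Longrightarrow> snd c p \<in> rep_dom c c' f"
  by (auto simp: charts_at_iff)

lemma local_rep_differentiable:
  assumes "smooth_map M N f" "c \<in> charts_at M p" "c' \<in> charts_at N (f p)"
  shows "local_rep c c' f differentiable (at (snd c p))"
  using smooth_on_differentiable[OF local_rep_smooth[OF assms(1)] in_rep_dom[where f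
      = f, OF assms(2,3)]] assms(2,3)
  by (auto simp: charts_at_iff)

lemma open_smooth_preimage: "smooth_on S h \<Longrightarrow> open S \<Longrightarrow> open T \<Longrightarrow> open {x \<in> S. h x \<in> T}"
  using continuous_open_preimage[OF smooth_on_continuous, of S h T] by (simp add: Int_def)

lemma smooth_map_ident: "smooth_atlas M \<Longrightarrow> smooth_map M M (\<lambda>x. x)"
  unfolding smooth_map_def smooth_atlas_def transition_def vimage_ident by simp

text \<open>\<open>smooth_map\<close> quantifies over all pairs of charts. One pair around each
  point is enough, because the representative in any other pair is composed of the given one and two
  transition maps. Continuity comes from the same local data.\<close>

lemma smooth_mapI_local:
  assumes M: "smooth_atlas M" and N: "smooth_atlas N"
    and loc: "\<And>p. p \<in> points M \<Longrightarrow> \<exists>c\<in>charts_at M p. \<exists>c'\<in>charts_at N (f p). \<exists>S. open S \<and> snd c p \<in> S \<and>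
      S \<subseteq> snd c ` chart_dom c \<and> (\<forall>x\<in>S. f (chart_inv c x) \<in> chart_dom c')
          \<and> smooth_on S (local_rep c c' f)"
  shows "smooth_map M N f"
proof -
  have cont: "continuous_map (mtop M) (mtop N) f"
    unfolding continuous_map_def
  proof (intro conjI allI impI)
    show "f \<in> points M \<rightarrow> points N" using loc charts_at_points[OF N] by blast
    fix W assume W: "openin (mtop N) W"
    show "openin (mtop M) {x \<in> points M. f x \<in> W}"
    proof (subst openin_subopen, intro ballI)
      fix p assume "p \<in> {x \<in> points M. f x \<in> W}"
      then have p: "p \<in> points M" "f p \<in> W" by auto
      from loc[OF p(1)] obtain c c' S where c: "c \<in> atlas M" "p \<in> chart_dom c"
          and c': "c' \<in> atlas N" "f p \<in> chart_dom c'"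
        and S: "open S" "snd c p \<in> S" "S \<subseteq> snd c ` chart_dom c"
            "\<forall>x\<in>S. f (chart_inv c x) \<in> chart_dom c'"
          "smooth_on S (local_rep c c' f)"
        by (auto simp: charts_at_iff)
      \<comment> \<open>The coordinates in \<open>S\<close> of the points that \<open>f\<close>
        sends into \<open>W\<close>; their preimage under the chart \<open>c\<close> is the
        neighbourhood of \<open>p\<close> that is sought.\<close>
      define T where "T = {x \<in> S. local_rep c c' f x \<in> snd c' ` (chart_dom c' \<inter> W)}"
      have "open T" unfolding T_def
        by (rule open_smooth_preimage[OF S(5,1)], rule chart_image_open[OF N c'(1)])
          (use W chart_openin[OF N c'(1)] in auto)
      then have op: "openin (mtop M) {q \<in> chart_dom c. snd c q \<in> T}"
          by (rule chart_preimage_open[OF M c(1)])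
      have "f q \<in> W" if "q \<in> chart_dom c" "snd c q \<in> T" for q
      proof -
        have "f q \<in> chart_dom c'" "snd c' (f q) \<in> snd c' ` (chart_dom c' \<inter> W)"
          using that S(4) chart_inv_chart[OF M c(1) that(1)] by (auto simp: T_def)
        then show ?thesis using chart_inj[OF N c'(1)] by (auto simp: inj_on_def)
      qed
      moreover have "snd c p \<in> T" using S(2) p c c' chart_inv_chart[OF M c] by (auto simp: T_def)
      ultimately show "\<exists>U. openin (mtop M) U \<and> p \<in> U \<and> U \<subseteq> {x \<in> points M. f x \<in> W}"
        using op c(2) chart_dom_subset[OF M c(1)] by (intro exI[of _ "{q \<in> chart_dom c. snd c q
            \<in> T}"]) auto
    qed
  qed
  obtain n b and u :: "nat \<Rightarrow> 'b \<Rightarrow> real" where cM: "coordinates n b u"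
      using smooth_atlas_coordinates[OF M] by blast
  obtain m d and w :: "nat \<Rightarrow> 'd \<Rightarrow> real" where cN: "coordinates m d w"
      using smooth_atlas_coordinates[OF N] by blast
  have "smooth_on (rep_dom c1 c2 f) (local_rep c1 c2 f)" if c1: "c1 \<in> atlas M"
      and c2: "c2 \<in> atlas N" for c1 c2
  proof (rule smooth_on_local)
    fix x assume x: "x \<in> rep_dom c1 c2 f"
    then obtain p where p: "p \<in> chart_dom c1" "f p \<in> chart_dom c2" "x = snd c1 p" by auto
    have pM: "p \<in> points M" using p chart_dom_subset[OF M c1] by blast
    from loc[OF pM] obtain c c' S where c: "c \<in> atlas M" "p \<in> chart_dom c"
        and c': "c' \<in> atlas N" "f p \<in> chart_dom c'"
        and S: "open S" "snd c p \<in> S" "S \<subseteq> snd c ` chart_dom c"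
            "\<forall>x\<in>S. f (chart_inv c x) \<in> chart_dom c'"
          "smooth_on S (local_rep c c' f)"
        by (auto simp: charts_at_iff)
    have o1: "open (rep_dom c1 c (\<lambda>x. x))" "open (rep_dom c1 c2 f)" "open (rep_dom c' c2 (\<lambda>x. x))"
      by (rule rep_dom_open'[OF M M continuous_map_id[unfolded id_def] c1 c(1)]
          rep_dom_open'[OF M N cont c1 c2]
          rep_dom_open'[OF N N continuous_map_id[unfolded id_def] c'(1) c2])+
    have s1: "smooth_on (rep_dom c1 c (\<lambda>x. x)) (local_rep c1 c (\<lambda>x. x))"
      by (rule local_rep_smooth[OF smooth_map_ident[OF M] c1 c(1)])
    have s2: "smooth_on (rep_dom c' c2 (\<lambda>x. x)) (local_rep c' c2 (\<lambda>x. x))"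
      by (rule local_rep_smooth[OF smooth_map_ident[OF N] c'(1) c2])
    \<comment> \<open>On \<open>T\<close> the representative in \<open>c1\<close> and
      \<open>c2\<close> factors through \<open>c\<close> and \<open>c'\<close>, with a transition
      map on either side of the given representative.\<close>
    define T where "T = {y \<in> rep_dom c1 c (\<lambda>x. x). local_rep c1 c (\<lambda>x. x) y \<in> S} \<inter> rep_dom c1 c2 f"
    have T: "open T" unfolding T_def by (intro open_Int open_smooth_preimage o1 S s1)
    have Tin: "chart_inv c1 y \<in> chart_dom c1" "chart_inv c1 y \<in> chart_dom c"
        "f (chart_inv c1 y) \<in> chart_dom c2"
      "snd c (chart_inv c1 y) \<in> S" "f (chart_inv c1 y) \<in> chart_dom c'" if "y \<in> T" for y
    proof -
      have y: "y \<in> rep_dom c1 c (\<lambda>x. x)" "snd c (chart_inv c1 y) \<in> S" "y \<in> rep_dom c1 c2 f"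
        using that by (auto simp: T_def)
      show 1: "chart_inv c1 y \<in> chart_dom c1" "chart_inv c1 y \<in> chart_dom c"
          "f (chart_inv c1 y) \<in> chart_dom c2"
        using rep_dom_inv[OF M c1 y(1)] rep_dom_inv[OF M c1 y(3)] by auto
      show "snd c (chart_inv c1 y) \<in> S" by (rule y(2))
      then show "f (chart_inv c1 y) \<in> chart_dom c'" using S(4) chart_inv_chart[OF M c(1) 1(2)]
          by metis
    qed
    have st: "smooth_on T (\<lambda>y. local_rep c c' f (local_rep c1 c (\<lambda>x. x) y))"
      by (rule smooth_on_compose[OF cM T S(1) _ smooth_on_subset[OF s1] S(5)]) (auto simp: T_def)
    have "smooth_on T (\<lambda>y. local_rep c' c2 (\<lambda>x. x) (local_rep c c' f (local_rep c1 c (\<lambda>x. x) y)))"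
    proof (rule smooth_on_compose[OF cN T o1(3) _ st s2])
      show "(\<lambda>y. local_rep c c' f (local_rep c1 c (\<lambda>x. x) y)) ` T \<subseteq> rep_dom c' c2 (\<lambda>x. x)"
        using Tin chart_inv_chart[OF M c(1)] by auto
    qed
    then have "smooth_on T (local_rep c1 c2 f)"
      by (rule smooth_on_cong[OF T, rotated])
        (simp add: Tin chart_inv_chart[OF M c(1)] chart_inv_chart[OF N c'(1)])
    moreover have "x \<in> T"
      using p c S(2) x chart_inv_chart[OF M c1] by (auto simp: T_def)
    ultimately show "\<exists>T. open T \<and> x \<in> T \<and> smooth_on T (local_rep c1 c2 f)" using T by blast
  qed
  then show ?thesis using cont by (simp add: smooth_map_def)
qed

lemma smooth_map_compose:
  assumes M: "smooth_atlas M" and N: "smooth_atlas N" and Q: "smooth_atlas Q"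
    and f: "smooth_map M N f" and g: "smooth_map N Q g"
  shows "smooth_map M Q (\<lambda>p. g (f p))"
proof (rule smooth_mapI_local[OF M Q])
  fix p assume p: "p \<in> points M"
  obtain n b and u :: "nat \<Rightarrow> 'd \<Rightarrow> real" where cN: "coordinates n b u"
      using smooth_atlas_coordinates[OF N] by blast
  obtain c c' c'' where cc: "c \<in> charts_at M p" "c' \<in> charts_at N (f p)"
      "c'' \<in> charts_at Q (g (f p))"
    using chart_at_in M N Q p smooth_map_points[OF f] smooth_map_points[OF g] by metis
  then have c: "c \<in> atlas M" "p \<in> chart_dom c" "c' \<in> atlas N" "f p \<in> chart_dom c'" "c'' \<in> atlas Q"
      "g (f p) \<in> chart_dom c''"
    by (auto simp: charts_at_iff)
  define S where "S = {x \<in> rep_dom c c' f. local_rep c c' f x \<in> rep_dom c' c'' g}"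
  have S: "open S" unfolding S_def
    by (intro open_smooth_preimage local_rep_smooth[OF f] rep_dom_open[OF M N f]
        rep_dom_open[OF N Q g] c)
  have Sin: "chart_inv c x \<in> chart_dom c" "f (chart_inv c x) \<in> chart_dom c'"
      "g (f (chart_inv c x)) \<in> chart_dom c''"
    "x \<in> snd c ` chart_dom c" if "x \<in> S" for x
  proof -
    have "x \<in> rep_dom c c' f" and 2: "snd c' (f (chart_inv c x)) \<in> rep_dom c' c'' g" using that
        by (auto simp: S_def)
    note 1 = rep_dom_inv[OF M c(1) this(1)]
    show "chart_inv c x \<in> chart_dom c" "f (chart_inv c x) \<in> chart_dom c'" "x \<in> snd c ` chart_dom c"
        by (rule 1)+
    show "g (f (chart_inv c x)) \<in> chart_dom c''"
      using rep_dom_inv(2)[OF N c(3) 2] chart_inv_chart[OF N c(3) 1(2)] by simp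
  qed
  have "smooth_on S (\<lambda>x. local_rep c' c'' g (local_rep c c' f x))"
    by (rule smooth_on_compose[OF cN S rep_dom_open[OF N Q g c(3,5)] _
          smooth_on_subset[OF local_rep_smooth[OF f c(1,3)]] local_rep_smooth[OF g c(3,5)]])
              (auto simp: S_def)
  then have sm: "smooth_on S (local_rep c c'' (\<lambda>p. g (f p)))"
    by (rule smooth_on_cong[OF S, rotated]) (simp add: Sin chart_inv_chart[OF N c(3)])
  have "snd c p \<in> S" using c chart_inv_chart[OF M c(1,2)] by (auto simp: S_def)
  then show "\<exists>c\<in>charts_at M p. \<exists>c'\<in>charts_at Q (g (f p)). \<exists>S. open S \<and> snd c p \<in> S \<and>
      S \<subseteq> snd c ` chart_dom c \<and> (\<forall>x\<in>S. g (f (chart_inv c x)) \<in> chart_dom c') \<and>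
      smooth_on S (local_rep c c' (\<lambda>p. g (f p)))"
    using cc(1,3) S sm Sin by blast
qed

text \<open>The chain rule in charts. With the identity for \<open>f\<close> or \<open>g\<close> it
  is the rule for a change of chart, from which the compatibility of coordinate vectors
  follows.\<close>

lemma fderiv_local_rep_compose:
  assumes M: "smooth_atlas M" and N: "smooth_atlas N" and f: "smooth_map M N f"
      and g: "smooth_map N Q g"
    and c: "c \<in> charts_at M p" "c' \<in> charts_at N (f p)" "c'' \<in> charts_at Q (g (f p))"
  shows "fderiv (local_rep c c'' (\<lambda>p. g (f p))) (snd c p) v =
     fderiv (local_rep c' c'' g) (snd c' (f p)) (fderiv (local_rep c c' f) (snd c p) v)"
proof -
  have ca: "c \<in> atlas M" "c' \<in> atlas N" "p \<in> chart_dom c" using c by (auto simp: charts_at_iff)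
  have e: "local_rep c c' f (snd c p) = snd c' (f p)" using chart_inv_chart[OF M ca(1,3)] by simp
  have "fderiv (local_rep c c'' (\<lambda>p. g (f p))) (snd c p) v
      = fderiv (\<lambda>x. local_rep c' c'' g (local_rep c c' f x)) (snd c p) v"
    by (rule fun_cong[OF fderiv_cong_open[OF rep_dom_open[OF M N f ca(1,2)] in_rep_dom[where f
        = f, OF c(1,2)]]])
      (simp add: chart_inv_chart[OF N ca(2)] rep_dom_inv[OF M ca(1)])
  also have "\<dots> = fderiv (local_rep c' c'' g) (local_rep c c' f (snd c p)) (fderiv (local_rep c c' f)
      (snd c p) v)"
    by (rule fderiv_compose[OF local_rep_differentiable[OF f c(1,2)]])
      (use local_rep_differentiable[OF g c(2,3)] e in simp)
  finally show ?thesis by (simp add: e)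
qed


section \<open>Tangent vectors and differentials\<close>

lemma tangent_spaceD:
  assumes "v \<in> tangent_space M p"
  shows "c \<in> charts_at M p \<Longrightarrow> c' \<in> charts_at M p \<Longrightarrow> v c' = fderiv (local_rep c c' (\<lambda>x. x)) (snd c p)
      (v c)"
    "c \<notin> charts_at M p \<Longrightarrow> v c = 0"
  using assms unfolding tangent_space_def transition_def by blast+

lemma tangent_spaceI:
  assumes "\<And>c c'. c \<in> charts_at M p \<Longrightarrow> c' \<in> charts_at M p \<Longrightarrow>
      v c' = fderiv (local_rep c c' (\<lambda>x. x)) (snd c p) (v c)"
    and "\<And>c. c \<notin> charts_at M p \<Longrightarrow> v c = 0"
  shows "v \<in> tangent_space M p"
  using assms unfolding tangent_space_def transition_def by blast

lemma tangent_eqI: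
  assumes "v \<in> tangent_space M p" "w \<in> tangent_space M p" "c \<in> charts_at M p" "v c = w c"
  shows "v = w"
proof
  fix c'
  show "v c' = w c'"
  proof (cases "c' \<in> charts_at M p")
    case True
    show ?thesis
      using tangent_spaceD(1)[OF assms(1,3) True] tangent_spaceD(1)[OF assms(2,3) True]
          by (simp only: assms(4))
  next
    case False
    then show ?thesis using tangent_spaceD(2)[OF assms(1)] tangent_spaceD(2)[OF assms(2)] by simp
  qed
qed

lemma fderiv_local_rep_ident:
  assumes M: "smooth_atlas M" and c: "c \<in> charts_at M p"
  shows "fderiv (local_rep c c (\<lambda>x. x)) (snd c p) v = v"
proof -
  have ca: "c \<in> atlas M" "p \<in> chart_dom c" using c by (auto simp: charts_at_iff)
  have "fderiv (local_rep c c (\<lambda>x. x)) (snd c p) = fderiv (\<lambda>x. x) (snd c p)"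
    by (rule fderiv_cong_open[OF rep_dom_open[OF M M smooth_map_ident[OF M] ca(1) ca(1)]
          in_rep_dom[where f = "\<lambda>x. x", OF c c]]) (use chart_inv_chart[OF M ca(1)] in auto)
  then show ?thesis by simp
qed

lemma coord_vec_apply: "smooth_atlas M \<Longrightarrow> c \<in> charts_at M p \<Longrightarrow> coord_vec M c p \<xi> c = \<xi>"
  by (simp add: coord_vec_def transition_def[abs_def] fderiv_local_rep_ident)

lemma coord_vec_tangent:
  assumes M: "smooth_atlas M" and c: "c \<in> charts_at M p"
  shows "coord_vec M c p \<xi> \<in> tangent_space M p"
proof (rule tangent_spaceI)
  fix c1 c2 assume 1: "c1 \<in> charts_at M p" and 2: "c2 \<in> charts_at M p"
  show "coord_vec M c p \<xi> c2 = fderiv (local_rep c1 c2 (\<lambda>x. x)) (snd c1 p) (coord_vec M c p \<xi> c1)"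
    using 1 2 unfolding coord_vec_def transition_def if_P[OF 1] if_P[OF 2]
    by (intro fderiv_local_rep_compose[OF M M smooth_map_ident[OF M] smooth_map_ident[OF M] c])
qed (simp add: coord_vec_def)

lemma coord_vec_eq:
  assumes "smooth_atlas M" "c \<in> charts_at M p" "v \<in> tangent_space M p"
  shows "coord_vec M c p (v c) = v"
  by (rule tangent_eqI[OF coord_vec_tangent[OF assms(1,2)] assms(3,2)
      coord_vec_apply[OF assms(1,2)]])

lemma lincomb_tangent:
  assumes M: "smooth_atlas M" and v: "v \<in> tangent_space M p" "w \<in> tangent_space M p"
  shows "lincomb a v b w \<in> tangent_space M p"
proof -
  have lin: "linear (fderiv (local_rep c c' (\<lambda>x. x)) (snd c p))"
      if "c \<in> charts_at M p" "c' \<in> charts_at M p" for c c'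
    by (rule linear_fderiv[OF local_rep_differentiable[OF smooth_map_ident[OF M] that]])
  show ?thesis
  proof (rule tangent_spaceI)
    fix c c' assume c: "c \<in> charts_at M p" "c' \<in> charts_at M p"
    show "lincomb a v b w c' = fderiv (local_rep c c' (\<lambda>x. x)) (snd c p) (lincomb a v b w c)"
      unfolding lincomb_def linear_add[OF lin[OF c]] linear_scale[OF lin[OF c]]
        tangent_spaceD(1)[OF v(1) c, symmetric] tangent_spaceD(1)[OF v(2) c, symmetric] ..
  qed (simp add: lincomb_def tangent_spaceD(2)[OF v(1)] tangent_spaceD(2)[OF v(2)])
qed

lemma coord_vec_lincomb:
  assumes M: "smooth_atlas M" and c: "c \<in> charts_at M p"
  shows "coord_vec M c p (a *\<^sub>R \<xi> + b *\<^sub>R \<eta>) = lincomb a (coord_vec M c p \<xi>) b (coord_vec M c p \<eta>)"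
  by (rule tangent_eqI[OF coord_vec_tangent[OF M c] lincomb_tangent[OF M coord_vec_tangent[OF M c]
      coord_vec_tangent[OF M c]] c])
    (simp add: lincomb_def coord_vec_apply[OF M c])

text \<open>Frees \<open>differential\<close> from the arbitrary chart in its definition, so that
  charts can be chosen to suit each argument.\<close>

lemma differential_apply:
  assumes M: "smooth_atlas M" and f: "smooth_map M N f" and v: "v \<in> tangent_space M p"
    and c: "c \<in> charts_at M p" and c': "c' \<in> charts_at N (f p)"
  shows "differential M N f p v c' = fderiv (local_rep c c' f) (snd c p) (v c)"
proof -
  let ?c = "chart_at M p"
  have c0: "?c \<in> charts_at M p" by (rule chart_at_in[OF M charts_at_points[OF M c]])
  have "differential M N f p v c' = fderiv (local_rep ?c c' f) (snd ?c p) (v ?c)"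
    using c' by (simp add: differential_def Let_def)
  also have "\<dots> = fderiv (local_rep c c' f) (snd c p) (fderiv (local_rep ?c c (\<lambda>x. x)) (snd ?c p)
      (v ?c))"
    by (rule fderiv_local_rep_compose[OF M M smooth_map_ident[OF M] f c0 c c'])
  also have "fderiv (local_rep ?c c (\<lambda>x. x)) (snd ?c p) (v ?c) = v c"
    using tangent_spaceD(1)[OF v c0 c] by simp
  finally show ?thesis .
qed

text \<open>All coordinates of the image are computed from the single vector
  \<open>v (chart_at M p)\<close>, and so they are compatible for every family
  \<open>v\<close>.\<close>

lemma differential_tangent:
  assumes M: "smooth_atlas M" and N: "smooth_atlas N" and f: "smooth_map M N f"
      and p: "p \<in> points M"
  shows "differential M N f p v \<in> tangent_space N (f p)"
proof (rule tangent_spaceI)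
  fix c1 c2 assume 1: "c1 \<in> charts_at N (f p)" and 2: "c2 \<in> charts_at N (f p)"
  show "differential M N f p v c2 = fderiv (local_rep c1 c2 (\<lambda>x. x)) (snd c1 (f p))
      (differential M N f p v c1)"
    unfolding differential_def Let_def if_P[OF 1] if_P[OF 2]
    by (rule fderiv_local_rep_compose[OF M N f smooth_map_ident[OF N] chart_at_in[OF M p] 1 2])
qed (simp add: differential_def)

lemma differential_compose:
  assumes M: "smooth_atlas M" and N: "smooth_atlas N" and Q: "smooth_atlas Q"
    and f: "smooth_map M N f" and g: "smooth_map N Q g" and p: "p \<in> points M"
        and v: "v \<in> tangent_space M p"
  shows "differential M Q (\<lambda>p. g (f p)) p v = differential N Q g (f p) (differential M N f p v)"
proof -
  have fp: "f p \<in> points N" and gp: "g (f p) \<in> points Q"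
    using smooth_map_points[OF f p] smooth_map_points[OF g] by auto
  let ?c = "chart_at M p" and ?c' = "chart_at N (f p)" and ?c'' = "chart_at Q (g (f p))"
  have c: "?c \<in> charts_at M p" "?c' \<in> charts_at N (f p)" "?c'' \<in> charts_at Q (g (f p))"
    by (rule chart_at_in[OF M p] chart_at_in[OF N fp] chart_at_in[OF Q gp])+
  note gf = smooth_map_compose[OF M N Q f g]
  note df = differential_tangent[OF M N f p]
  show ?thesis
  proof (rule tangent_eqI[OF differential_tangent[OF M Q gf p] differential_tangent[OF N Q g fp]
      c(3)])
    show "differential M Q (\<lambda>p. g (f p)) p v ?c'' = differential N Q g (f p)
        (differential M N f p v) ?c''"
      unfolding differential_apply[OF M gf v c(1,3)] differential_apply[OF N g df c(2,3)]
        differential_apply[OF M f v c(1,2)]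
      by (rule fderiv_local_rep_compose[OF M N f g c])
  qed
qed

lemma differential_lincomb:
  assumes M: "smooth_atlas M" and N: "smooth_atlas N" and f: "smooth_map M N f"
      and p: "p \<in> points M"
  shows "differential M N f p (lincomb a v b w) = lincomb a (differential M N f p v)
      b (differential M N f p w)"
proof
  fix c'
  show "differential M N f p (lincomb a v b w) c' = lincomb a (differential M N f p v)
      b (differential M N f p w) c'"
  proof (cases "c' \<in> charts_at N (f p)")
    case True
    have "linear (fderiv (local_rep (chart_at M p) c' f) (snd (chart_at M p) p))"
      by (rule linear_fderiv[OF local_rep_differentiable[OF f chart_at_in[OF M p] True]])
    then show ?thesis using True
      by (simp add: differential_def lincomb_def Let_def linear_add linear_scale)
  qed (simp add: differential_def lincomb_def)
qed

text \<open>Maps are total functions and may differ outside of \<open>M\<close>. The image of a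
  chart is open and consists of coordinates of points of \<open>M\<close>, so the derivatives cannot
  see the difference.\<close>

lemma differential_cong:
  fixes M :: "('a, 'e::real_normed_vector) manifold" and N :: "('b, 'f::real_normed_vector)
      manifold"
  assumes M: "smooth_atlas M" and p: "p \<in> points M" and fg: "\<And>q. q \<in> points M \<Longrightarrow> f q = g q"
  shows "differential M N f p v = differential M N g p v"
proof -
  let ?c = "chart_at M p"
  have c: "?c \<in> atlas M" "p \<in> chart_dom ?c" using chart_at_in[OF M p] by (auto simp: charts_at_iff)
  have "open (snd ?c ` chart_dom ?c)" using M c(1) by (simp add: smooth_atlas_def)
  then have "fderiv (local_rep ?c c' f) (snd ?c p) = fderiv (local_rep ?c c' g) (snd ?c p)"
      for c' :: "('b, 'f) chart"
    by (rule fderiv_cong_open) (use c chart_inv_in fg chart_dom_subset[OF M c(1)]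
        in \<open>auto dest!: chart_inv_in\<close>)
  then show ?thesis unfolding differential_def Let_def fg[OF p] by (intro ext) simp
qed

lemma differential_ident:
  assumes M: "smooth_atlas M" and v: "v \<in> tangent_space M p" and p: "p \<in> points M"
  shows "differential M M (\<lambda>x. x) p v = v"
  by (rule tangent_eqI[OF differential_tangent[OF M M smooth_map_ident[OF M] p]
      v chart_at_in[OF M p]])
    (simp add: differential_apply[OF M smooth_map_ident[OF M] v chart_at_in[OF M p]
        chart_at_in[OF M p]]
      fderiv_local_rep_ident[OF M chart_at_in[OF M p]])

section \<open>Pullback and exterior derivative\<close>

text \<open>
  The conditions of \<open>forms\<close> except for the one on the degree: the value of a cochain at an
  element of the Lie algebra is such a form.
\<close>

definition all_forms :: "('a, 'e::real_normed_vector) manifold \<Rightarrow> ('a, 'e) form set" where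
  "all_forms M =
     {\<omega>. (\<forall>p vs. \<omega> p vs \<noteq> 0 \<longrightarrow> p \<in> points M \<and> set vs \<subseteq> tangent_space M p) \<and>
         (\<forall>p\<in>points M. \<forall>us vs v w a b.
            set us \<union> set vs \<union> {v, w} \<subseteq> tangent_space M p \<longrightarrow>
            \<omega> p (us @ lincomb a v b w # vs) = a * \<omega> p (us @ v # vs) + b * \<omega> p (us @ w # vs)) \<and>
         (\<forall>p\<in>points M. \<forall>vs. \<not> distinct vs \<longrightarrow> \<omega> p vs = 0) \<and>
         (\<forall>c\<in>atlas M. \<forall>\<xi>s. smooth_on (snd c ` chart_dom c) (\<lambda>x. local_form M c \<omega> x \<xi>s))}"

lemma forms_iff: "\<omega> \<in> forms M l \<longleftrightarrow> \<omega> \<in> all_forms M \<and> (\<forall>p vs. \<omega> p vs \<noteq> 0 \<longrightarrow> length vs = l)"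
  unfolding forms_def all_forms_def by blast

lemma all_formsD:
  assumes "\<omega> \<in> all_forms M"
  shows "p \<notin> points M \<or> \<not> set vs \<subseteq> tangent_space M p \<Longrightarrow> \<omega> p vs = 0"
    "p \<in> points M \<Longrightarrow> set us \<union> set vs \<union> {v, w} \<subseteq> tangent_space M p \<Longrightarrow>
       \<omega> p (us @ lincomb a v b w # vs) = a * \<omega> p (us @ v # vs) + b * \<omega> p (us @ w # vs)"
    "p \<in> points M \<Longrightarrow> \<not> distinct vs \<Longrightarrow> \<omega> p vs = 0"
    "c \<in> atlas M \<Longrightarrow> smooth_on (snd c ` chart_dom c) (\<lambda>x. local_form M c \<omega> x \<xi>s)"
  using assms unfolding all_forms_def by blast+

lemma all_formsI:
  assumes "\<And>p vs. p \<notin> points M \<or> \<not> set vs \<subseteq> tangent_space M p \<Longrightarrow> \<omega> p vs = 0"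
    "\<And>p us vs v w a b. p \<in> points M \<Longrightarrow> set us \<subseteq> tangent_space M p \<Longrightarrow> set vs \<subseteq> tangent_space M p \<Longrightarrow>
       v \<in> tangent_space M p \<Longrightarrow> w \<in> tangent_space M p \<Longrightarrow>
       \<omega> p (us @ lincomb a v b w # vs) = a * \<omega> p (us @ v # vs) + b * \<omega> p (us @ w # vs)"
    "\<And>p vs. p \<in> points M \<Longrightarrow> \<not> distinct vs \<Longrightarrow> \<omega> p vs = 0"
    "\<And>c \<xi>s. c \<in> atlas M \<Longrightarrow> smooth_on (snd c ` chart_dom c) (\<lambda>x. local_form M c \<omega> x \<xi>s)"
  shows "\<omega> \<in> all_forms M"
proof -
  have "\<forall>p vs. \<omega> p vs \<noteq> 0 \<longrightarrow> p \<in> points M \<and> set vs \<subseteq> tangent_space M p" using assms(1) by blast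
  moreover have "\<forall>p\<in>points M. \<forall>us vs v w a b.
            set us \<union> set vs \<union> {v, w} \<subseteq> tangent_space M p \<longrightarrow>
            \<omega> p (us @ lincomb a v b w # vs) = a * \<omega> p (us @ v # vs) + b * \<omega> p (us @ w # vs)"
    using assms(2) by simp
  moreover have "\<forall>p\<in>points M. \<forall>vs. \<not> distinct vs \<longrightarrow> \<omega> p vs = 0" using assms(3) by blast
  moreover have "\<forall>c\<in>atlas M. \<forall>\<xi>s. smooth_on (snd c ` chart_dom c) (\<lambda>x. local_form M c \<omega> x \<xi>s)"
    using assms(4) by blast
  ultimately show ?thesis unfolding all_forms_def by blast
qed

lemma chart_open: "smooth_atlas M \<Longrightarrow> c \<in> atlas M \<Longrightarrow> open (snd c ` chart_dom c)"
  by (simp add: smooth_atlas_def)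

lemma charts_at_chart_inv: "c \<in> atlas M \<Longrightarrow> x \<in> snd c ` chart_dom c \<Longrightarrow> c \<in> charts_at M (chart_inv c x)"
  by (simp add: charts_at_iff chart_inv_in)

lemma form_on_local_form:
  assumes M: "smooth_atlas M" and w: "\<omega> \<in> all_forms M" and c: "c \<in> atlas M"
  shows "form_on (snd c ` chart_dom c) (local_form M c \<omega>)"
  unfolding form_on_def
proof (intro conjI ballI allI)
  show "open (snd c ` chart_dom c)" by (rule chart_open[OF M c])
  show "smooth_on (snd c ` chart_dom c) (\<lambda>y. local_form M c \<omega> y \<xi>s)" for \<xi>s
      by (rule all_formsD(4)[OF w c])
  fix y assume y: "y \<in> snd c ` chart_dom c"
  let ?p = "chart_inv c y"
  have p: "c \<in> charts_at M ?p" by (rule charts_at_chart_inv[OF c y])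
  have pM: "?p \<in> points M" by (rule charts_at_points[OF M p])
  show "alternating_form (local_form M c \<omega> y)"
    unfolding alternating_form_def local_form_def
    using all_formsD(2)[OF w pM] all_formsD(3)[OF w pM]
    by (auto simp: coord_vec_lincomb[OF M p] coord_vec_tangent[OF M p]
        image_subset_iff distinct_map)
qed

lemma form_eval:
  assumes M: "smooth_atlas M" and c: "c \<in> charts_at M p" and vs: "set vs \<subseteq> tangent_space M p"
  shows "\<omega> p vs = local_form M c \<omega> (snd c p) (map (\<lambda>v. v c) vs)"
proof -
  have "c \<in> atlas M" "p \<in> chart_dom c" using c by (auto simp: charts_at_iff)
  moreover have "map (coord_vec M c p) (map (\<lambda>v. v c) vs) = vs"
    using vs coord_vec_eq[OF M c] by (induction vs) auto
  ultimately show ?thesis by (simp add: local_form_def chart_inv_chart[OF M] del: map_map)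
qed

lemma local_rep_image:
  "smooth_atlas M \<Longrightarrow> c \<in> atlas M \<Longrightarrow> local_rep c c' f ` rep_dom c c' f \<subseteq> snd c' ` chart_dom c'"
  using rep_dom_inv(2)[of M c _ f c'] by blast

lemma local_form_pullback:
  assumes M: "smooth_atlas M" and N: "smooth_atlas N" and f: "smooth_map M N f"
    and c: "c \<in> atlas M" and c': "c' \<in> atlas N" and x: "x \<in> rep_dom c c' f"
  shows "local_form M c (pullback M N f \<omega>) x \<xi>s = pull (local_rep c c' f) (local_form N c' \<omega>) x \<xi>s"
proof -
  let ?p = "chart_inv c x"
  note i = rep_dom_inv[OF M c x]
  have p: "c \<in> charts_at M ?p" "c' \<in> charts_at N (f ?p)" using i c c' by (auto simp: charts_at_iff)
  have pM: "?p \<in> points M" by (rule charts_at_points[OF M p(1)])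
  have "local_form M c (pullback M N f \<omega>) x \<xi>s
      = \<omega> (f ?p) (map (differential M N f ?p) (map (coord_vec M c ?p) \<xi>s))"
    using pM by (simp add: local_form_def pullback_def coord_vec_tangent[OF M p(1)]
        image_subset_iff)
  also have "\<dots> = local_form N c' \<omega> (snd c' (f ?p))
      (map (\<lambda>v. v c') (map (differential M N f ?p) (map (coord_vec M c ?p) \<xi>s)))"
    by (rule form_eval[OF N p(2)]) (auto intro: differential_tangent[OF M N f pM])
  also have "map (\<lambda>v. v c') (map (differential M N f ?p) (map (coord_vec M c ?p) \<xi>s))
      = map (fderiv (local_rep c c' f) x) \<xi>s"
    by (simp add: differential_apply[OF M f coord_vec_tangent[OF M p(1)] p]
        coord_vec_apply[OF M p(1)] i(3))
  finally show ?thesis by (simp add: pull_def)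
qed

lemma pullback_all_forms:
  assumes M: "smooth_atlas M" and N: "smooth_atlas N" and f: "smooth_map M N f"
      and w: "\<omega> \<in> all_forms N"
  shows "pullback M N f \<omega> \<in> all_forms M"
proof (rule all_formsI)
  fix p vs assume "p \<notin> points M \<or> \<not> set vs \<subseteq> tangent_space M p"
  then show "pullback M N f \<omega> p vs = 0" by (auto simp: pullback_def)
next
  fix p us vs v w a b
  assume p: "p \<in> points M" and t: "set us \<subseteq> tangent_space M p" "set vs \<subseteq> tangent_space M p"
       "v \<in> tangent_space M p" "w \<in> tangent_space M p"
  have "\<omega> (f p) (map (differential M N f p) us @ lincomb a (differential M N f p v)
      b (differential M N f p w) # map (differential M N f p) vs)
     = a * \<omega> (f p) (map (differential M N f p) us @ differential M N f p v # map (differential M N f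
         p) vs)
     + b * \<omega> (f p) (map (differential M N f p) us @ differential M N f p w # map (differential M N f
         p) vs)"
    by (rule all_formsD(2)[OF w smooth_map_points[OF f p]]) (auto intro: differential_tangent[OF M N
        f p])
  then show "pullback M N f \<omega> p (us @ lincomb a v b w # vs) =
      a * pullback M N f \<omega> p (us @ v # vs) + b * pullback M N f \<omega> p (us @ w # vs)"
    using p t by (simp add: pullback_def differential_lincomb[OF M N f p] lincomb_tangent[OF M])
next
  show "pullback M N f \<omega> p vs = 0" if "p \<in> points M" "\<not> distinct vs" for p vs
    using that all_formsD(3)[OF w smooth_map_points[OF f]] by (auto simp: pullback_def distinct_map)
next
  fix c \<xi>s assume c: "c \<in> atlas M"
  obtain n b and u :: "nat \<Rightarrow> 'd \<Rightarrow> real" where cN: "coordinates n b u"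
      using smooth_atlas_coordinates[OF N] by blast
  show "smooth_on (snd c ` chart_dom c) (\<lambda>x. local_form M c (pullback M N f \<omega>) x \<xi>s)"
  proof (rule smooth_on_local)
    fix x assume "x \<in> snd c ` chart_dom c"
    then obtain p where p: "p \<in> chart_dom c" "x = snd c p" by blast
    have pM: "p \<in> points M" using p(1) chart_dom_subset[OF M c] by blast
    obtain c' where c': "c' \<in> charts_at N (f p)" using chart_at_in[OF N smooth_map_points[OF f pM]]
        by blast
    then have c'N: "c' \<in> atlas N" by (simp add: charts_at_iff)
    note o = rep_dom_open[OF M N f c c'N]
    have "form_on (rep_dom c c' f) (pull (local_rep c c' f) (local_form N c' \<omega>))"
      by (rule form_on_pull[OF cN form_on_local_form[OF N w c'N] o local_rep_image[OF M c]
          local_rep_smooth[OF f c c'N]])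
    from form_onD(3)[OF this, of \<xi>s]
    have "smooth_on (rep_dom c c' f) (\<lambda>x. local_form M c (pullback M N f \<omega>) x \<xi>s)"
      by (rule smooth_on_cong[OF o, rotated]) (simp add: local_form_pullback[OF M N f c c'N])
    moreover have "x \<in> rep_dom c c' f" using p c' by (auto simp: charts_at_iff)
    ultimately show "\<exists>T. open T \<and> x \<in> T \<and> smooth_on T (\<lambda>x. local_form M c (pullback M N f \<omega>) x \<xi>s)"
      using o by blast
  qed
qed

lemma pullback_ident:
  assumes M: "smooth_atlas M" and w: "\<omega> \<in> all_forms M"
  shows "pullback M M (\<lambda>x. x) \<omega> = \<omega>"
proof (intro ext)
  fix p vs
  show "pullback M M (\<lambda>x. x) \<omega> p vs = \<omega> p vs"
  proof (cases "p \<in> points M \<and> set vs \<subseteq> tangent_space M p")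
    case True
    then have "map (differential M M (\<lambda>x. x) p) vs = vs"
      using differential_ident[OF M] by (auto intro!: map_idI)
    then show ?thesis using True by (simp add: pullback_def)
  next
    case False
    then show ?thesis using all_formsD(1)[OF w] by (auto simp: pullback_def)
  qed
qed

text \<open>A change of chart is treated as a pullback along the identity of \<open>M\<close>: the
  local form in one chart is the \<open>pull\<close> of the local form in the other along the
  transition map, and \<open>lext\<close> is compatible with \<open>pull\<close>.\<close>

lemma ext_deriv_eq_lext:
  assumes M: "smooth_atlas M" and w: "\<omega> \<in> all_forms M" and c: "c \<in> charts_at M p"
    and vs: "set vs \<subseteq> tangent_space M p"
  shows "ext_deriv M \<omega> p vs = lext (local_form M c \<omega>) (snd c p) (map (\<lambda>v. v c) vs)"
proof -
  let ?c = "chart_at M p"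
  let ?h = "local_rep ?c c (\<lambda>x. x)"
  have pM: "p \<in> points M" by (rule charts_at_points[OF M c])
  have c0: "?c \<in> charts_at M p" by (rule chart_at_in[OF M pM])
  have ca: "c \<in> atlas M" "?c \<in> atlas M" "p \<in> chart_dom ?c" using c c0 by (auto simp: charts_at_iff)
  obtain n b and u :: "nat \<Rightarrow> 'b \<Rightarrow> real" where cM: "coordinates n b u"
      using smooth_atlas_coordinates[OF M] by blast
  note o = rep_dom_open[OF M M smooth_map_ident[OF M] ca(2,1)]
  have x: "snd ?c p \<in> rep_dom ?c c (\<lambda>x. x)" by (rule in_rep_dom[where f = "\<lambda>x. x", OF c0 c])
  have "ext_deriv M \<omega> p vs = lext (local_form M ?c \<omega>) (snd ?c p) (map (\<lambda>v. v ?c) vs)"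
    using pM vs by (simp add: ext_deriv_def lext_def Let_def omit_map) (simp add: omit_def)
  also have "\<dots> = lext (pull ?h (local_form M c \<omega>)) (snd ?c p) (map (\<lambda>v. v ?c) vs)"
    by (rule lext_cong[OF o x])
      (metis local_form_pullback[OF M M smooth_map_ident[OF M] ca(2,1)] pullback_ident[OF M w])
  also have "\<dots> = lext (local_form M c \<omega>) (?h (snd ?c p)) (map (fderiv ?h (snd ?c p)) (map (\<lambda>v. v ?c)
      vs))"
    by (rule lext_pull[OF cM form_on_local_form[OF M w ca(1)] o local_rep_image[OF M ca(2)] x
          local_rep_smooth[OF smooth_map_ident[OF M] ca(2,1)]])
  also have "?h (snd ?c p) = snd c p" using chart_inv_chart[OF M ca(2,3)] by simp
  also have "map (fderiv ?h (snd ?c p)) (map (\<lambda>v. v ?c) vs) = map (\<lambda>v. v c) vs"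
    using tangent_spaceD(1)[OF _ c0 c, symmetric] vs by auto
  finally show ?thesis .
qed

lemma pullback_ext_deriv:
  assumes M: "smooth_atlas M" and N: "smooth_atlas N" and f: "smooth_map M N f"
      and w: "\<omega> \<in> all_forms N"
  shows "ext_deriv M (pullback M N f \<omega>) = pullback M N f (ext_deriv N \<omega>)"
proof (intro ext)
  fix p vs
  show "ext_deriv M (pullback M N f \<omega>) p vs = pullback M N f (ext_deriv N \<omega>) p vs"
  proof (cases "p \<in> points M \<and> set vs \<subseteq> tangent_space M p")
    case True
    then have p: "p \<in> points M" and vs: "set vs \<subseteq> tangent_space M p" by auto
    obtain c where c: "c \<in> charts_at M p" using chart_at_in[OF M p] by blast
    obtain c' where c': "c' \<in> charts_at N (f p)" using chart_at_in[OF N smooth_map_points[OF f p]]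
        by blast
    have ca: "c \<in> atlas M" "c' \<in> atlas N" "p \<in> chart_dom c" using c c' by (auto simp: charts_at_iff)
    let ?h = "local_rep c c' f"
    obtain n b and u :: "nat \<Rightarrow> 'd \<Rightarrow> real" where cN: "coordinates n b u"
        using smooth_atlas_coordinates[OF N] by blast
    note o = rep_dom_open[OF M N f ca(1,2)]
    have x: "snd c p \<in> rep_dom c c' f" by (rule in_rep_dom[where f = f, OF c c'])
    have "ext_deriv M (pullback M N f \<omega>) p vs = lext (local_form M c (pullback M N f \<omega>)) (snd c p)
        (map (\<lambda>v. v c) vs)"
      by (rule ext_deriv_eq_lext[OF M pullback_all_forms[OF M N f w] c vs])
    also have "\<dots> = lext (pull ?h (local_form N c' \<omega>)) (snd c p) (map (\<lambda>v. v c) vs)"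
      by (rule lext_cong[OF o x local_form_pullback[OF M N f ca(1,2)]])
    also have "\<dots> = lext (local_form N c' \<omega>) (?h (snd c p)) (map (fderiv ?h (snd c p)) (map (\<lambda>v. v c)
        vs))"
      by (rule lext_pull[OF cN form_on_local_form[OF N w ca(2)] o local_rep_image[OF M ca(1)] x
            local_rep_smooth[OF f ca(1,2)]])
    also have "?h (snd c p) = snd c' (f p)" using chart_inv_chart[OF M ca(1,3)] by simp
    also have "map (fderiv ?h (snd c p)) (map (\<lambda>v. v c) vs)
        = map (\<lambda>v. v c') (map (differential M N f p) vs)"
      using differential_apply[OF M f _ c c'] vs by auto
    also have "lext (local_form N c' \<omega>) (snd c' (f p)) (map (\<lambda>v. v c') (map (differential M N f p)
        vs))
        = ext_deriv N \<omega> (f p) (map (differential M N f p) vs)"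
      by (rule ext_deriv_eq_lext[OF N w c', symmetric]) (auto intro: differential_tangent[OF M N f
          p])
    finally show ?thesis using True by (simp add: pullback_def)
  next
    case False
    then show ?thesis by (auto simp: pullback_def ext_deriv_def)
  qed
qed

lemma pullback_compose:
  assumes M: "smooth_atlas M" and N: "smooth_atlas N" and Q: "smooth_atlas Q"
    and f: "smooth_map M N f" and g: "smooth_map N Q g"
  shows "pullback M N f (pullback N Q g \<omega>) = pullback M Q (\<lambda>p. g (f p)) \<omega>"
proof (intro ext)
  fix p vs
  show "pullback M N f (pullback N Q g \<omega>) p vs = pullback M Q (\<lambda>p. g (f p)) \<omega> p vs"
  proof (cases "p \<in> points M \<and> set vs \<subseteq> tangent_space M p")
    case True
    then have p: "p \<in> points M" and vs: "set vs \<subseteq> tangent_space M p" by auto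
    have "map (differential N Q g (f p)) (map (differential M N f p) vs)
        = map (differential M Q (\<lambda>p. g (f p)) p) vs"
      using differential_compose[OF M N Q f g p] vs by auto
    moreover have "set (map (differential M N f p) vs) \<subseteq> tangent_space N (f p)"
      by (auto intro: differential_tangent[OF M N f p])
    ultimately show ?thesis using True smooth_map_points[OF f p]
        by (simp add: pullback_def del: map_map)
  qed (auto simp: pullback_def)
qed

lemma pullback_cong:
  assumes M: "smooth_atlas M" and fg: "\<And>q. q \<in> points M \<Longrightarrow> f q = g q"
  shows "pullback M N f \<omega> = pullback M N g \<omega>"
proof (intro ext)
  fix p vs
  show "pullback M N f \<omega> p vs = pullback M N g \<omega> p vs"
  proof (cases "p \<in> points M")
    case True
    have "differential M N f p = differential M N g p"
      by (rule ext) (rule differential_cong[OF M True fg])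
    then show ?thesis by (simp add: pullback_def fg[OF True])
  qed (simp add: pullback_def)
qed

section \<open>Linear combinations of forms\<close>

lemma all_forms_lincomb:
  assumes M: "smooth_atlas M" and w: "\<omega> \<in> all_forms M" and e: "\<eta> \<in> all_forms M"
  shows "(\<lambda>p vs. r * \<omega> p vs + s * \<eta> p vs) \<in> all_forms M"
proof (rule all_formsI)
  fix c \<xi>s assume c: "c \<in> atlas M"
  have "smooth_on (snd c ` chart_dom c) (\<lambda>x. r *\<^sub>R local_form M c \<omega> x \<xi>s
      + s *\<^sub>R local_form M c \<eta> x \<xi>s)"
    by (intro smooth_on_add smooth_on_scaleR smooth_on_const chart_open[OF M c]
        all_formsD(4)[OF w c] all_formsD(4)[OF e c])
  then show "smooth_on (snd c ` chart_dom c) (\<lambda>x. local_form M c (\<lambda>p vs. r * \<omega> p vs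
      + s * \<eta> p vs) x \<xi>s)"
    by (simp add: local_form_def)
qed (use all_formsD(1-3)[OF w] all_formsD(1-3)[OF e] in \<open>auto simp: algebra_simps\<close>)

lemma all_forms_zero: "smooth_atlas M \<Longrightarrow> (\<lambda>p vs. 0) \<in> all_forms M"
  by (rule all_formsI) (auto simp: local_form_def[abs_def] smooth_on_const)

lemma all_forms_sum:
  assumes M: "smooth_atlas M" and "\<And>i. i \<in> I \<Longrightarrow> \<omega> i \<in> all_forms M"
  shows "(\<lambda>p vs. \<Sum>i\<in>I. a i * \<omega> i p vs) \<in> all_forms M"
  using assms(2)
proof (induction I rule: infinite_finite_induct)
  case (insert i I)
  then show ?case using all_forms_lincomb[OF M, of "\<omega> i" "\<lambda>p vs. \<Sum>i\<in>I. a i * \<omega> i p vs" "a i" 1]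
      by simp
qed (simp_all add: all_forms_zero[OF M])

lemma local_form_differentiable:
  assumes "smooth_atlas M" "\<omega> \<in> all_forms M" "c \<in> charts_at M p"
  shows "(\<lambda>x. local_form M c \<omega> x \<xi>s) differentiable (at (snd c p))"
  using smooth_on_differentiable[OF all_formsD(4)[OF assms(2)]] assms(3)
      by (auto simp: charts_at_iff)

lemma ext_deriv_lincomb:
  assumes M: "smooth_atlas M" and w: "\<omega> \<in> all_forms M" and e: "\<eta> \<in> all_forms M"
  shows "ext_deriv M (\<lambda>p vs. r * \<omega> p vs + s * \<eta> p vs) = (\<lambda>p vs. r * ext_deriv M \<omega> p vs
      + s * ext_deriv M \<eta> p vs)"
proof (intro ext)
  fix p vs
  show "ext_deriv M (\<lambda>p vs. r * \<omega> p vs + s * \<eta> p vs) p vs = r * ext_deriv M \<omega> p vs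
      + s * ext_deriv M \<eta> p vs"
  proof (cases "p \<in> points M")
    case True
    let ?c = "chart_at M p"
    have c: "?c \<in> charts_at M p" by (rule chart_at_in[OF M True])
    have "fderiv (\<lambda>x. local_form M ?c (\<lambda>p vs. r * \<omega> p vs + s * \<eta> p vs) x \<xi>s) (snd ?c p) v =
      r * fderiv (\<lambda>x. local_form M ?c \<omega> x \<xi>s) (snd ?c p) v + s * fderiv (\<lambda>x. local_form M ?c \<eta> x \<xi>s)
          (snd ?c p) v" for \<xi>s v
    proof -
      have "((\<lambda>x. r * local_form M ?c \<omega> x \<xi>s + s * local_form M ?c \<eta> x \<xi>s) has_derivative
        (\<lambda>v. r * fderiv (\<lambda>x. local_form M ?c \<omega> x \<xi>s) (snd ?c p) v
            + s * fderiv (\<lambda>x. local_form M ?c \<eta> x \<xi>s) (snd ?c p) v)) (at (snd ?c p))"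
        by (intro has_derivative_add has_derivative_mult_right fderiv_has local_form_differentiable
            M w e c)
      from fderiv_eq[OF this] show ?thesis by (simp add: local_form_def[abs_def])
    qed
    then show ?thesis
      by (simp add: ext_deriv_def Let_def sum_distrib_left sum.distrib[symmetric] algebra_simps)
  qed (simp add: ext_deriv_def)
qed

section \<open>Products of manifolds\<close>

lemma coordinates_prod:
  fixes u :: "nat \<Rightarrow> 'a::real_normed_vector \<Rightarrow> real" and w :: "nat \<Rightarrow> 'b::real_normed_vector \<Rightarrow> real"
  assumes c: "coordinates n b u" and d: "coordinates m d w"
  shows "coordinates (n + m) (\<lambda>i. if i < n then (b i, 0) else (0, d (i - n)))
     (\<lambda>i x. if i < n then u i (fst x) else w (i - n) (snd x))"
  unfolding coordinates_def
proof (intro conjI allI impI)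
  fix i assume i: "i < n + m"
  show "bounded_linear (\<lambda>x. if i < n then u i (fst x) else w (i - n) (snd x))"
  proof (cases "i < n")
    case True
    then show ?thesis
      using bounded_linear_compose[OF coordinates_bounded_linear[OF c] bounded_linear_fst] by simp
  next
    case False
    then have "i - n < m" using i by arith
    then show ?thesis using False
        bounded_linear_compose[OF coordinates_bounded_linear[OF d, of "i - n"] bounded_linear_snd] i
      by auto
  qed
next
  fix x :: "'a \<times> 'b"
  have s: "(\<Sum>i<n + m. F i) = (\<Sum>i<n. F i) + (\<Sum>i<m. F (n + i))" for F :: "nat \<Rightarrow> 'a \<times> 'b"
    by (induction m) (auto simp: add.assoc)
  have "(\<Sum>i<n. u i (fst x) *\<^sub>R (b i, 0 :: 'b)) = (fst x, 0)"
    using coordinates_sum[OF c, of "fst x"] by (simp add: prod_eq_iff fst_sum snd_sum)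
  moreover have "(\<Sum>i<m. w i (snd x) *\<^sub>R (0 :: 'a, d i)) = (0, snd x)"
    using coordinates_sum[OF d, of "snd x"] by (simp add: prod_eq_iff fst_sum snd_sum)
  ultimately show "(\<Sum>i<n + m. (if i < n then u i (fst x) else w (i - n) (snd x)) *\<^sub>R
      (if i < n then (b i, 0) else (0, d (i - n)))) = x"
    unfolding s by simp
next
  fix i j assume "i < n + m" "j < n + m"
  moreover have "u i 0 = 0" if "i < n" for i
    using coordinates_bounded_linear[OF c that] by (simp add: linear_simps)
  moreover have "w i 0 = 0" if "i < m" for i
    using coordinates_bounded_linear[OF d that] by (simp add: linear_simps)
  ultimately show "(if i < n then u i (fst (if j < n then (b j, 0) else (0, d (j - n))))
      else w (i - n) (snd (if j < n then (b j, 0) else (0, d (j - n))))) = (if i = j then 1 else 0)"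
    using c d unfolding coordinates_def by auto
qed

abbreviation prod_chart :: "('a, 'e) chart \<Rightarrow> ('b, 'f) chart \<Rightarrow> ('a \<times> 'b, 'e \<times> 'f) chart" where
  "prod_chart c d \<equiv> (chart_dom c \<times> chart_dom d, map_prod (snd c) (snd d))"

lemma points_prod: "points (prod_manifold M N) = points M \<times> points N"
  by (simp add: prod_manifold_def)

lemma atlas_prod: "k \<in> atlas (prod_manifold M N) \<longleftrightarrow> (\<exists>c\<in>atlas M. \<exists>d\<in>atlas N. k = prod_chart c d)"
  unfolding prod_manifold_def manifold.simps mem_Collect_eq by blast

lemma charts_at_prod:
  "k \<in> charts_at (prod_manifold M N) (p, q) \<longleftrightarrow> (\<exists>c\<in>charts_at M p. \<exists>d\<in>charts_at N q. k
      = prod_chart c d)"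
proof
  assume "k \<in> charts_at (prod_manifold M N) (p, q)"
  then obtain c d where "c \<in> atlas M" "d \<in> atlas N" "k = prod_chart c d" "(p, q) \<in> chart_dom k"
    unfolding charts_at_iff atlas_prod by blast
  then show "\<exists>c\<in>charts_at M p. \<exists>d\<in>charts_at N q. k = prod_chart c d"
    by (intro bexI[of _ c] bexI[of _ d]) (simp_all add: charts_at_iff)
next
  assume "\<exists>c\<in>charts_at M p. \<exists>d\<in>charts_at N q. k = prod_chart c d"
  then obtain c d where "c \<in> charts_at M p" "d \<in> charts_at N q" and k: "k = prod_chart c d" by blast
  then have cd: "c \<in> atlas M" "p \<in> chart_dom c" "d \<in> atlas N" "q \<in> chart_dom d"
      by (auto simp: charts_at_iff)
  then show "k \<in> charts_at (prod_manifold M N) (p, q)" unfolding charts_at_iff atlas_prod using k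
      by auto
qed

lemma prod_chart_image: "snd (prod_chart c d) ` chart_dom (prod_chart c d)
    = snd c ` chart_dom c \<times> snd d ` chart_dom d"
  by auto

lemma chart_inv_prod:
  assumes M: "smooth_atlas M" and N: "smooth_atlas N" and c: "c \<in> atlas M" and d: "d \<in> atlas N"
    and x: "x \<in> snd c ` chart_dom c" and y: "y \<in> snd d ` chart_dom d"
  shows "chart_inv (prod_chart c d) (x, y) = (chart_inv c x, chart_inv d y)"
proof (rule inv_into_f_eq)
  show "inj_on (snd (prod_chart c d)) (chart_dom (prod_chart c d))"
    using map_prod_inj_on[OF chart_inj[OF M c] chart_inj[OF N d]] by simp
qed (use chart_inv_in[OF x] chart_inv_in[OF y] chart_chart_inv[OF x] chart_chart_inv[OF y] in auto)

lemma homeomorphic_map_map_prod: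
  assumes "homeomorphic_map X X' f" "homeomorphic_map Y Y' g"
  shows "homeomorphic_map (prod_topology X Y) (prod_topology X' Y') (map_prod f g)"
proof -
  obtain f' g' where f': "homeomorphic_maps X X' f f'" and g': "homeomorphic_maps Y Y' g g'"
    using assms unfolding homeomorphic_map_maps by blast
  have c: "continuous_map (prod_topology A B) (prod_topology A' B') (map_prod h k)"
    if "continuous_map A A' h" "continuous_map B B' k" for A :: "'x topology"
        and A' :: "'y topology"
      and B :: "'z topology" and B' :: "'w topology" and h k
  proof -
    have "continuous_map (prod_topology A B) (prod_topology A' B') (\<lambda>z. (h (fst z), k (snd z)))"
      using continuous_map_compose[OF continuous_map_fst that(1)]
          continuous_map_compose[OF continuous_map_snd that(2)]
      by (intro continuous_map_pairedI) (simp_all add: o_def)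
    then show ?thesis by (simp add: map_prod_def case_prod_unfold)
  qed
  have "homeomorphic_maps (prod_topology X Y) (prod_topology X' Y') (map_prod f g) (map_prod f' g')"
    using f' g' unfolding homeomorphic_maps_def by (auto intro!: c)
  then show ?thesis unfolding homeomorphic_map_maps by blast
qed

lemma smooth_on_map_prod:
  fixes f :: "'a::real_normed_vector \<Rightarrow> 'c::real_normed_vector"
      and g :: "'b::real_normed_vector \<Rightarrow> 'd::real_normed_vector"
    and u :: "nat \<Rightarrow> 'a \<Rightarrow> real" and w :: "nat \<Rightarrow> 'b \<Rightarrow> real"
  assumes c: "coordinates n b u" and d: "coordinates m e w"
    and S: "open S" "open T" and f: "smooth_on S f" and g: "smooth_on T g"
  shows "smooth_on (S \<times> T) (map_prod f g)"
proof -
  have o: "open (S \<times> T)" using S by (rule open_Times)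
  have "smooth_on (S \<times> T) (\<lambda>z. (f (fst z), g (snd z)))"
    by (rule smooth_on_Pair[OF o smooth_on_compose[OF c o S(1) _ smooth_on_fst[OF o smooth_on_ident]
        f]
          smooth_on_compose[OF d o S(2) _ smooth_on_snd[OF o smooth_on_ident] g]]) auto
  then show ?thesis by (simp add: map_prod_def case_prod_unfold)
qed

text \<open>Serves the multiplication of a Lie group, actions and the cylinder. The transition maps
  of product charts are products of transition maps.\<close>

lemma smooth_atlas_prod:
  fixes M :: "('a, 'e::real_normed_vector) manifold" and N :: "('b, 'f::real_normed_vector)
      manifold"
  assumes M: "smooth_atlas M" and N: "smooth_atlas N"
  shows "smooth_atlas (prod_manifold M N)"
  unfolding smooth_atlas_def
proof (intro conjI ballI)
  obtain n b and u :: "nat \<Rightarrow> 'e \<Rightarrow> real" where cM: "coordinates n b u"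
      using smooth_atlas_coordinates[OF M] by blast
  obtain m d and w :: "nat \<Rightarrow> 'f \<Rightarrow> real" where cN: "coordinates m d w"
      using smooth_atlas_coordinates[OF N] by blast
  show "\<exists>n b (u :: nat \<Rightarrow> 'e \<times> 'f \<Rightarrow> real). coordinates n b u" using coordinates_prod[OF cM cN]
      by blast
  have e: "(\<Union>c\<in>atlas M. chart_dom c) = points M" "(\<Union>c\<in>atlas N. chart_dom c) = points N"
    using M N unfolding smooth_atlas_def by blast+
  show "(\<Union>c\<in>atlas (prod_manifold M N). chart_dom c) = points (prod_manifold M N)"
  proof (rule Set.set_eqI)
    fix z
    show "z \<in> (\<Union>c\<in>atlas (prod_manifold M N). chart_dom c) \<longleftrightarrow> z \<in> points (prod_manifold M N)"
      unfolding points_prod e[symmetric] by (auto simp: prod_manifold_def) blast+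
  qed
  fix k assume "k \<in> atlas (prod_manifold M N)"
  then obtain c c' where c: "c \<in> atlas M" "c' \<in> atlas N" and k: "k = prod_chart c c'"
      unfolding atlas_prod by blast
  show "openin (mtop (prod_manifold M N)) (chart_dom k)"
    using chart_openin[OF M c(1)] chart_openin[OF N c(2)] unfolding k
        by (simp add: prod_manifold_def openin_prod_Times_iff)
  show "open (snd k ` chart_dom k)"
    unfolding k prod_chart_image using chart_open[OF M c(1)] chart_open[OF N c(2)]
        by (rule open_Times)
  show "homeomorphic_map (subtopology (mtop (prod_manifold M N)) (chart_dom k))
      (top_of_set (snd k ` chart_dom k)) (snd k)"
    unfolding k prod_chart_image using homeomorphic_map_map_prod[OF chart_homeo[OF M c(1)]
        chart_homeo[OF N c(2)]]
    by (simp add: prod_manifold_def subtopology_Times flip: euclidean_product_topology)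
  fix k' assume "k' \<in> atlas (prod_manifold M N)"
  then obtain d d' where d: "d \<in> atlas M" "d' \<in> atlas N" and k': "k' = prod_chart d d'"
      unfolding atlas_prod by blast
  have D: "snd k ` (chart_dom k \<inter> chart_dom k') = rep_dom c d (\<lambda>x. x) \<times> rep_dom c' d' (\<lambda>x. x)"
    unfolding k k' by auto
  note o = rep_dom_open[OF M M smooth_map_ident[OF M] c(1) d(1)]
      rep_dom_open[OF N N smooth_map_ident[OF N] c(2) d(2)]
  show "smooth_on (snd k ` (chart_dom k \<inter> chart_dom k')) (transition k k')"
    unfolding D
  proof (rule smooth_on_cong[OF open_Times[OF o]])
    show "smooth_on (rep_dom c d (\<lambda>x. x) \<times> rep_dom c' d' (\<lambda>x. x)) (map_prod (local_rep c d (\<lambda>x. x))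
        (local_rep c' d' (\<lambda>x. x)))"
      by (rule smooth_on_map_prod[OF cM cN o local_rep_smooth[OF smooth_map_ident[OF M] c(1) d(1)]
            local_rep_smooth[OF smooth_map_ident[OF N] c(2) d(2)]])
    fix z assume "z \<in> rep_dom c d (\<lambda>x. x) \<times> rep_dom c' d' (\<lambda>x. x)"
    then obtain x y where z: "z = (x, y)" and xy: "x \<in> rep_dom c d (\<lambda>x. x)"
        "y \<in> rep_dom c' d' (\<lambda>x. x)" by blast
    show "map_prod (local_rep c d (\<lambda>x. x)) (local_rep c' d' (\<lambda>x. x)) z = transition k k' z"
      using chart_inv_prod[OF M N c rep_dom_inv(4)[OF M c(1) xy(1)] rep_dom_inv(4)[OF N c(2) xy(2)]]
      unfolding z transition_def k k' by simp
  qed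
qed

section \<open>Maps into and out of products\<close>

lemma smooth_map_pair:
  assumes Q: "smooth_atlas Q" and M: "smooth_atlas M" and N: "smooth_atlas N"
    and f: "smooth_map Q M f" and g: "smooth_map Q N g"
  shows "smooth_map Q (prod_manifold M N) (\<lambda>q. (f q, g q))"
proof (rule smooth_mapI_local[OF Q smooth_atlas_prod[OF M N]])
  fix p assume p: "p \<in> points Q"
  obtain k c d where k: "k \<in> charts_at Q p" and c: "c \<in> charts_at M (f p)"
      and d: "d \<in> charts_at N (g p)"
    using chart_at_in[OF Q p] chart_at_in[OF M smooth_map_points[OF f p]]
        chart_at_in[OF N smooth_map_points[OF g p]] by blast
  then have a: "k \<in> atlas Q" "c \<in> atlas M" "d \<in> atlas N" by (auto simp: charts_at_iff)
  let ?S = "rep_dom k c f \<inter> rep_dom k d g"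
  have o: "open ?S" using rep_dom_open[OF Q M f a(1,2)] rep_dom_open[OF Q N g a(1,3)] by blast
  have "smooth_on ?S (\<lambda>x. (local_rep k c f x, local_rep k d g x))"
    by (rule smooth_on_Pair[OF o smooth_on_subset[OF local_rep_smooth[OF f a(1,2)]]
        smooth_on_subset[OF local_rep_smooth[OF g a(1,3)]]]) auto
  then have "smooth_on ?S (local_rep k (prod_chart c d) (\<lambda>q. (f q, g q)))" by simp
  moreover have "snd k p \<in> ?S" using in_rep_dom[where f = f, OF k c] in_rep_dom[where f = g, OF k d]
      by simp
  moreover have "\<forall>x\<in>?S. (f (chart_inv k x), g (chart_inv k x)) \<in> chart_dom (prod_chart c d)"
  proof
    fix x assume "x \<in> ?S"
    then have "x \<in> rep_dom k c f" "x \<in> rep_dom k d g" by auto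
    from rep_dom_inv(2)[OF Q a(1) this(1)] rep_dom_inv(2)[OF Q a(1) this(2)]
    show "(f (chart_inv k x), g (chart_inv k x)) \<in> chart_dom (prod_chart c d)" by simp
  qed
  moreover have "?S \<subseteq> snd k ` chart_dom k" by auto
  moreover have "prod_chart c d \<in> charts_at (prod_manifold M N) (f p, g p)" unfolding charts_at_prod
      using c d by blast
  ultimately show "\<exists>c\<in>charts_at Q p. \<exists>c'\<in>charts_at (prod_manifold M N) (f p, g p). \<exists>S. open S
      \<and> snd c p \<in> S \<and>
      S \<subseteq> snd c ` chart_dom c \<and> (\<forall>x\<in>S. (f (chart_inv c x), g (chart_inv c x)) \<in> chart_dom c') \<and>
      smooth_on S (local_rep c c' (\<lambda>q. (f q, g q)))"
    using k o by blast
qed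

lemma smooth_map_const:
  assumes M: "smooth_atlas M" and N: "smooth_atlas N" and q: "q \<in> points N"
  shows "smooth_map M N (\<lambda>p. q)"
proof (rule smooth_mapI_local[OF M N])
  fix p assume p: "p \<in> points M"
  obtain c d where c: "c \<in> charts_at M p" and d: "d \<in> charts_at N q"
      using chart_at_in[OF M p] chart_at_in[OF N q] by blast
  then have "open (snd c ` chart_dom c)" "snd c p \<in> snd c ` chart_dom c" "q \<in> chart_dom d"
    using chart_open[OF M] by (auto simp: charts_at_iff)
  then show "\<exists>c\<in>charts_at M p. \<exists>c'\<in>charts_at N q. \<exists>S. open S \<and> snd c p \<in> S \<and>
      S \<subseteq> snd c ` chart_dom c \<and> (\<forall>x\<in>S. q \<in> chart_dom c') \<and> smooth_on S (\<lambda>x. snd c' q)"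
    using c d by (intro bexI[of _ c] bexI[of _ d] exI[of _
        "snd c ` chart_dom c"]) (auto simp: smooth_on_const)
qed

lemma smooth_map_fst:
  assumes M: "smooth_atlas M" and N: "smooth_atlas N"
  shows "smooth_map (prod_manifold M N) M fst"
proof (rule smooth_mapI_local[OF smooth_atlas_prod[OF M N] M])
  fix z assume "z \<in> points (prod_manifold M N)"
  then obtain p q where z: "z = (p, q)" "p \<in> points M" "q \<in> points N" by (auto simp: points_prod)
  obtain c d where c: "c \<in> charts_at M p" and d: "d \<in> charts_at N q"
      using chart_at_in[OF M z(2)] chart_at_in[OF N z(3)] by blast
  then have a: "c \<in> atlas M" "d \<in> atlas N" "p \<in> chart_dom c" "q \<in> chart_dom d"
      by (auto simp: charts_at_iff)
  let ?S = "snd c ` chart_dom c \<times> snd d ` chart_dom d"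
  have o: "open ?S" by (rule open_Times[OF chart_open[OF M a(1)] chart_open[OF N a(2)]])
  have i: "chart_inv (prod_chart c d) x = (chart_inv c (fst x), chart_inv d (snd x))" if "x \<in> ?S"
      for x
    using that chart_inv_prod[OF M N a(1,2), of "fst x" "snd x"] by auto
  have "smooth_on ?S (local_rep (prod_chart c d) c fst)"
    by (rule smooth_on_cong[OF o _ smooth_on_fst[OF o smooth_on_ident]])
        (subst i, assumption, auto simp: chart_inv_chart[OF M a(1)])
  moreover have "snd (prod_chart c d) z \<in> ?S" using z a by auto
  moreover have "\<forall>x\<in>?S. fst (chart_inv (prod_chart c d) x) \<in> chart_dom c"
      by (intro ballI, subst i, assumption, auto simp: chart_inv_chart[OF M a(1)])
  moreover have "prod_chart c d \<in> charts_at (prod_manifold M N) z" unfolding z(1) charts_at_prod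
      using c d by blast
  ultimately show "\<exists>k\<in>charts_at (prod_manifold M N) z. \<exists>c'\<in>charts_at M (fst z). \<exists>S. open S \<and> snd k z
      \<in> S \<and>
      S \<subseteq> snd k ` chart_dom k \<and> (\<forall>x\<in>S. fst (chart_inv k x) \<in> chart_dom c')
          \<and> smooth_on S (local_rep k c' fst)"
    using o c z(1) prod_chart_image[of c d] by (intro bexI[of _ "prod_chart c d"] bexI[of _ c]
        exI[of _ ?S]) auto
qed

lemma smooth_map_snd:
  assumes M: "smooth_atlas M" and N: "smooth_atlas N"
  shows "smooth_map (prod_manifold M N) N snd"
proof (rule smooth_mapI_local[OF smooth_atlas_prod[OF M N] N])
  fix z assume "z \<in> points (prod_manifold M N)"
  then obtain p q where z: "z = (p, q)" "p \<in> points M" "q \<in> points N" by (auto simp: points_prod)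
  obtain c d where c: "c \<in> charts_at M p" and d: "d \<in> charts_at N q"
      using chart_at_in[OF M z(2)] chart_at_in[OF N z(3)] by blast
  then have a: "c \<in> atlas M" "d \<in> atlas N" "p \<in> chart_dom c" "q \<in> chart_dom d"
      by (auto simp: charts_at_iff)
  let ?S = "snd c ` chart_dom c \<times> snd d ` chart_dom d"
  have o: "open ?S" by (rule open_Times[OF chart_open[OF M a(1)] chart_open[OF N a(2)]])
  have i: "chart_inv (prod_chart c d) x = (chart_inv c (fst x), chart_inv d (snd x))" if "x \<in> ?S"
      for x
    using that chart_inv_prod[OF M N a(1,2), of "fst x" "snd x"] by auto
  have "smooth_on ?S (local_rep (prod_chart c d) d snd)"
    by (rule smooth_on_cong[OF o _ smooth_on_snd[OF o smooth_on_ident]])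
        (subst i, assumption, auto simp: chart_inv_chart[OF N a(2)])
  moreover have "snd (prod_chart c d) z \<in> ?S" using z a by auto
  moreover have "\<forall>x\<in>?S. snd (chart_inv (prod_chart c d) x) \<in> chart_dom d"
      by (intro ballI, subst i, assumption, auto simp: chart_inv_chart[OF N a(2)])
  moreover have "prod_chart c d \<in> charts_at (prod_manifold M N) z" unfolding z(1) charts_at_prod
      using c d by blast
  ultimately show "\<exists>k\<in>charts_at (prod_manifold M N) z. \<exists>c'\<in>charts_at N (snd z). \<exists>S. open S \<and> snd k z
      \<in> S \<and>
      S \<subseteq> snd k ` chart_dom k \<and> (\<forall>x\<in>S. snd (chart_inv k x) \<in> chart_dom c')
          \<and> smooth_on S (local_rep k c' snd)"
    using o d z(1) prod_chart_image[of c d] by (intro bexI[of _ "prod_chart c d"] bexI[of _ d]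
        exI[of _ ?S]) auto
qed

section \<open>The real line as a manifold\<close>

lemma points_real_line: "points real_line = UNIV"
  by (simp add: real_line_def)

lemma charts_at_real_line: "charts_at real_line t = {(UNIV, id)}"
  by (auto simp: charts_at_iff real_line_def)

lemma smooth_atlas_real_line: "smooth_atlas real_line"
  unfolding smooth_atlas_def
proof (intro conjI ballI)
  have "coordinates 1 (\<lambda>_. 1) (\<lambda>_ x :: real. x)" by (auto simp: coordinates_def
      bounded_linear_ident)
  then show "\<exists>n b (u :: nat \<Rightarrow> real \<Rightarrow> real). coordinates n b u" by blast
  fix c c' :: "(real, real) chart" assume "c \<in> atlas real_line" and "c' \<in> atlas real_line"
  then have "c = (UNIV, id)" "c' = (UNIV, id)" by (auto simp: real_line_def)
  moreover have "transition (UNIV, id) (UNIV, id) = (\<lambda>x::real. x)"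
    by (simp add: transition_def inv_id)
  ultimately show "smooth_on (snd c ` (chart_dom c \<inter> chart_dom c')) (transition c c')"
    by (simp add: smooth_on_ident)
qed (auto simp: real_line_def)


section \<open>Integration over the interval\<close>

abbreviation cyl :: "('a, 'e::real_normed_vector) manifold \<Rightarrow> ('a \<times> real, 'e \<times> real) manifold" where
  "cyl M \<equiv> prod_manifold M real_line"

abbreviation cyl_chart :: "('a, 'e) chart \<Rightarrow> ('a \<times> real, 'e \<times> real) chart" where
  "cyl_chart c \<equiv> (chart_dom c \<times> UNIV, map_prod (snd c) id)"

text \<open>The vector field d/dt on the cylinder. The same coordinate vector can be used in every
  chart because the transition maps of the cylinder leave the last coordinate alone.\<close>

definition time_field :: "('a, 'e::real_normed_vector) manifold \<Rightarrow> 'a \<times> real \<Rightarrow> ('a \<times> real, 'e \<times> real)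
    tangent" where
  "time_field M z = (\<lambda>k. if k \<in> charts_at (cyl M) z then (0, 1) else 0)"

text \<open>Contraction with d/dt followed by integration over \<open>[0, 1]\<close> along the
  fibres of the cylinder. The vectors of \<open>M\<close> are moved to height \<open>t\<close> by
  the inclusion of the slice. That d/dt comes first determines the signs below.\<close>

definition fiber_integral :: "('a, 'e::real_normed_vector) manifold \<Rightarrow> ('a \<times> real, 'e \<times> real)
    form \<Rightarrow> ('a, 'e) form" where
  "fiber_integral M \<theta> = (\<lambda>p vs. if p \<in> points M \<and> set vs \<subseteq> tangent_space M p
     then integral {0..1} (\<lambda>t. \<theta> (p, t) (time_field M (p, t) # map (differential M (cyl M)
         (\<lambda>p. (p, t)) p) vs))
     else 0)"

section \<open>Charts, maps and tangent vectors of the cylinder\<close>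

lemma smooth_atlas_cyl: "smooth_atlas M \<Longrightarrow> smooth_atlas (cyl M)"
  by (rule smooth_atlas_prod[OF _ smooth_atlas_real_line])

lemma charts_at_cyl: "k \<in> charts_at (cyl M) (p, t) \<longleftrightarrow> (\<exists>c\<in>charts_at M p. k = cyl_chart c)"
  unfolding charts_at_prod charts_at_real_line by simp

lemma chart_inv_cyl:
  assumes "smooth_atlas M" "c \<in> atlas M" "x \<in> snd c ` chart_dom c"
  shows "chart_inv (cyl_chart c) (x, t) = (chart_inv c x, t)"
proof -
  have "(UNIV, id) \<in> atlas real_line" "t \<in> snd (UNIV, id) ` chart_dom (UNIV, id)"
      by (auto simp: real_line_def)
  from chart_inv_prod[OF assms(1) smooth_atlas_real_line assms(2) this(1) assms(3) this(2)]
  show ?thesis by (simp only: fst_conv snd_conv inv_id id_apply)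
qed

lemma smooth_map_slice:
  assumes "smooth_atlas M"
  shows "smooth_map M (cyl M) (\<lambda>p. (p, t))"
  by (rule smooth_map_pair[OF assms assms smooth_atlas_real_line smooth_map_ident[OF assms]
        smooth_map_const[OF assms smooth_atlas_real_line]]) (simp add: points_real_line)

lemma smooth_map_cyl:
  assumes M: "smooth_atlas M" and k: "smooth_map M M k"
  shows "smooth_map (cyl M) (cyl M) (\<lambda>z. (k (fst z), snd z))"
proof -
  note P = smooth_atlas_cyl[OF M]
  show ?thesis
    by (rule smooth_map_pair[OF P M smooth_atlas_real_line
          smooth_map_compose[OF P M M smooth_map_fst[OF M smooth_atlas_real_line] k]
              smooth_map_snd[OF M smooth_atlas_real_line]])
qed

text \<open>With the identity for \<open>k\<close> this concerns the transition maps of the cylinder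
  and makes \<open>time_field\<close> a tangent vector; with a translation by a group element it
  yields the invariance of d/dt.\<close>

lemma fderiv_local_rep_cyl:
  assumes M: "smooth_atlas M" and k: "smooth_map M M k" and c: "c \<in> charts_at M p"
      "c' \<in> charts_at M (k p)"
  shows "fderiv (local_rep (cyl_chart c) (cyl_chart c') (\<lambda>z. (k (fst z), snd z))) (snd (cyl_chart c)
      (p, t)) (v, r)
     = (fderiv (local_rep c c' k) (snd c p) v, r)"
proof -
  have a: "c \<in> atlas M" "c' \<in> atlas M" using c by (auto simp: charts_at_iff)
  let ?x = "snd c p"
  have x: "?x \<in> rep_dom c c' k" by (rule in_rep_dom[where f = k, OF c])
  have o: "open (rep_dom c c' k)" by (rule rep_dom_open[OF M M k a])
  have "((\<lambda>z. local_rep c c' k (fst z)) has_derivative (\<lambda>w. fderiv (local_rep c c' k) ?x (fst w)))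
      (at (?x, t))"
    using diff_chain_at[OF has_derivative_fst[OF has_derivative_ident] fderiv_has[of
        "local_rep c c' k"], of "(?x, t)"]
      local_rep_differentiable[OF k c]
    by (simp add: o_def)
  then have d: "((\<lambda>z. (local_rep c c' k (fst z), snd z)) has_derivative (\<lambda>w. (fderiv (local_rep c c'
      k) ?x (fst w), snd w))) (at (?x, t))"
    by (intro has_derivative_Pair has_derivative_snd has_derivative_ident)
  have "fderiv (local_rep (cyl_chart c) (cyl_chart c') (\<lambda>z. (k (fst z), snd z))) (?x, t)
      = fderiv (\<lambda>z. (local_rep c c' k (fst z), snd z)) (?x, t)"
  proof (rule fderiv_cong_open[OF open_Times[OF o open_UNIV]])
    fix z assume "z \<in> rep_dom c c' k \<times> (UNIV :: real set)"
    then obtain y s where z: "z = (y, s)" "y \<in> rep_dom c c' k" by blast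
    show "local_rep (cyl_chart c) (cyl_chart c') (\<lambda>z. (k (fst z), snd z)) z
        = (local_rep c c' k (fst z), snd z)"
      using chart_inv_cyl[OF M a(1) rep_dom_inv(4)[OF M a(1) z(2)], of s] unfolding z(1) by simp
  qed (use x in auto)
  then show ?thesis unfolding fderiv_eq[OF d] by simp
qed

lemma time_field_apply: "c \<in> charts_at M p \<Longrightarrow> time_field M (p, t) (cyl_chart c) = (0, 1)"
  unfolding time_field_def charts_at_cyl by auto

lemma time_field_tangent:
  assumes M: "smooth_atlas M"
  shows "time_field M (p, t) \<in> tangent_space (cyl M) (p, t)"
proof (rule tangent_spaceI)
  fix k k' assume k: "k \<in> charts_at (cyl M) (p, t)" and k': "k' \<in> charts_at (cyl M) (p, t)"
  then obtain c c' where c: "c \<in> charts_at M p" "c' \<in> charts_at M p" "k = cyl_chart c"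
      "k' = cyl_chart c'"
    unfolding charts_at_cyl by blast
  have z: "fderiv (local_rep c c' (\<lambda>x. x)) (snd c p) 0 = 0"
    by (rule linear_0[OF linear_fderiv[OF local_rep_differentiable[OF smooth_map_ident[OF M]
        c(1,2)]]])
  show "time_field M (p, t) k' = fderiv (local_rep k k' (\<lambda>x. x)) (snd k (p, t)) (time_field M (p, t)
      k)"
    using fderiv_local_rep_cyl[OF M smooth_map_ident[OF M] c(1,2), of t 0 1]
    by (simp add: time_field_apply c z del: snd_conv fst_conv snd_map_prod)
qed (simp add: time_field_def)

text \<open>The invariance of d/dt; \<open>k\<close> will be the action of a group element.\<close>

lemma differential_cyl_time_field:
  assumes M: "smooth_atlas M" and k: "smooth_map M M k" and p: "p \<in> points M"
  shows "differential (cyl M) (cyl M) (\<lambda>z. (k (fst z), snd z)) (p, t) (time_field M (p, t))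
      = time_field M (k p, t)"
proof -
  note P = smooth_atlas_cyl[OF M] and K = smooth_map_cyl[OF M k]
  obtain c c' where c: "c \<in> charts_at M p" "c' \<in> charts_at M (k p)"
    using chart_at_in[OF M p] chart_at_in[OF M smooth_map_points[OF k p]] by blast
  have kk: "cyl_chart c \<in> charts_at (cyl M) (p, t)" "cyl_chart c' \<in> charts_at (cyl M) (k p, t)"
    using c unfolding charts_at_cyl by blast+
  have pt: "(p, t) \<in> points (cyl M)" using p by (simp add: points_prod points_real_line)
  have z: "fderiv (local_rep c c' k) (snd c p) 0 = 0"
    by (rule linear_0[OF linear_fderiv[OF local_rep_differentiable[OF k c]]])
  have e: "differential (cyl M) (cyl M) (\<lambda>z. (k (fst z), snd z)) (p, t) (time_field M (p, t))
      (cyl_chart c') = (0, 1)"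
    using differential_apply[OF P K time_field_tangent[OF M] kk(1)] kk(2)
      fderiv_local_rep_cyl[OF M k c, of t 0 1] time_field_apply[OF c(1)] z by simp
  show ?thesis
    by (rule tangent_eqI[OF _ time_field_tangent[OF M] kk(2)])
      (use differential_tangent[OF P P K pt] e time_field_apply[OF c(2)] in auto)
qed

lemma differential_slice_apply:
  assumes M: "smooth_atlas M" and v: "v \<in> tangent_space M p" and c: "c \<in> charts_at M p"
  shows "differential M (cyl M) (\<lambda>p. (p, t)) p v (cyl_chart c) = (v c, 0)"
proof -
  have a: "c \<in> atlas M" "p \<in> chart_dom c" using c by (auto simp: charts_at_iff)
  have k: "cyl_chart c \<in> charts_at (cyl M) (p, t)" using c unfolding charts_at_cyl by blast
  have d: "((\<lambda>x. (x, t)) has_derivative (\<lambda>w. (w, 0))) (at (snd c p))"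
    by (intro has_derivative_Pair has_derivative_ident has_derivative_const)
  have "fderiv (local_rep c (cyl_chart c) (\<lambda>p. (p, t))) (snd c p) = fderiv (\<lambda>x. (x, t)) (snd c p)"
    by (rule fderiv_cong_open[OF chart_open[OF M a(1)]]) (use a chart_inv_chart[OF M a(1)] in auto)
  then show ?thesis
    using differential_apply[OF M smooth_map_slice[OF M] v c k] fderiv_eq[OF d] by simp
qed

lemma slice_vectors_tangent:
  assumes M: "smooth_atlas M" and p: "p \<in> points M"
  shows "set (map (differential M (cyl M) (\<lambda>p. (p, t)) p) vs) \<subseteq> tangent_space (cyl M) (p, t)"
  using differential_tangent[OF M smooth_atlas_cyl[OF M] smooth_map_slice[OF M] p] by auto

text \<open>In a chart the integrand becomes a local form with constant arguments, evaluated at a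
  point that depends on \<open>t\<close>. This is a smooth function of position and time, the kind
  of integrand that differentiation under the integral requires.\<close>

lemma fiber_integrand_eq:
  assumes M: "smooth_atlas M" and c: "c \<in> charts_at M p" and vs: "set vs \<subseteq> tangent_space M p"
  shows "\<theta> (p, t) (time_field M (p, t) # map (differential M (cyl M) (\<lambda>p. (p, t)) p) vs) =
    local_form (cyl M) (cyl_chart c) \<theta> (snd c p, t) ((0, 1) # map (\<lambda>\<xi>. (\<xi>, 0)) (map (\<lambda>v. v c) vs))"
proof -
  have k: "cyl_chart c \<in> charts_at (cyl M) (p, t)" using c unfolding charts_at_cyl by blast
  have p: "p \<in> points M" by (rule charts_at_points[OF M c])
  have "\<theta> (p, t) (time_field M (p, t) # map (differential M (cyl M) (\<lambda>p. (p, t)) p) vs) =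
    local_form (cyl M) (cyl_chart c) \<theta> (snd (cyl_chart c) (p, t))
      (map (\<lambda>v. v (cyl_chart c)) (time_field M (p, t) # map (differential M (cyl M) (\<lambda>p. (p, t)) p)
          vs))"
    by (rule form_eval[OF smooth_atlas_cyl[OF M] k])
      (use time_field_tangent[OF M] slice_vectors_tangent[OF M p] in auto)
  also have "map (\<lambda>v. v (cyl_chart c)) (time_field M (p, t) # map (differential M (cyl M)
      (\<lambda>p. (p, t)) p) vs)
     = (0, 1) # map (\<lambda>\<xi>. (\<xi>, 0)) (map (\<lambda>v. v c) vs)"
    using vs differential_slice_apply[OF M _ c] by (auto simp: time_field_apply[OF c])
  moreover have "snd (cyl_chart c) (p, t) = (snd c p, t)" by simp
  ultimately show ?thesis by metis
qed

lemma local_form_cyl_smooth: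
  assumes M: "smooth_atlas M" and th: "\<theta> \<in> all_forms (cyl M)" and c: "c \<in> atlas M"
  shows "smooth_on (snd c ` chart_dom c \<times> UNIV) (\<lambda>z. local_form (cyl M) (cyl_chart c) \<theta> z \<xi>s)"
proof -
  have k: "cyl_chart c \<in> atlas (cyl M)" unfolding atlas_prod using c
      by (intro bexI[of _ c] bexI[of _ "(UNIV, id)"]) (auto simp: real_line_def)
  have "snd (cyl_chart c) ` chart_dom (cyl_chart c) = snd c ` chart_dom c \<times> UNIV"
    using prod_chart_image[of c "(UNIV, id)"] by simp
  with all_formsD(4)[OF th k, of \<xi>s] show ?thesis by simp
qed

lemma fiber_integrand_continuous:
  assumes M: "smooth_atlas M" and th: "\<theta> \<in> all_forms (cyl M)" and p: "p \<in> points M"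
      and vs: "set vs \<subseteq> tangent_space M p"
  shows "continuous_on T (\<lambda>t. \<theta> (p, t) (time_field M (p, t) # map (differential M (cyl M)
      (\<lambda>p. (p, t)) p) vs))"
proof -
  obtain c where c: "c \<in> charts_at M p" using chart_at_in[OF M p] by blast
  then have "c \<in> atlas M" "snd c p \<in> snd c ` chart_dom c" by (auto simp: charts_at_iff)
  then show ?thesis
    unfolding fiber_integrand_eq[OF M c vs] using continuous_on_slice[OF local_form_cyl_smooth[OF M
        th]] by blast
qed

lemma fiber_integrand_integrable:
  assumes M: "smooth_atlas M" and th: "\<theta> \<in> all_forms (cyl M)" and p: "p \<in> points M"
      and vs: "set vs \<subseteq> tangent_space M p"
  shows "(\<lambda>t. \<theta> (p, t) (time_field M (p, t) # map (differential M (cyl M) (\<lambda>p. (p, t)) p) vs))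
      integrable_on {0..1}"
  by (rule integrable_continuous_real[OF fiber_integrand_continuous[OF assms]])

lemma fiber_integral_eq:
  assumes M: "smooth_atlas M" and c: "c \<in> charts_at M p" and vs: "set vs \<subseteq> tangent_space M p"
  shows "fiber_integral M \<theta> p vs = integral {0..1} (\<lambda>t. local_form (cyl M) (cyl_chart c)
      \<theta> (snd c p, t)
      ((0, 1) # map (\<lambda>\<xi>. (\<xi>, 0)) (map (\<lambda>v. v c) vs)))"
  unfolding fiber_integrand_eq[OF M c vs, symmetric] using charts_at_points[OF M c] vs
      by (simp add: fiber_integral_def)

lemma local_form_fiber_integral:
  assumes M: "smooth_atlas M" and c: "c \<in> atlas M" and x: "x \<in> snd c ` chart_dom c"
  shows "local_form M c (fiber_integral M \<theta>) x \<xi>s = integral {0..1} (\<lambda>t. local_form (cyl M)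
      (cyl_chart c) \<theta> (x, t)
      ((0, 1) # map (\<lambda>\<xi>. (\<xi>, 0)) \<xi>s))"
proof -
  note p = charts_at_chart_inv[where M = M, OF c x]
  have "set (map (coord_vec M c (chart_inv c x)) \<xi>s) \<subseteq> tangent_space M (chart_inv c x)"
    using coord_vec_tangent[OF M p] by auto
  from fiber_integral_eq[OF M p this, of \<theta>] show ?thesis
    unfolding local_form_def[of M] by (simp add: chart_chart_inv[OF x] coord_vec_apply[OF M p]
        o_def)
qed

text \<open>The algebraic conditions pass from the integrand to the integral for each
  \<open>t\<close> separately; smoothness is \<open>smooth_on_integral_param\<close> in a
  chart.\<close>

lemma fiber_integral_all_forms:
  fixes M :: "('a, 'e::real_normed_vector) manifold"
  assumes M: "smooth_atlas M" and th: "\<theta> \<in> all_forms (cyl M)"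
  shows "fiber_integral M \<theta> \<in> all_forms M"
proof (rule all_formsI)
  show "fiber_integral M \<theta> p vs = 0" if "p \<notin> points M \<or> \<not> set vs \<subseteq> tangent_space M p" for p vs
    using that by (auto simp: fiber_integral_def)
  show "fiber_integral M \<theta> p (us @ lincomb a v b w # vs) =
      a * fiber_integral M \<theta> p (us @ v # vs) + b * fiber_integral M \<theta> p (us @ w # vs)"
    if p: "p \<in> points M" and us: "set us \<subseteq> tangent_space M p" "set vs \<subseteq> tangent_space M p"
      "v \<in> tangent_space M p" "w \<in> tangent_space M p" for p us vs v w a b
  proof -
    let ?d = "\<lambda>t. differential M (cyl M) (\<lambda>p. (p, t)) p"
    have "\<theta> (p, t) ((time_field M (p, t) # map (?d t) us) @ lincomb a (?d t v) b (?d t w)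
        # map (?d t) vs) =
       a * \<theta> (p, t) ((time_field M (p, t) # map (?d t) us) @ ?d t v # map (?d t) vs) +
       b * \<theta> (p, t) ((time_field M (p, t) # map (?d t) us) @ ?d t w # map (?d t) vs)" for t
      by (rule all_formsD(2)[OF th])
        (use p time_field_tangent[OF M] slice_vectors_tangent[OF M p]
            differential_tangent[OF M smooth_atlas_cyl[OF M] smooth_map_slice[OF M] p]
          in \<open>auto simp: points_prod points_real_line\<close>)
    then have "fiber_integral M \<theta> p (us @ lincomb a v b w # vs) = integral {0..1} (\<lambda>t.
       a * \<theta> (p, t) (time_field M (p, t) # map (?d t) (us @ v # vs)) +
       b * \<theta> (p, t) (time_field M (p, t) # map (?d t) (us @ w # vs)))"
      using p us lincomb_tangent[OF M us(3,4)]
      by (simp add: fiber_integral_def differential_lincomb[OF M smooth_atlas_cyl[OF M]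
          smooth_map_slice[OF M] p])
    also have "\<dots> = a * integral {0..1} (\<lambda>t. \<theta> (p, t) (time_field M (p, t) # map (?d t)
        (us @ v # vs))) +
       b * integral {0..1} (\<lambda>t. \<theta> (p, t) (time_field M (p, t) # map (?d t) (us @ w # vs)))"
      by (subst Henstock_Kurzweil_Integration.integral_add)
        (use us in \<open>auto intro!: integrable_on_mult_right fiber_integrand_integrable[OF M th p]
            simp del: map_append\<close>)
    finally show ?thesis using p us by (simp add: fiber_integral_def)
  qed
  show "fiber_integral M \<theta> p vs = 0" if p: "p \<in> points M" and vs: "\<not> distinct vs" for p vs
  proof -
    have "\<theta> (p, t) (time_field M (p, t) # map (differential M (cyl M) (\<lambda>p. (p, t)) p) vs) = 0" for t
      by (rule all_formsD(3)[OF th]) (use p vs in \<open>auto simp: points_prod points_real_line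
          distinct_map\<close>)
    then show ?thesis by (simp add: fiber_integral_def)
  qed
  fix c \<xi>s assume c: "c \<in> atlas M"
  obtain n b and u :: "nat \<Rightarrow> 'e \<Rightarrow> real" where cM: "coordinates n b u"
      using smooth_atlas_coordinates[OF M] by blast
  show "smooth_on (snd c ` chart_dom c) (\<lambda>x. local_form M c (fiber_integral M \<theta>) x \<xi>s)"
    by (rule smooth_on_cong[OF chart_open[OF M c] _
          smooth_on_integral_param[OF cM chart_open[OF M c] local_form_cyl_smooth[OF M th c]]])
      (simp add: local_form_fiber_integral[OF M c])
qed

lemma omit_Cons: "omit 0 (x # xs) = xs" "omit (Suc i) (x # xs) = x # omit i xs"
  by (auto simp: omit_def)

text \<open>The exterior derivative on the cylinder, evaluated with d/dt in front, has one term that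
  differentiates in time and terms that differentiate along \<open>M\<close>. After integration the
  latter cancel the exterior derivative of the integral, and the former leaves the boundary
  values.\<close>

lemma homotopy_formula:
  fixes M :: "('a, 'e::real_normed_vector) manifold"
  assumes M: "smooth_atlas M" and th: "\<theta> \<in> all_forms (cyl M)"
  shows "ext_deriv M (fiber_integral M \<theta>) p vs + fiber_integral M (ext_deriv (cyl M) \<theta>) p vs =
    pullback M (cyl M) (\<lambda>p. (p, 1)) \<theta> p vs - pullback M (cyl M) (\<lambda>p. (p, 0)) \<theta> p vs"
proof (cases "p \<in> points M \<and> set vs \<subseteq> tangent_space M p")
  case True
  then have p: "p \<in> points M" and vs: "set vs \<subseteq> tangent_space M p" by auto
  note P = smooth_atlas_cyl[OF M]
  obtain c where c: "c \<in> charts_at M p" using chart_at_in[OF M p] by blast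
  then have ca: "c \<in> atlas M" and x: "snd c p \<in> snd c ` chart_dom c" by (auto simp: charts_at_iff)
  let ?U = "snd c ` chart_dom c" and ?k = "cyl_chart c" and ?x = "snd c p"
      and ?\<xi>s = "map (\<lambda>v. v c) vs"
  let ?\<Theta> = "local_form (cyl M) ?k \<theta>" and ?i = "\<lambda>\<xi>::'e. (\<xi>, 0::real)"
  have k: "?k \<in> charts_at (cyl M) (p, t)" for t using c unfolding charts_at_cyl by blast
  note U = chart_open[OF M ca]
  obtain n b and u :: "nat \<Rightarrow> 'e \<Rightarrow> real" where cM: "coordinates n b u"
      using smooth_atlas_coordinates[OF M] by blast
  note sm = local_form_cyl_smooth[OF M th ca]
  \<comment> \<open>\<open>A i\<close> is the derivative along \<open>M\<close> in the direction of
    the vector \<open>i\<close>, with d/dt kept as an argument; \<open>B\<close> below is the time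
    derivative, with d/dt used up as the direction.\<close>
  define A where "A = (\<lambda>i t. fderiv (\<lambda>z. ?\<Theta> z ((0, 1) # map ?i (omit i ?\<xi>s))) (?x, t)
      (?i (?\<xi>s ! i)))"
  define B where "B = (\<lambda>t. fderiv (\<lambda>z. ?\<Theta> z (map ?i ?\<xi>s)) (?x, t) (0, 1))"
  have contA: "continuous_on T (A i)" for i T
    unfolding A_def by (rule continuous_on_slice[OF smooth_on_fderiv[OF sm] x])
  have contB: "continuous_on T B" for T
    unfolding B_def by (rule continuous_on_slice[OF smooth_on_fderiv[OF sm] x])
  have "ext_deriv M (fiber_integral M \<theta>) p vs = lext (local_form M c (fiber_integral M \<theta>)) ?x ?\<xi>s"
    by (rule ext_deriv_eq_lext[OF M fiber_integral_all_forms[OF M th] c vs])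
  also have "\<dots> = lext (\<lambda>y \<xi>s. integral {0..1} (\<lambda>t. ?\<Theta> (y, t) ((0, 1) # map ?i \<xi>s))) ?x ?\<xi>s"
    by (rule lext_cong[OF U x]) (rule local_form_fiber_integral[OF M ca])
  also have "\<dots> = (\<Sum>i<length vs. (-1) ^ i * integral {0..1} (A i))"
    unfolding lext_def A_def using fderiv_eq[OF has_derivative_integral_param[OF cM U x sm]] by simp
  finally have 1: "ext_deriv M (fiber_integral M \<theta>) p vs
      = (\<Sum>i<length vs. (-1) ^ i * integral {0..1} (A i))" .
  have "ext_deriv (cyl M) \<theta> (p, t) (time_field M (p, t) # map (differential M (cyl M) (\<lambda>p. (p, t))
      p) vs)
    = B t - (\<Sum>i<length vs. (-1) ^ i * A i t)" for t
  proof -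
    have "ext_deriv (cyl M) \<theta> (p, t) (time_field M (p, t) # map (differential M (cyl M) (\<lambda>p. (p, t))
        p) vs) =
      lext ?\<Theta> (snd ?k (p, t)) (map (\<lambda>v. v ?k) (time_field M (p, t) # map (differential M (cyl M)
          (\<lambda>p. (p, t)) p) vs))"
      by (rule ext_deriv_eq_lext[OF P th k])
        (use time_field_tangent[OF M] slice_vectors_tangent[OF M p] in auto)
    also have "map (\<lambda>v. v ?k) (time_field M (p, t) # map (differential M (cyl M) (\<lambda>p. (p, t)) p) vs)
        = (0, 1) # map ?i ?\<xi>s"
      using vs differential_slice_apply[OF M _ c] by (auto simp: time_field_apply[OF c])
    \<comment> \<open>The term of index 0 omits d/dt and is \<open>B t\<close>. In every other term
      d/dt shifts the index by one, which accounts for the minus sign in front of the sum.\<close>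
    also have "lext ?\<Theta> (snd ?k (p, t)) ((0, 1) # map ?i ?\<xi>s)
        = B t - (\<Sum>i<length vs. (-1) ^ i * A i t)"
      unfolding lext_def
      by (simp add: sum.lessThan_Suc_shift omit_Cons A_def B_def omit_map[symmetric]
          sum_negf del: sum.lessThan_Suc map_map)
    finally show ?thesis .
  qed
  then have "fiber_integral M (ext_deriv (cyl M) \<theta>) p vs
      = integral {0..1} (\<lambda>t. B t - (\<Sum>i<length vs. (-1) ^ i * A i t))"
    using True by (simp add: fiber_integral_def)
  also have "\<dots> = integral {0..1} B - integral {0..1} (\<lambda>t. \<Sum>i<length vs. (-1) ^ i * A i t)"
    by (intro Henstock_Kurzweil_Integration.integral_diff integrable_continuous_real
        continuous_intros contA contB)
  also have "integral {0..1} (\<lambda>t. \<Sum>i<length vs. (-1) ^ i * A i t)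
      = (\<Sum>i<length vs. integral {0..1} (\<lambda>t. (-1) ^ i * A i t))"
    by (intro integral_sum integrable_continuous_real continuous_intros contA) simp
  also have "\<dots> = (\<Sum>i<length vs. (-1) ^ i * integral {0..1} (A i))" by simp
  finally have 2: "fiber_integral M (ext_deriv (cyl M) \<theta>) p vs =
     integral {0..1} B - (\<Sum>i<length vs. (-1) ^ i * integral {0..1} (A i))" .
  have "((\<lambda>t. ?\<Theta> (?x, t) (map ?i ?\<xi>s)) has_vector_derivative B t) (at t)" for t
  proof -
    have "(\<lambda>z. ?\<Theta> z (map ?i ?\<xi>s)) differentiable (at ((?x, 0) + t *\<^sub>R (0, 1)))"
      by (rule smooth_on_differentiable[OF sm]) (use x in auto)
    from has_vector_derivative_along[OF this] show ?thesis by (simp add: B_def)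
  qed
  then have "(B has_integral (?\<Theta> (?x, 1) (map ?i ?\<xi>s) - ?\<Theta> (?x, 0) (map ?i ?\<xi>s))) {0..1}"
    by (rule fundamental_theorem_of_calculus[OF zero_le_one has_vector_derivative_at_within])
  then have 3: "integral {0..1} B = ?\<Theta> (?x, 1) (map ?i ?\<xi>s) - ?\<Theta> (?x, 0) (map ?i ?\<xi>s)"
      by (rule integral_unique)
  have 4: "pullback M (cyl M) (\<lambda>p. (p, t)) \<theta> p vs = ?\<Theta> (?x, t) (map ?i ?\<xi>s)" for t
  proof -
    have "pullback M (cyl M) (\<lambda>p. (p, t)) \<theta> p vs = \<theta> (p, t) (map (differential M (cyl M)
        (\<lambda>p. (p, t)) p) vs)"
      using True by (simp add: pullback_def)
    also have "\<dots> = ?\<Theta> (snd ?k (p, t)) (map (\<lambda>v. v ?k) (map (differential M (cyl M) (\<lambda>p. (p, t)) p)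
        vs))"
      by (rule form_eval[OF P k slice_vectors_tangent[OF M p]])
    also have "map (\<lambda>v. v ?k) (map (differential M (cyl M) (\<lambda>p. (p, t)) p) vs) = map ?i ?\<xi>s"
      using vs differential_slice_apply[OF M _ c] by auto
    moreover have "snd ?k (p, t) = (?x, t)" by simp
    ultimately show ?thesis by metis
  qed
  show ?thesis unfolding 1 2 3 4 by simp
next
  case False
  then show ?thesis by (auto simp: fiber_integral_def pullback_def ext_deriv_def)
qed

text \<open>The map \<open>k\<close>, extended by the identity in time, fixes d/dt and carries the
  slice inclusion at \<open>p\<close> to the one at \<open>k p\<close>. Both integrands therefore
  evaluate \<theta> at the same vectors. With the action of a group element for \<open>k\<close>,
  this yields the invariance of the homotopy operator.\<close>

lemma fiber_integral_pullback:
  assumes M: "smooth_atlas M" and k: "smooth_map M M k"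
  shows "fiber_integral M (pullback (cyl M) (cyl M) (\<lambda>z. (k (fst z), snd z)) \<theta>)
      = pullback M M k (fiber_integral M \<theta>)"
proof (intro ext)
  fix p vs
  note P = smooth_atlas_cyl[OF M] and K = smooth_map_cyl[OF M k]
  let ?K = "\<lambda>z. (k (fst z), snd z)"
  show "fiber_integral M (pullback (cyl M) (cyl M) ?K \<theta>) p vs = pullback M M k (fiber_integral M \<theta>)
      p vs"
  proof (cases "p \<in> points M \<and> set vs \<subseteq> tangent_space M p")
    case True
    then have p: "p \<in> points M" and vs: "set vs \<subseteq> tangent_space M p" by auto
    have kp: "k p \<in> points M" by (rule smooth_map_points[OF k p])
    have "pullback (cyl M) (cyl M) ?K \<theta> (p, t) (time_field M (p, t) # map (differential M (cyl M)
        (\<lambda>p. (p, t)) p) vs)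
      = \<theta> (k p, t) (time_field M (k p, t) # map (differential M (cyl M) (\<lambda>p. (p, t)) (k p))
          (map (differential M M k p) vs))" for t
    proof -
      have "differential (cyl M) (cyl M) ?K (p, t) (differential M (cyl M) (\<lambda>p. (p, t)) p v) =
        differential M (cyl M) (\<lambda>p. (p, t)) (k p) (differential M M k p v)" if v: "v \<in> set vs" for v
        using differential_compose[OF M P P smooth_map_slice[OF M, of t] K p, of v] v vs
          differential_compose[OF M M P k smooth_map_slice[OF M, of t] p, of v] by auto
      then have "map (differential (cyl M) (cyl M) ?K (p, t)) (map (differential M (cyl M)
          (\<lambda>p. (p, t)) p) vs) =
        map (differential M (cyl M) (\<lambda>p. (p, t)) (k p)) (map (differential M M k p) vs)" by simp
      moreover have "(p, t) \<in> points (cyl M)" using p by (simp add: points_prod points_real_line)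
      ultimately show ?thesis
        using slice_vectors_tangent[OF M p, of t vs] time_field_tangent[OF M, of p t]
            differential_cyl_time_field[OF M k p, of t]
        by (simp add: pullback_def del: map_map)
    qed
    moreover have "set (map (differential M M k p) vs) \<subseteq> tangent_space M (k p)"
      using differential_tangent[OF M M k p] by auto
    ultimately show ?thesis
      using True kp by (simp add: fiber_integral_def pullback_def[of M M])
  qed (auto simp: fiber_integral_def pullback_def)
qed

text \<open>\<open>Y'\<close> is carried from \<open>M\<close> by the slices, so both sides evaluate
  \<theta> at the same vectors except that \<open>Y'\<close> and d/dt are exchanged. The sign of the
  exchange is read off in a chart, where the form is an \<open>alternating_form\<close>.\<close>

lemma fiber_integral_interior_product:
  assumes M: "smooth_atlas M" and th: "\<theta> \<in> all_forms (cyl M)"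
    and Y: "\<And>p. p \<in> points M \<Longrightarrow> Y p \<in> tangent_space M p"
    and Y': "\<And>p t. p \<in> points M \<Longrightarrow> Y' (p, t) = differential M (cyl M) (\<lambda>p. (p, t)) p (Y p)"
  shows "fiber_integral M (interior_product Y' \<theta>) p vs = - interior_product Y (fiber_integral M \<theta>)
      p vs"
proof (cases "p \<in> points M \<and> set vs \<subseteq> tangent_space M p")
  case True
  then have p: "p \<in> points M" and vs: "set vs \<subseteq> tangent_space M p" by auto
  obtain c where c: "c \<in> charts_at M p" using chart_at_in[OF M p] by blast
  let ?d = "\<lambda>t. differential M (cyl M) (\<lambda>p. (p, t)) p" and ?k = "cyl_chart c"
  have "\<theta> (p, t) (?d t (Y p) # time_field M (p, t) # map (?d t) vs)
      = - \<theta> (p, t) (time_field M (p, t) # map (?d t) (Y p # vs))" for t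
  proof -
    have k: "?k \<in> charts_at (cyl M) (p, t)" using c unfolding charts_at_cyl by blast
    then have ka: "?k \<in> atlas (cyl M)" "snd ?k (p, t) \<in> snd ?k ` chart_dom ?k"
        unfolding charts_at_iff by blast+
    have tan: "set (map (?d t) (Y p # vs)) \<subseteq> tangent_space (cyl M) (p, t)"
        by (rule slice_vectors_tangent[OF M p])
    note alt = alternating_form_swap[OF form_onD(2)[OF form_on_local_form[OF smooth_atlas_cyl[OF M]
        th ka(1)] ka(2)], of "[]"]
    have ev: "set ws \<subseteq> tangent_space (cyl M) (p, t) \<Longrightarrow> \<theta> (p, t) ws =
        local_form (cyl M) ?k \<theta> (snd ?k (p, t)) (map (\<lambda>v. v ?k) ws)" for ws
      by (rule form_eval[OF smooth_atlas_cyl[OF M] k])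
    note tt = time_field_tangent[OF M, of p t]
    have "\<theta> (p, t) (?d t (Y p) # time_field M (p, t) # map (?d t) vs)
        = local_form (cyl M) ?k \<theta> (snd ?k (p, t))
        (map (\<lambda>v. v ?k) (?d t (Y p) # time_field M (p, t) # map (?d t) vs))"
      by (rule ev) (use tan tt in simp)
    also have "\<dots> = - local_form (cyl M) ?k \<theta> (snd ?k (p, t)) (map (\<lambda>v. v ?k) (time_field M (p, t)
        # map (?d t) (Y p # vs)))"
      unfolding list.map by (rule alt[unfolded append_Nil])
    also have "local_form (cyl M) ?k \<theta> (snd ?k (p, t)) (map (\<lambda>v. v ?k) (time_field M (p, t)
        # map (?d t) (Y p # vs)))
        = \<theta> (p, t) (time_field M (p, t) # map (?d t) (Y p # vs))"
      by (rule ev[symmetric]) (use tan tt in simp)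
    finally show ?thesis .
  qed
  then show ?thesis using True Y[OF p] Y'[OF p] by (simp add: fiber_integral_def
      interior_product_def)
next
  case False
  then show ?thesis by (auto simp: fiber_integral_def interior_product_def)
qed

lemma fiber_integral_sum:
  assumes M: "smooth_atlas M" and w: "\<And>j. j \<in> J \<Longrightarrow> \<theta> j \<in> all_forms (cyl M)" and J: "finite J"
  shows "fiber_integral M (\<lambda>p vs. \<Sum>j\<in>J. a j * \<theta> j p vs) p vs = (\<Sum>j\<in>J. a j * fiber_integral M (\<theta> j)
      p vs)"
proof (cases "p \<in> points M \<and> set vs \<subseteq> tangent_space M p")
  case True
  then show ?thesis
    unfolding fiber_integral_def
    by (simp add: integral_sum[OF J] integrable_on_mult_right fiber_integrand_integrable[OF M w])
next
  case False
  then have "fiber_integral M \<theta> p vs = 0" for \<theta> by (auto simp: fiber_integral_def)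
  then show ?thesis by simp
qed

section \<open>Ordinary differential equations\<close>

lemma has_vector_derivative_norm_bound:
  fixes f :: "real \<Rightarrow> 'a::real_normed_vector"
  assumes S: "convex S" "s \<in> S" "t \<in> S"
    and d: "\<And>x. x \<in> S \<Longrightarrow> (f has_vector_derivative f' x) (at x within S)"
    and B: "\<And>x. x \<in> S \<Longrightarrow> norm (f' x) \<le> B"
  shows "norm (f s - f t) \<le> B * \<bar>s - t\<bar>"
proof -
  have "norm (f s - f t) \<le> B * norm (s - t)"
  proof (rule differentiable_bound[OF S(1) _ _ S(2,3)])
    show "(f has_derivative (\<lambda>h. h *\<^sub>R f' x)) (at x within S)" if "x \<in> S" for x
      using d[OF that] by (simp add: has_vector_derivative_def)
    show "onorm (\<lambda>h. h *\<^sub>R f' x) \<le> B" if "x \<in> S" for x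
      by (rule onorm_le) (use mult_left_mono[OF B[OF that] abs_ge_zero] in \<open>simp add: mult.commute\<close>)
  qed
  then show ?thesis by simp
qed

text \<open>Picard iteration, on curves that are constant outside of \<open>[-\<tau>, \<tau>]\<close>.\<close>

lemma ode_solution_banach:
  fixes V :: "'a::banach \<Rightarrow> 'a"
  assumes r: "r > 0" and K: "K \<ge> 0"
    and lip: "\<And>x y. x \<in> cball e r \<Longrightarrow> y \<in> cball e r \<Longrightarrow> norm (V x - V y) \<le> K * norm (x - y)"
  shows "\<exists>\<tau>>0. \<exists>u. u 0 = e \<and> (\<forall>t. \<bar>t\<bar> < \<tau> \<longrightarrow> u t \<in> cball e r \<and> (u has_vector_derivative V (u t))
      (at t))"
proof -
  \<comment> \<open>A bound for the speed of solutions inside the ball; the summand 1 makes it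
    positive, so that it can be a divisor.\<close>
  define B where "B = norm (V e) + K * r + 1"
  have B: "B > 0" using r K by (auto simp: B_def intro!: add_nonneg_pos)
  have VB: "norm (V x) \<le> B" if x: "x \<in> cball e r" for x
  proof -
    have "norm (V x) \<le> norm (V e) + norm (V x - V e)" by (metis add.commute norm_triangle_sub)
    also have "norm (V x - V e) \<le> K * norm (x - e)" using lip x r by simp
    also have "\<dots> \<le> K * r" using x K by (intro mult_left_mono)
        (auto simp: dist_norm norm_minus_commute)
    finally show ?thesis by (simp add: B_def)
  qed
  have contV: "continuous_on (cball e r) V"
  proof (rule continuous_onI)
    fix x and \<epsilon> :: real assume x: "x \<in> cball e r" and \<epsilon>: "\<epsilon> > 0"
    show "\<exists>d>0. \<forall>x'\<in>cball e r. dist x' x < d \<longrightarrow> dist (V x') (V x) \<le> \<epsilon>"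
    proof (intro exI[of _ "\<epsilon> / (K + 1)"] conjI ballI impI)
      show "\<epsilon> / (K + 1) > 0" using \<epsilon> K by simp
      fix y assume y: "y \<in> cball e r" "dist y x < \<epsilon> / (K + 1)"
      have "dist (V y) (V x) \<le> K * dist y x" using lip[OF y(1) x] by (simp add: dist_norm)
      also have "\<dots> \<le> (K + 1) * (\<epsilon> / (K + 1))" using y(2) K by (intro mult_mono) auto
      finally show "dist (V y) (V x) \<le> \<epsilon>" using K by simp
    qed
  qed
  \<comment> \<open>Within time \<open>r / B\<close> a curve of speed at most \<open>B\<close>
    cannot leave the ball, and \<open>1 / (2 * (K + 1))\<close> turns the Picard operator into a
    contraction with factor 1/2.\<close>
  define \<tau> where "\<tau> = min (r / B) (1 / (2 * (K + 1)))"
  have \<tau>: "\<tau> > 0" using r B K by (simp add: \<tau>_def)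
  have "B * \<tau> \<le> B * (r / B)" using B by (intro mult_left_mono) (auto simp: \<tau>_def)
  then have B\<tau>: "B * \<tau> \<le> r" using B by simp
  have "K * \<tau> \<le> K * (1 / (2 * (K + 1)))" using K by (intro mult_left_mono) (auto simp: \<tau>_def)
  also have "\<dots> \<le> 1 / 2" using K by (simp add: field_simps)
  finally have K\<tau>: "K * \<tau> \<le> 1 / 2" .
  let ?I = "{-\<tau>..\<tau>}"
  \<comment> \<open>Clamping the time to \<open>[-\<tau>, \<tau>]\<close> extends curves to bounded
    continuous functions on the whole line, which form a complete space.\<close>
  define cl where "cl = (\<lambda>t. max (-\<tau>) (min \<tau> t))"
  have cl: "cl t \<in> ?I" for t using \<tau> by (auto simp: cl_def)
  have cl_id: "cl t = t" if "t \<in> ?I" for t using that by (auto simp: cl_def)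
  have cl_cont: "continuous_on UNIV cl" unfolding cl_def by (intro continuous_intros)
  define S where "S = {f :: real \<Rightarrow>\<^sub>C 'a. \<forall>t. f t \<in> cball e r}"
  \<comment> \<open>The difference of two integrals that start at \<open>-\<tau>\<close> is the
    integral from 0 to \<open>t\<close>, for \<open>t\<close> of either sign.\<close>
  define J where "J = (\<lambda>(f :: real \<Rightarrow>\<^sub>C 'a) t. e + (integral {-\<tau>..t} (\<lambda>s. V (f s))
      - integral {-\<tau>..0} (\<lambda>s. V (f s))))"
  have J0: "J f 0 = e" for f by (simp add: J_def)
  have JD: "(J f has_vector_derivative V (f t)) (at t within ?I)" if "f \<in> S" "t \<in> ?I" for f t
  proof -
    have "continuous_on ?I (\<lambda>s. V (f s))"
      by (rule continuous_on_compose2[OF contV]) (use that(1) in \<open>auto simp: S_def\<close>)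
    from integral_has_vector_derivative[OF this that(2)]
    show ?thesis unfolding J_def by (auto intro!: derivative_eq_intros)
  qed
  have abs_le: "\<bar>t\<bar> \<le> \<tau>" if "t \<in> ?I" for t using that by auto
  have zero: "(0::real) \<in> ?I" using \<tau> by simp
  have Jin: "J f t \<in> cball e r" if f: "f \<in> S" and t: "t \<in> ?I" for f t
  proof -
    have "norm (J f t - J f 0) \<le> B * \<bar>t - 0\<bar>"
      by (rule has_vector_derivative_norm_bound[OF _ t zero JD[OF f]])
          (use VB f in \<open>auto simp: S_def\<close>)
    also have "\<dots> \<le> B * \<tau>" using abs_le[OF t] B by simp
    finally show ?thesis using B\<tau> by (simp add: J0 dist_norm norm_minus_commute)
  qed
  define \<Phi> where "\<Phi> = (\<lambda>f. Bcontfun (\<lambda>t. J f (cl t)))"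
  have \<Phi>: "\<Phi> f t = J f (cl t)" if f: "f \<in> S" for f t
  proof -
    have "continuous_on ?I (J f)"
      unfolding continuous_on_eq_continuous_within using has_vector_derivative_continuous[OF JD[OF
          f]] by blast
    then have "continuous_on UNIV (\<lambda>t. J f (cl t))"
      by (rule continuous_on_compose2[OF _ cl_cont]) (use cl in auto)
    moreover have "bounded (range (\<lambda>t. J f (cl t)))"
      by (rule bounded_subset[OF bounded_cball[of e r]]) (use Jin[OF f cl] in blast)
    ultimately show ?thesis unfolding \<Phi>_def by (subst Bcontfun_inverse) (auto simp: bcontfun_def)
  qed
  have "\<exists>!f\<in>S. \<Phi> f = f"
  proof (rule Banach_fix[where c = "1/2"])
    have "S = PiC UNIV (\<lambda>_. cball e r)" by (auto simp: S_def mem_PiC_iff Pi_iff)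
    then show "complete S" using closed_PiC[of UNIV "\<lambda>_. cball e r"]
        by (simp add: complete_eq_closed)
    show "S \<noteq> {}" using r by (auto simp: S_def intro!: exI[of _ "const_bcontfun e"])
    show "\<Phi> ` S \<subseteq> S" using \<Phi> Jin cl by (auto simp: S_def)
    fix f g assume f: "f \<in> S" and g: "g \<in> S"
    show "dist (\<Phi> f) (\<Phi> g) \<le> 1 / 2 * dist f g"
    proof (rule dist_bound)
      fix t
      have "norm ((J f (cl t) - J g (cl t)) - (J f 0 - J g 0)) \<le> (K * dist f g) * \<bar>cl t - 0\<bar>"
      proof (rule has_vector_derivative_norm_bound[OF _ cl zero])
        show "((\<lambda>t. J f t - J g t) has_vector_derivative V (f t) - V (g t)) (at t within ?I)"
            if "t \<in> ?I" for t
          by (rule has_vector_derivative_diff[OF JD[OF f that] JD[OF g that]])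
        show "norm (V (f t) - V (g t)) \<le> K * dist f g" for t
        proof -
          have "norm (V (f t) - V (g t)) \<le> K * dist (f t) (g t)" using lip f g
              by (simp add: S_def dist_norm)
          also have "\<dots> \<le> K * dist f g" using K dist_bounded by (intro mult_left_mono)
          finally show ?thesis .
        qed
      qed simp
      also have "\<dots> \<le> (K * dist f g) * \<tau>" using abs_le[OF cl] K by (intro mult_left_mono) auto
      also have "\<dots> = (K * \<tau>) * dist f g" by simp
      also have "\<dots> \<le> 1 / 2 * dist f g" using K\<tau> by (intro mult_right_mono) auto
      finally show "dist (\<Phi> f t) (\<Phi> g t) \<le> 1 / 2 * dist f g"
          by (simp add: \<Phi>[OF f] \<Phi>[OF g] J0 dist_norm)
    qed
  qed auto
  then obtain f where f: "f \<in> S" "\<Phi> f = f" by blast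
  have fJ: "f t = J f t" if "t \<in> ?I" for t using \<Phi>[OF f(1), of t] f(2) cl_id[OF that] by simp
  have "f t \<in> cball e r \<and> (f has_vector_derivative V (f t)) (at t)" if t: "\<bar>t\<bar> < \<tau>" for t
  proof
    show "f t \<in> cball e r" using f(1) by (auto simp: S_def)
    have tI: "t \<in> ?I" and "-\<tau> < t" "t < \<tau>" using t by auto
    then have "(J f has_vector_derivative V (f t)) (at t)" using JD[OF f(1) tI]
        by (simp add: at_within_Icc_at)
    then show "(f has_vector_derivative V (f t)) (at t)"
      by (rule has_vector_derivative_transform_within_open[of _ _ _ "{-\<tau><..<\<tau>}"]) (use t fJ in auto)
  qed
  moreover have "f 0 = e" using fJ[OF zero] J0 by simp
  ultimately show ?thesis using \<tau> by blast
qed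

text \<open>
  A finite-dimensional normed space is a retract of the space of functionals on it, which is a
  Banach space.
\<close>

lemma ode_solution:
  fixes V :: "'a::real_normed_vector \<Rightarrow> 'a" and w :: "nat \<Rightarrow> 'a \<Rightarrow> real"
  assumes c: "coordinates n b w" and r: "r > 0" and K: "K \<ge> 0"
    and lip: "\<And>x y. x \<in> cball e r \<Longrightarrow> y \<in> cball e r \<Longrightarrow> norm (V x - V y) \<le> K * norm (x - y)"
  shows "\<exists>\<tau>>0. \<exists>u. u 0 = e \<and> (\<forall>t. \<bar>t\<bar> < \<tau> \<longrightarrow> u t \<in> cball e r \<and> (u has_vector_derivative V (u t))
      (at t))"
proof -
  \<comment> \<open>As \<open>w\<close> and \<open>b\<close> are dual to each other,
    \<open>S\<close> below is a left inverse of \<open>T\<close>. The equation is solved for the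
    field \<open>V\<close> transported to functionals, \<open>T\<close> after \<open>V\<close> after
    \<open>S\<close>, and \<open>S\<close> carries the solution back.\<close>
  define T where "T = (\<lambda>x. \<Sum>i<n. w i x *\<^sub>R Blinfun (w i))"
  define S where "S = (\<lambda>\<phi> :: 'a \<Rightarrow>\<^sub>L real. \<Sum>i<n. \<phi> (b i) *\<^sub>R b i)"
  have T: "bounded_linear T" unfolding T_def
    by (intro bounded_linear_sum bounded_linear_scaleR_const coordinates_bounded_linear[OF c]) simp
  have S: "bounded_linear S" unfolding S_def
    by (intro bounded_linear_sum bounded_linear_scaleR_const blinfun.bounded_linear_left)
  have ST: "S (T x) = x" for x
  proof -
    have "S (T x) = (\<Sum>i<n. (\<Sum>j<n. w j x * w j (b i)) *\<^sub>R b i)"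
      unfolding S_def T_def using coordinates_bounded_linear[OF c]
      by (intro sum.cong) (auto simp: blinfun.sum_left blinfun.scaleR_left
          bounded_linear_Blinfun_apply)
    also have "\<dots> = (\<Sum>i<n. w i x *\<^sub>R b i)"
    proof (intro sum.cong refl)
      fix i assume i: "i \<in> {..<n}"
      have "(\<Sum>j<n. w j x * w j (b i)) = (\<Sum>j<n. if j = i then w i x else 0)"
        using c i by (intro sum.cong) (auto simp: coordinates_def)
      then show "(\<Sum>j<n. w j x * w j (b i)) *\<^sub>R b i = w i x *\<^sub>R b i" using i by simp
    qed
    finally show ?thesis using coordinates_sum[OF c] by simp
  qed
  obtain CT where CT: "CT > 0" "\<And>x. norm (T x) \<le> norm x * CT" using bounded_linear.pos_bounded[OF T]
      by blast
  obtain CS where CS: "CS > 0" "\<And>x. norm (S x) \<le> norm x * CS" using bounded_linear.pos_bounded[OF S]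
      by blast
  \<comment> \<open>Chosen such that \<open>S\<close> maps the ball of radius \<open>r'\<close> into
    the ball on which \<open>V\<close> is Lipschitz.\<close>
  define r' where "r' = r / CS"
  have r': "r' > 0" using r CS by (simp add: r'_def)
  have Sin: "S \<phi> \<in> cball e r" if "\<phi> \<in> cball (T e) r'" for \<phi>
  proof -
    have "dist e (S \<phi>) = norm (S (T e - \<phi>))" by (simp add: dist_norm linear_diff[OF
        bounded_linear.linear[OF S]] ST)
    also have "\<dots> \<le> norm (T e - \<phi>) * CS" by (rule CS)
    also have "\<dots> \<le> r' * CS" using that CS(1) by (intro mult_right_mono) (auto simp: dist_norm)
    finally show ?thesis using CS(1) by (simp add: r'_def)
  qed
  have "\<exists>\<tau>>0. \<exists>u. u 0 = T e \<and> (\<forall>t. \<bar>t\<bar> < \<tau> \<longrightarrow> u t \<in> cball (T e) r'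
      \<and> (u has_vector_derivative T (V (S (u t)))) (at t))"
  proof (rule ode_solution_banach[OF r', of "CT * K * CS"])
    show "CT * K * CS \<ge> 0" using CT CS K by simp
    fix x y assume x: "x \<in> cball (T e) r'" and y: "y \<in> cball (T e) r'"
    have "norm (T (V (S x)) - T (V (S y))) \<le> norm (V (S x) - V (S y)) * CT"
      using CT(2)[of "V (S x) - V (S y)"] by (simp add: linear_diff[OF bounded_linear.linear[OF T]])
    also have "\<dots> \<le> (K * norm (S x - S y)) * CT"
      using lip[OF Sin[OF x] Sin[OF y]] CT(1) by (intro mult_right_mono) auto
    also have "\<dots> \<le> (K * (norm (x - y) * CS)) * CT"
      using CS(2)[of "x - y"] CT(1) K
      by (intro mult_right_mono mult_left_mono) (auto simp: linear_diff[OF bounded_linear.linear[OF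
          S]])
    finally show "norm (T (V (S x)) - T (V (S y))) \<le> CT * K * CS * norm (x - y)"
        by (simp add: algebra_simps)
  qed
  then obtain \<tau> u where \<tau>: "\<tau> > 0" and u: "u 0 = T e"
    "\<And>t. \<bar>t\<bar> < \<tau> \<Longrightarrow> u t \<in> cball (T e) r'" "\<And>t. \<bar>t\<bar> < \<tau> \<Longrightarrow> (u has_vector_derivative T (V (S (u t))))
        (at t)"
    by blast
  have "((\<lambda>t. S (u t)) has_vector_derivative V (S (u t))) (at t)" if "\<bar>t\<bar> < \<tau>" for t
    using bounded_linear.has_vector_derivative[OF S u(3)[OF that]] by (simp add: ST)
  then show ?thesis
    using \<tau> u Sin ST by (intro exI[of _ \<tau>] conjI exI[of _ "\<lambda>t. S (u t)"]) auto
qed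

text \<open>By continuity the finitely many derivatives along basis vectors are bounded near
  \<open>e\<close>. This bounds the derivative in every direction, and the mean value inequality
  along segments of the ball concludes.\<close>

lemma smooth_on_locally_lipschitz:
  fixes V :: "'a::real_normed_vector \<Rightarrow> 'b::real_normed_vector" and w :: "nat \<Rightarrow> 'a \<Rightarrow> real"
  assumes c: "coordinates n b w" and U: "open U" "e \<in> U" and V: "smooth_on U V"
  shows "\<exists>r>0. \<exists>K\<ge>0. cball e r \<subseteq> U \<and> (\<forall>x\<in>cball e r. \<forall>y\<in>cball e r. norm (V x - V y)
      \<le> K * norm (x - y))"
proof -
  \<comment> \<open>One more than the size of the derivative at \<open>e\<close>, so that the strict
    bound persists on a neighbourhood.\<close>
  define C where "C = (\<lambda>i. norm (fderiv V e (b i)) + 1)"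
  define X where "X = (\<lambda>i. {x \<in> U. fderiv V x (b i) \<in> ball 0 (C i)})"
  have "open (X i)" for i unfolding X_def by (rule open_smooth_preimage[OF smooth_on_fderiv[OF V]
      U(1)]) simp
  then have o: "open (U \<inter> (\<Inter>i<n. X i))" using U(1) by auto
  have "e \<in> U \<inter> (\<Inter>i<n. X i)" using U(2) by (auto simp: X_def C_def)
  then obtain r where r: "r > 0" "cball e r \<subseteq> U \<inter> (\<Inter>i<n. X i)" using o open_contains_cball by metis
  obtain Kw where Kw: "Kw > 0" "\<And>x. (\<Sum>i<n. \<bar>w i x\<bar>) \<le> Kw * norm x"
      using coordinates_norm_bound[OF c] by blast
  define K where "K = (\<Sum>i<n. C i) * Kw"
  have Cpos: "C i \<ge> 0" for i by (simp add: C_def)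
  have Cs: "(\<Sum>i<n. C i) \<ge> 0" using Cpos by (simp add: sum_nonneg)
  have D: "norm (fderiv V x v) \<le> K * norm v" if x: "x \<in> cball e r" for x v
  proof -
    have xU: "x \<in> U" and xX: "\<And>i. i < n \<Longrightarrow> norm (fderiv V x (b i)) \<le> C i" using r(2) x
        by (auto simp: X_def subset_iff intro!: less_imp_le)
    have "fderiv V x v = (\<Sum>i<n. w i v *\<^sub>R fderiv V x (b i))"
      by (rule coordinates_linear_apply[OF c linear_fderiv[OF smooth_on_differentiable[OF V xU]]])
    also have "norm \<dots> \<le> (\<Sum>i<n. \<bar>w i v\<bar> * (\<Sum>j<n. C j))"
    proof (rule sum_norm_le)
      fix i assume i: "i \<in> {..<n}"
      have "norm (fderiv V x (b i)) \<le> C i" using xX i by simp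
      also have "C i \<le> (\<Sum>j<n. C j)" using i Cpos by (intro member_le_sum) auto
      finally show "norm (w i v *\<^sub>R fderiv V x (b i)) \<le> \<bar>w i v\<bar> * (\<Sum>j<n. C j)"
          by (simp add: mult_left_mono)
    qed
    also have "\<dots> = (\<Sum>i<n. \<bar>w i v\<bar>) * (\<Sum>j<n. C j)" by (rule sum_distrib_right[symmetric])
    also have "\<dots> \<le> (Kw * norm v) * (\<Sum>j<n. C j)" using Kw(2) Cs by (intro mult_right_mono)
    finally show ?thesis by (simp add: K_def mult_ac)
  qed
  have "norm (V x - V y) \<le> K * norm (x - y)" if x: "x \<in> cball e r" and y: "y \<in> cball e r" for x y
  proof -
    have seg: "y + s *\<^sub>R (x - y) \<in> cball e r" if "s \<in> {0..1}" for s
    proof -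
      have "(1 - s) *\<^sub>R y + s *\<^sub>R x \<in> cball e r"
        using convex_cball[of e r] x y that unfolding convex_alt by auto
      then show ?thesis by (simp add: algebra_simps)
    qed
    have "norm (V (y + 1 *\<^sub>R (x - y)) - V (y + 0 *\<^sub>R (x - y))) \<le> (K * norm (x - y)) * \<bar>1 - 0\<bar>"
    proof (rule has_vector_derivative_norm_bound[where S = "{0..1}"])
      fix s :: real assume s: "s \<in> {0..1}"
      have "V differentiable (at (y + s *\<^sub>R (x - y)))"
        using smooth_on_differentiable[OF V] seg[OF s] r(2) by blast
      then show "((\<lambda>s. V (y + s *\<^sub>R (x - y))) has_vector_derivative fderiv V (y
          + s *\<^sub>R (x - y)) (x - y)) (at s within {0..1})"
        by (rule has_vector_derivative_at_within[OF has_vector_derivative_along])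
      show "norm (fderiv V (y + s *\<^sub>R (x - y)) (x - y)) \<le> K * norm (x - y)"
          by (rule D[OF seg[OF s]])
    qed auto
    then show ?thesis by simp
  qed
  moreover have "K \<ge> 0" using Kw(1) Cs by (simp add: K_def)
  ultimately show ?thesis using r by blast
qed

text \<open>The interval is so short that integrating the Lipschitz estimate bounds the maximum of
  the distance between the two curves by half of itself. The maximum is therefore 0.\<close>

lemma ode_unique:
  fixes V :: "'a::real_normed_vector \<Rightarrow> 'a"
  assumes K: "K \<ge> 0" "K * \<tau> \<le> 1 / 2" and \<tau>: "\<tau> \<ge> 0"
    and lip: "\<And>x y. x \<in> A \<Longrightarrow> y \<in> A \<Longrightarrow> norm (V x - V y) \<le> K * norm (x - y)"
    and v: "\<And>t. \<bar>t\<bar> \<le> \<tau> \<Longrightarrow> v t \<in> A \<and> (v has_vector_derivative V (v t)) (at t)"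
    and w: "\<And>t. \<bar>t\<bar> \<le> \<tau> \<Longrightarrow> w t \<in> A \<and> (w has_vector_derivative V (w t)) (at t)"
    and 0: "v 0 = w 0" and t: "\<bar>t\<bar> \<le> \<tau>"
  shows "v t = w t"
proof -
  let ?I = "{-\<tau>..\<tau>}"
  have I: "\<bar>s\<bar> \<le> \<tau> \<longleftrightarrow> s \<in> ?I" for s by auto
  have d: "((\<lambda>t. v t - w t) has_vector_derivative V (v s) - V (w s)) (at s within ?I)" if "s \<in> ?I"
      for s
    using v[of s] w[of s] that[folded I] by (simp add: has_vector_derivative_at_within
        has_vector_derivative_diff)
  have "continuous_on ?I (\<lambda>t. norm (v t - w t))"
    unfolding continuous_on_eq_continuous_within
    using continuous_norm[OF has_vector_derivative_continuous[OF d]] by blast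
  then obtain m where m: "m \<in> ?I" "\<And>s. s \<in> ?I \<Longrightarrow> norm (v s - w s) \<le> norm (v m - w m)"
    using continuous_attains_sup[OF compact_Icc, of "-\<tau>" \<tau> "\<lambda>t. norm (v t - w t)"] \<tau> by auto
  let ?N = "norm (v m - w m)"
  have "norm ((v m - w m) - (v 0 - w 0)) \<le> (K * ?N) * \<bar>m - 0\<bar>"
  proof (rule has_vector_derivative_norm_bound[OF _ m(1) _ d])
    fix s assume s: "s \<in> ?I"
    have "norm (V (v s) - V (w s)) \<le> K * norm (v s - w s)" using lip v[of s] w[of s] s[folded I]
        by simp
    also have "\<dots> \<le> K * ?N" using m(2)[OF s] K(1) by (rule mult_left_mono)
    finally show "norm (V (v s) - V (w s)) \<le> K * ?N" .
  qed (use \<tau> in auto)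
  also have "\<dots> \<le> (K * ?N) * \<tau>" using m(1) K(1) by (intro mult_left_mono) auto
  also have "\<dots> = (K * \<tau>) * ?N" by simp
  also have "\<dots> \<le> 1 / 2 * ?N" using K(2) by (intro mult_right_mono) auto
  finally have "?N \<le> 0" using 0 by simp
  moreover have "norm (v t - w t) \<le> ?N" using m(2) t I by blast
  ultimately show ?thesis by simp
qed

text \<open>Bootstrapping: if \<open>u\<close> is C^k, then so is its derivative
  \<open>V (u t)\<close>, and \<open>u\<close> is of order one higher.\<close>

lemma ode_solution_smooth:
  fixes V :: "'a::real_normed_vector \<Rightarrow> 'a" and w :: "nat \<Rightarrow> 'a \<Rightarrow> real"
  assumes c: "coordinates n b w" and U: "open U" and V: "smooth_on U V" and I: "open I"
    and u: "\<And>t. t \<in> I \<Longrightarrow> u t \<in> U \<and> (u has_vector_derivative V (u t)) (at t)"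
  shows "smooth_on I u"
  unfolding smooth_on_def
proof
  fix k
  have d: "(u has_derivative (\<lambda>h. h *\<^sub>R V (u t))) (at t)" if "t \<in> I" for t
    using u[OF that] by (simp add: has_vector_derivative_def)
  show "Ck_on k I u"
  proof (induction k)
    case 0
    then show ?case
      using u by (auto intro!: continuous_at_imp_continuous_on intro:
          has_vector_derivative_continuous)
  next
    case (Suc k)
    have "Ck_on k I (\<lambda>t. V (u t))"
      by (rule Ck_on_compose[OF c I U _ Suc]) (use u V in \<open>auto simp: smooth_on_def\<close>)
    then have "Ck_on k I (\<lambda>t. h *\<^sub>R V (u t))" for h
      by (rule Ck_on_bounded_linear_compose[OF bounded_linear_scaleR_right I])
    then have "Ck_on k I (\<lambda>t. fderiv u t h)" for h
      by (rule Ck_on_cong[OF I, of "\<lambda>t. h *\<^sub>R V (u t)", rotated]) (simp add: fderiv_eq[OF d])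
    then show ?case using differentiableI[OF d] by simp
  qed
qed

section \<open>Curves\<close>

lemma chart_inv_real_line: "chart_inv (UNIV, id) = (\<lambda>t::real. t)"
  by (simp add: inv_id[unfolded id_def] id_def)

lemma smooth_curve_open:
  assumes M: "smooth_atlas M" and g: "smooth_map real_line M \<gamma>" and c: "c \<in> atlas M" and T: "open T"
  shows "open {t. \<gamma> t \<in> chart_dom c \<and> snd c (\<gamma> t) \<in> T}"
proof -
  have "continuous_map euclidean (mtop M) \<gamma>" using g by (simp add: smooth_map_def real_line_def)
  from openin_continuous_map_preimage[OF this chart_preimage_open[OF M c T]] show ?thesis by simp
qed

lemma smooth_curve_local:
  assumes g: "smooth_map real_line M \<gamma>" and c: "c \<in> atlas M"
  shows "smooth_on {t. \<gamma> t \<in> chart_dom c} (\<lambda>t. snd c (\<gamma> t))"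
proof -
  have "(UNIV, id) \<in> atlas real_line" by (simp add: real_line_def)
  from local_rep_smooth[OF g this c] show ?thesis by (simp add: chart_inv_real_line vimage_def)
qed

lemma smooth_curveI:
  assumes M: "smooth_atlas M"
    and loc: "\<And>t. \<exists>c\<in>charts_at M (\<gamma> t). \<exists>T. open T \<and> t \<in> T \<and> (\<forall>s\<in>T. \<gamma> s \<in> chart_dom c)
        \<and> smooth_on T (\<lambda>s. snd c (\<gamma> s))"
  shows "smooth_map real_line M \<gamma>"
proof (rule smooth_mapI_local[OF smooth_atlas_real_line M])
  fix t :: real
  obtain c T where "c \<in> charts_at M (\<gamma> t)" "open T" "t \<in> T" "\<forall>s\<in>T. \<gamma> s \<in> chart_dom c"
      "smooth_on T (\<lambda>s. snd c (\<gamma> s))"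
    using loc by blast
  then show "\<exists>k\<in>charts_at real_line t. \<exists>c'\<in>charts_at M (\<gamma> t). \<exists>S. open S \<and> snd k t \<in> S \<and>
      S \<subseteq> snd k ` chart_dom k \<and> (\<forall>x\<in>S. \<gamma> (chart_inv k x) \<in> chart_dom c')
          \<and> smooth_on S (local_rep k c' \<gamma>)"
    unfolding charts_at_real_line
    by (intro bexI[of _ "(UNIV, id)"] bexI[of _ c] exI[of _ T]) (simp_all add: chart_inv_real_line)
qed

abbreviation unit_tangent :: "(real, real) tangent" where
  "unit_tangent \<equiv> (\<lambda>k. if k = (UNIV, id) then 1 else 0)"

lemma unit_tangent: "unit_tangent \<in> tangent_space real_line t"
proof (rule tangent_spaceI)
  fix c c' :: "(real, real) chart"
  assume "c \<in> charts_at real_line t" "c' \<in> charts_at real_line t"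
  then have "c = (UNIV, id)" "c' = (UNIV, id)" unfolding charts_at_real_line by blast+
  then show "unit_tangent c' = fderiv (local_rep c c' (\<lambda>x. x)) (snd c t) (unit_tangent c)"
    by (simp add: chart_inv_real_line)
qed (auto simp: charts_at_real_line)

lemma velocity_has_vector_derivative:
  assumes M: "smooth_atlas M" and g: "smooth_map real_line M \<gamma>" and c: "c \<in> charts_at M (\<gamma> t)"
  shows "((\<lambda>s. snd c (\<gamma> s)) has_vector_derivative velocity M \<gamma> t c) (at t)"
proof -
  have "(\<lambda>s. snd c (\<gamma> s)) differentiable (at t)"
    using smooth_on_differentiable[OF smooth_curve_local[OF g]] c by (auto simp: charts_at_iff)
  then show ?thesis using c by (simp add: velocity_def vector_derivative_works)
qed

text \<open>A velocity is the image of the unit tangent of the line, so the chain rule for curves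
  becomes an instance of \<open>differential_compose\<close>.\<close>

lemma velocity_eq_differential:
  assumes M: "smooth_atlas M" and g: "smooth_map real_line M \<gamma>"
  shows "velocity M \<gamma> t = differential real_line M \<gamma> t unit_tangent"
proof
  fix c
  have k: "(UNIV, id) \<in> charts_at real_line t" by (simp add: charts_at_real_line)
  show "velocity M \<gamma> t c = differential real_line M \<gamma> t unit_tangent c"
  proof (cases "c \<in> charts_at M (\<gamma> t)")
    case True
    have "differential real_line M \<gamma> t unit_tangent c = fderiv (\<lambda>s. snd c (\<gamma> s)) t 1"
      using differential_apply[OF smooth_atlas_real_line g unit_tangent k True]
          by (simp add: chart_inv_real_line)
    also have "\<dots> = velocity M \<gamma> t c"
      using fderiv_eq[OF velocity_has_vector_derivative[OF M g True, unfolded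
          has_vector_derivative_def]] by simp
    finally show ?thesis by simp
  qed (simp add: velocity_def differential_def)
qed

lemma velocity_tangent:
  assumes "smooth_atlas M" "smooth_map real_line M \<gamma>"
  shows "velocity M \<gamma> t \<in> tangent_space M (\<gamma> t)"
  unfolding velocity_eq_differential[OF assms]
  by (rule differential_tangent[OF smooth_atlas_real_line assms]) (simp add: points_real_line)

lemma velocity_compose:
  assumes M: "smooth_atlas M" and N: "smooth_atlas N" and g: "smooth_map real_line M \<gamma>"
      and f: "smooth_map M N f"
  shows "velocity N (\<lambda>t. f (\<gamma> t)) t = differential M N f (\<gamma> t) (velocity M \<gamma> t)"
  unfolding velocity_eq_differential[OF M g]
    velocity_eq_differential[OF N smooth_map_compose[OF smooth_atlas_real_line M N g f]]
  by (rule differential_compose[OF smooth_atlas_real_line M N g f _ unit_tangent])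
      (simp add: points_real_line)


section \<open>One-parameter subgroups\<close>

text \<open>The value at \<open>t\<close> has to be the power with exponent \<open>n\<close> of the
  value at \<open>t / n\<close>, for any \<open>n\<close> that brings \<open>t / n\<close> into the
  given interval. The work lies in the independence of \<open>n\<close>; additivity is then checked
  with one common \<open>n\<close> for \<open>s\<close>, \<open>t\<close> and
  \<open>s + t\<close>.\<close>

lemma (in group) extend_local_hom:
  fixes \<gamma>0 :: "real \<Rightarrow> 'a"
  assumes d: "\<delta> > 0" and car: "\<And>t. \<bar>t\<bar> \<le> \<delta> \<Longrightarrow> \<gamma>0 t \<in> carrier G"
    and hom: "\<And>s t. \<bar>s\<bar> \<le> \<delta> \<Longrightarrow> \<bar>t\<bar> \<le> \<delta> \<Longrightarrow> \<gamma>0 (s + t) = \<gamma>0 s \<otimes> \<gamma>0 t"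
  shows "\<exists>\<gamma>. (\<forall>t. \<gamma> t \<in> carrier G) \<and> (\<forall>s t. \<gamma> (s + t) = \<gamma> s \<otimes> \<gamma> t) \<and> (\<forall>t. \<bar>t\<bar> \<le> \<delta> \<longrightarrow> \<gamma> t = \<gamma>0 t)"
proof -
  have one: "\<gamma>0 0 = \<one>"
    using hom[of 0 0] car[of 0] d by simp
  have pw: "\<gamma>0 (real k * s) = \<gamma>0 s [^] k" if "\<bar>real k * s\<bar> \<le> \<delta>" for k s
    using that
  proof (induction k)
    case 0
    then show ?case by (simp add: one)
  next
    case (Suc k)
    have "\<bar>real k * s\<bar> \<le> \<bar>real (Suc k) * s\<bar>" "\<bar>s\<bar> \<le> \<bar>real (Suc k) * s\<bar>"
      by (auto simp: abs_mult intro!: mult_right_mono mult_le_cancel_right1[THEN iffD2])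
    then have "\<bar>real k * s\<bar> \<le> \<delta>" "\<bar>s\<bar> \<le> \<delta>" using Suc.prems by linarith+
    then have "\<gamma>0 (real k * s + s) = \<gamma>0 s [^] k \<otimes> \<gamma>0 s" using hom Suc.IH by simp
    then show ?case by (simp add: distrib_right add.commute)
  qed
  \<comment> \<open>The successor keeps the exponent positive for \<open>t = 0\<close>.\<close>
  define N where "N = (\<lambda>t. Suc (nat \<lceil>\<bar>t\<bar> / \<delta>\<rceil>))"
  define \<gamma> where "\<gamma> = (\<lambda>t. \<gamma>0 (t / real (N t)) [^] N t)"
  have N: "\<bar>t\<bar> \<le> real (N t) * \<delta>" for t
  proof -
    have "\<bar>t\<bar> / \<delta> \<le> real (N t)" unfolding N_def using real_nat_ceiling_ge[of "\<bar>t\<bar> / \<delta>"] by simp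
    then show ?thesis using d by (simp add: field_simps)
  qed
  have small: "\<bar>t / real n\<bar> \<le> \<delta>" if "\<bar>t\<bar> \<le> real n * \<delta>" "n > 0" for t n
    using that by (simp add: field_simps)
  have indep: "\<gamma> t = \<gamma>0 (t / real n) [^] n" if n: "n > 0" "\<bar>t\<bar> \<le> real n * \<delta>" for t n
  proof -
    \<comment> \<open>Passing from \<open>k\<close> to a multiple \<open>k * l\<close> does not
      change the power. Two admissible exponents are then compared through their product.\<close>
    have key: "\<gamma>0 (t / real k) [^] k = \<gamma>0 (t / real (k * l)) [^] (k * l)"
        if k: "k > 0" "l > 0" "\<bar>t\<bar> \<le> real k * \<delta>" for k l
    proof -
      have e: "real l * (t / real (k * l)) = t / real k" using k by simp
      have s: "\<bar>t / real k\<bar> \<le> \<delta>" by (rule small[OF k(3,1)])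
      have "\<bar>t / real (k * l)\<bar> \<le> \<bar>t / real k\<bar>"
      proof -
        have "\<bar>t\<bar> / (real k * real l) \<le> \<bar>t\<bar> / real k"
          using k by (intro divide_left_mono) (auto simp: mult_le_cancel_left1 Suc_le_eq)
        then show ?thesis by (simp add: abs_divide)
      qed
      then have "\<gamma>0 (t / real (k * l)) \<in> carrier G" using s by (intro car) linarith
      then show ?thesis
        using pw[of l "t / real (k * l)"] s unfolding e by (simp add: nat_pow_pow mult.commute)
    qed
    show ?thesis
      using key[of "N t" n] key[of n "N t"] n N[of t] by (simp add: \<gamma>_def mult.commute N_def)
  qed
  have "\<gamma> t \<in> carrier G" for t
    unfolding \<gamma>_def by (rule nat_pow_closed[OF car[OF small[OF N]]]) (simp add: N_def)
  moreover have "\<gamma> (s + t) = \<gamma> s \<otimes> \<gamma> t" for s t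
  proof -
    define n where "n = N s + N t"
    have n: "n > 0" "\<bar>s\<bar> + \<bar>t\<bar> \<le> real n * \<delta>" using N[of s] N[of t]
        by (auto simp: n_def N_def distrib_right)
    have st: "\<bar>s\<bar> \<le> real n * \<delta>" "\<bar>t\<bar> \<le> real n * \<delta>" "\<bar>s + t\<bar> \<le> real n * \<delta>" using n(2) by linarith+
    note sm = small[OF st(1) n(1)] small[OF st(2) n(1)]
    \<comment> \<open>The two values commute since addition of reals does, although the group need
      not be commutative; so the power of their product is the product of their powers.\<close>
    have "\<gamma>0 (s / real n) \<otimes> \<gamma>0 (t / real n) = \<gamma>0 (t / real n) \<otimes> \<gamma>0 (s / real n)"
      using hom[OF sm] hom[OF sm(2,1)] by (simp add: add.commute)
    from pow_mult_distrib[OF this car[OF sm(1)] car[OF sm(2)], of n]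
    show ?thesis
      using hom[OF sm] by (simp add: indep[OF n(1) st(1)] indep[OF n(1) st(2)] indep[OF n(1) st(3)]
          add_divide_distrib)
  qed
  moreover have "\<gamma> t = \<gamma>0 t" if "\<bar>t\<bar> \<le> \<delta>" for t
    using indep[of 1 t] car[OF that] that by simp
  ultimately show ?thesis by blast
qed

text \<open>One chart around the unit is fixed. In it the multiplication is the map
  \<open>mul\<close>, smooth on the open set \<open>mul_dom\<close>, and left-invariant fields
  become ordinary vector fields on the model space.\<close>

locale lie_group_chart =
  fixes G :: "'g monoid" (structure) and L :: "('g, 'k::real_normed_vector) manifold"
    and c :: "('g, 'k) chart" and n :: nat and b :: "nat \<Rightarrow> 'k" and w :: "nat \<Rightarrow> 'k \<Rightarrow> real"
  assumes lie: "lie_group G L" and c: "c \<in> charts_at L \<one>" and coords: "coordinates n b w"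
begin

definition unit_coord :: 'k where "unit_coord = snd c \<one>"

definition coord_dom :: "'k set" where "coord_dom = snd c ` chart_dom c"

definition mul :: "'k \<times> 'k \<Rightarrow> 'k" where
  "mul z = snd c (chart_inv c (fst z) \<otimes> chart_inv c (snd z))"

definition mul_dom :: "('k \<times> 'k) set" where
  "mul_dom = {z \<in> coord_dom \<times> coord_dom. chart_inv c (fst z) \<otimes> chart_inv c (snd z) \<in> chart_dom c}"

text \<open>The derivative at the unit of left translation by \<open>x\<close>, applied to \<xi>:
  the coordinate expression of the left-invariant field generated by \<xi>.\<close>

definition left_invariant_field :: "'k \<Rightarrow> 'k \<Rightarrow> 'k" where
  "left_invariant_field \<xi> x = fderiv mul (x, unit_coord) (0, \<xi>)"

section \<open>The multiplication in the chart and left-invariant fields\<close>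

lemma group_G: "group G" using lie by (simp add: lie_group_def)

sublocale group G by (rule group_G)

lemma atlas_L: "smooth_atlas L"
  using lie smooth_manifold_atlas by (auto simp: lie_group_def)

lemma points_L: "points L = carrier G"
  using lie by (simp add: lie_group_def)

lemma c_atlas: "c \<in> atlas L" and one_dom: "\<one> \<in> chart_dom c"
  using c by (auto simp: charts_at_iff)

lemma coord_dom_open: "open coord_dom"
  unfolding coord_dom_def by (rule chart_open[OF atlas_L c_atlas])

lemma chart_inv_dom: "x \<in> coord_dom \<Longrightarrow> chart_inv c x \<in> chart_dom c"
  unfolding coord_dom_def by (rule chart_inv_in)

lemma chart_inv_carrier: "x \<in> coord_dom \<Longrightarrow> chart_inv c x \<in> carrier G"
  using chart_inv_dom chart_dom_subset[OF atlas_L c_atlas] points_L by blast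

lemma chart_chart_inv_coord: "x \<in> coord_dom \<Longrightarrow> snd c (chart_inv c x) = x"
  unfolding coord_dom_def by (rule chart_chart_inv)

lemma chart_inv_coord: "a \<in> chart_dom c \<Longrightarrow> chart_inv c (snd c a) = a"
  by (rule chart_inv_chart[OF atlas_L c_atlas])

lemma coord_in: "a \<in> chart_dom c \<Longrightarrow> snd c a \<in> coord_dom"
  by (simp add: coord_dom_def)

lemma unit_in: "unit_coord \<in> coord_dom"
  unfolding unit_coord_def by (rule coord_in[OF one_dom])

lemma chart_inv_unit: "chart_inv c unit_coord = \<one>"
  unfolding unit_coord_def by (rule chart_inv_coord[OF one_dom])

lemma mul_dom_eq: "mul_dom = rep_dom (prod_chart c c) c (\<lambda>(a, b). a \<otimes> b)"
proof (intro subset_antisym subsetI)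
  fix z assume "z \<in> mul_dom"
  then obtain x y where z: "z = (x, y)" "x \<in> coord_dom" "y \<in> coord_dom"
      "chart_inv c x \<otimes> chart_inv c y \<in> chart_dom c"
    by (auto simp: mul_dom_def)
  then have "z = snd (prod_chart c c) (chart_inv c x, chart_inv c y)"
      by (simp add: chart_chart_inv_coord)
  moreover have "(chart_inv c x, chart_inv c y) \<in> chart_dom (prod_chart c c) \<inter> (\<lambda>(a, b). a \<otimes> b)
      -` chart_dom c"
    using z chart_inv_dom by simp
  ultimately show "z \<in> rep_dom (prod_chart c c) c (\<lambda>(a, b). a \<otimes> b)" by blast
next
  fix z assume "z \<in> rep_dom (prod_chart c c) c (\<lambda>(a, b). a \<otimes> b)"
  then obtain p q where "p \<in> chart_dom c" "q \<in> chart_dom c" "p \<otimes> q \<in> chart_dom c"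
      "z = (snd c p, snd c q)" by auto
  then show "z \<in> mul_dom" by (simp add: mul_dom_def coord_in chart_inv_coord)
qed

lemma smooth_mult: "smooth_map (prod_manifold L L) L (\<lambda>(a, b). a \<otimes> b)"
  using lie by (simp add: lie_group_def)

lemma mul_dom_open: "open mul_dom" and mul_smooth: "smooth_on mul_dom mul"
proof -
  have k: "prod_chart c c \<in> atlas (prod_manifold L L)" unfolding atlas_prod using c_atlas by blast
  show o: "open mul_dom" unfolding mul_dom_eq
    by (rule rep_dom_open[OF smooth_atlas_prod[OF atlas_L atlas_L] atlas_L smooth_mult k c_atlas])
  show "smooth_on mul_dom mul"
  proof (rule smooth_on_cong[OF o])
    show "smooth_on mul_dom (local_rep (prod_chart c c) c (\<lambda>(a, b). a \<otimes> b))"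
      unfolding mul_dom_eq by (rule local_rep_smooth[OF smooth_mult k c_atlas])
    fix z assume "z \<in> mul_dom"
    then obtain x y where z: "z = (x, y)" "x \<in> coord_dom" "y \<in> coord_dom"
        by (auto simp: mul_dom_def)
    show "local_rep (prod_chart c c) c (\<lambda>(a, b). a \<otimes> b) z = mul z"
      using chart_inv_prod[OF atlas_L atlas_L c_atlas c_atlas z(2,3)[unfolded coord_dom_def]]
          by (simp add: z(1) mul_def)
  qed
qed

lemma mul_domD:
  assumes "(x, y) \<in> mul_dom"
  shows "x \<in> coord_dom" "y \<in> coord_dom" "mul (x, y) \<in> coord_dom"
      "chart_inv c (mul (x, y)) = chart_inv c x \<otimes> chart_inv c y"
  using assms by (auto simp: mul_dom_def mul_def coord_in chart_inv_coord)

lemma mul_unit_right: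
  assumes "x \<in> coord_dom"
  shows "(x, unit_coord) \<in> mul_dom" "mul (x, unit_coord) = x"
  using assms by (auto simp: mul_dom_def mul_def unit_in chart_inv_unit chart_inv_carrier
      chart_inv_dom chart_chart_inv_coord)

lemma mul_unit_left:
  assumes "x \<in> coord_dom"
  shows "(unit_coord, x) \<in> mul_dom" "mul (unit_coord, x) = x"
  using assms by (auto simp: mul_dom_def mul_def unit_in chart_inv_unit chart_inv_carrier
      chart_inv_dom chart_chart_inv_coord)

text \<open>Only the inner products have to lie in the chart. The triple product may leave it: both
  sides are then still \<open>snd c\<close> of the same group element.\<close>

lemma mul_assoc:
  assumes "(x, y) \<in> mul_dom" "(y, z) \<in> mul_dom"
  shows "mul (mul (x, y), z) = mul (x, mul (y, z))"
  using mul_domD[OF assms(1)] mul_domD[OF assms(2)]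
  by (simp add: mul_def[of "(mul (x, y), z)"] mul_def[of
      "(x, mul (y, z))"] m_assoc chart_inv_carrier)

lemma mul_has_vector_derivative:
  assumes "(x, h t) \<in> mul_dom" "(h has_vector_derivative \<eta>) (at t)"
  shows "((\<lambda>s. mul (x, h s)) has_vector_derivative fderiv mul (x, h t) (0, \<eta>)) (at t)"
proof -
  have d: "mul differentiable (at (x, h t))" by (rule smooth_on_differentiable[OF mul_smooth
      assms(1)])
  have "((\<lambda>s. (x, h s)) has_derivative (\<lambda>r. (0, r *\<^sub>R \<eta>))) (at t)"
    using assms(2) by (intro has_derivative_Pair has_derivative_const)
        (simp add: has_vector_derivative_def)
  from has_derivative_compose[OF this fderiv_has[OF d]]
  have "((\<lambda>s. mul (x, h s)) has_derivative (\<lambda>r. fderiv mul (x, h t) (r *\<^sub>R (0, \<eta>)))) (at t)" by simp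
  then show ?thesis
    unfolding has_vector_derivative_def linear_scale[OF linear_fderiv[OF d]] .
qed

lemma left_invariant_field_smooth: "smooth_on coord_dom (left_invariant_field \<xi>)"
proof -
  have "smooth_on coord_dom (\<lambda>x. (x, unit_coord))"
    by (rule smooth_on_Pair[OF coord_dom_open smooth_on_ident smooth_on_const])
  from smooth_on_compose[OF coordinates_prod[OF coords coords] coord_dom_open mul_dom_open _ this
      smooth_on_fderiv[OF mul_smooth, of "(0, \<xi>)"]]
  show ?thesis using mul_unit_right(1) by (simp add: left_invariant_field_def[abs_def]
      image_subset_iff)
qed

text \<open>Left translation by the unit is the identity; both descriptions of one curve are
  differentiated at time 0.\<close>

lemma left_invariant_field_unit: "left_invariant_field \<xi> unit_coord = \<xi>"
proof -
  let ?h = "\<lambda>s::real. unit_coord + s *\<^sub>R \<xi>"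
  have h: "(?h has_vector_derivative \<xi>) (at 0)" by (auto intro!: derivative_eq_intros)
  have "((\<lambda>s. mul (unit_coord, ?h s)) has_vector_derivative left_invariant_field \<xi> unit_coord)
      (at 0)"
    using mul_has_vector_derivative[of unit_coord ?h 0, OF _ h] mul_unit_right(1)[OF unit_in]
        by (simp add: left_invariant_field_def)
  moreover have "((\<lambda>s. mul (unit_coord, ?h s)) has_vector_derivative \<xi>) (at 0)"
  proof (rule has_vector_derivative_transform_within_open[OF h])
    show "open (?h -` coord_dom)" by (rule open_vimage[OF coord_dom_open]) (intro continuous_intros)
  qed (auto simp: unit_in mul_unit_left)
  ultimately show ?thesis by (rule vector_derivative_unique_at)
qed

text \<open>Obtained by differentiating \<open>mul_assoc\<close> with respect to the third factor at
  the unit.\<close>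

lemma left_invariant_field_invariant:
  assumes xy: "(x, y) \<in> mul_dom"
  shows "left_invariant_field \<xi> (mul (x, y)) = fderiv mul (x, y) (0, left_invariant_field \<xi> y)"
proof -
  let ?h = "\<lambda>s::real. unit_coord + s *\<^sub>R \<xi>"
  note D = mul_domD[OF xy]
  have h: "(?h has_vector_derivative \<xi>) (at 0)" by (auto intro!: derivative_eq_intros)
  have 1: "((\<lambda>s. mul (mul (x, y), ?h s)) has_vector_derivative left_invariant_field \<xi> (mul (x, y)))
      (at 0)"
    using mul_has_vector_derivative[of "mul (x, y)" ?h 0, OF _ h] mul_unit_right(1)[OF D(3)]
        by (simp add: left_invariant_field_def)
  have 2: "((\<lambda>s. mul (y, ?h s)) has_vector_derivative left_invariant_field \<xi> y) (at 0)"
    using mul_has_vector_derivative[of y ?h 0, OF _ h] mul_unit_right(1)[OF D(2)]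
        by (simp add: left_invariant_field_def)
  have 3: "((\<lambda>s. mul (x, mul (y, ?h s))) has_vector_derivative fderiv mul (x, y)
      (0, left_invariant_field \<xi> y)) (at 0)"
    using mul_has_vector_derivative[of x "\<lambda>s. mul (y, ?h s)" 0, OF _ 2]
        xy mul_unit_right(2)[OF D(2)] by simp
  let ?T = "(\<lambda>s. (y, ?h s)) -` mul_dom"
  have "((\<lambda>s. mul (x, mul (y, ?h s))) has_vector_derivative left_invariant_field \<xi> (mul (x, y)))
      (at 0)"
  proof (rule has_vector_derivative_transform_within_open[OF 1])
    show "open ?T" by (rule open_vimage[OF mul_dom_open]) (intro continuous_intros)
    show "0 \<in> ?T" using mul_unit_right(1)[OF D(2)] by simp
    show "mul (mul (x, y), ?h s) = mul (x, mul (y, ?h s))" if "s \<in> ?T" for s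
      using that by (intro mul_assoc[OF xy]) simp
  qed
  from vector_derivative_unique_at[OF this 3] show ?thesis .
qed

section \<open>One-parameter subgroups as integral curves of left-invariant fields\<close>

lemma one_parameter_subgroupD:
  assumes "one_parameter_subgroup G L \<gamma>"
  shows "smooth_map real_line L \<gamma>" "\<gamma> (s + t) = \<gamma> s \<otimes> \<gamma> t" "\<gamma> t \<in> carrier G" "\<gamma> 0 = \<one>"
proof -
  show 1: "smooth_map real_line L \<gamma>" and 2: "\<gamma> (s + t) = \<gamma> s \<otimes> \<gamma> t" for s t
    using assms by (auto simp: one_parameter_subgroup_def)
  show 3: "\<gamma> t \<in> carrier G" for t using smooth_map_points[OF 1, of t]
      by (simp add: points_real_line points_L)
  show "\<gamma> 0 = \<one>" using 2[of 0 0] 3[of 0] by simp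
qed

lemma one_parameter_subgroup_pow:
  assumes "one_parameter_subgroup G L \<gamma>"
  shows "\<gamma> (real k * s) = \<gamma> s [^] k"
  by (induction k)
    (simp_all add: one_parameter_subgroupD[OF assms] distrib_right add.commute[of 1]
        one_parameter_subgroupD(2)[OF assms, symmetric] add.commute[of s])

text \<open>Differentiate the homomorphism property at \<open>t + s\<close> with respect to
  \<open>s\<close> at 0, then shift the time back by \<open>t\<close>.\<close>

lemma one_parameter_subgroup_ode:
  assumes g: "one_parameter_subgroup G L \<gamma>" and t: "\<gamma> t \<in> chart_dom c"
  shows "((\<lambda>s. snd c (\<gamma> s)) has_vector_derivative left_invariant_field (velocity L \<gamma> 0 c)
      (snd c (\<gamma> t))) (at t)"
proof -
  note D = one_parameter_subgroupD[OF g]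
  let ?v = "\<lambda>s. snd c (\<gamma> s)"
  have v0: "?v 0 = unit_coord" by (simp add: D(4) unit_coord_def)
  have "(?v has_vector_derivative velocity L \<gamma> 0 c) (at 0)"
    by (rule velocity_has_vector_derivative[OF atlas_L D(1)]) (simp add: D(4) c)
  from mul_has_vector_derivative[of "?v t" ?v 0, OF _ this]
  have 1: "((\<lambda>s. mul (?v t, ?v s)) has_vector_derivative left_invariant_field (velocity L \<gamma> 0 c)
      (?v t)) (at 0)"
    using mul_unit_right(1)[OF coord_in[OF t]] by (simp add: v0 left_invariant_field_def)
  let ?T0 = "{s. \<gamma> s \<in> chart_dom c}"
  have oT: "open ?T0" using smooth_curve_open[OF atlas_L D(1) c_atlas open_UNIV] by simp
  let ?T = "?T0 \<inter> (\<lambda>s. t + s) -` ?T0"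
  have "((\<lambda>s. ?v (t + s)) has_vector_derivative left_invariant_field (velocity L \<gamma> 0 c) (?v t))
      (at 0)"
  proof (rule has_vector_derivative_transform_within_open[OF 1])
    show "open ?T" by (intro open_Int oT open_vimage continuous_intros)
    show "0 \<in> ?T" using t by (simp add: D(4) one_dom)
    show "mul (?v t, ?v s) = ?v (t + s)" if "s \<in> ?T" for s
      using that t by (simp add: mul_def chart_inv_coord D(2))
  qed
  moreover have "((\<lambda>r. r - t) has_vector_derivative 1) (at t)"
      by (auto intro!: derivative_eq_intros)
  ultimately show ?thesis
    using vector_diff_chain_at[of "\<lambda>r. r - t" 1 t "\<lambda>s. ?v (t + s)"] by (simp add: o_def)
qed

lemma open_zero_interval:
  assumes "open T" "(0::real) \<in> T"
  shows "\<exists>\<delta>>0. \<forall>s. \<bar>s\<bar> < \<delta> \<longrightarrow> s \<in> T"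
proof -
  obtain \<delta> where "\<delta> > 0" "ball 0 \<delta> \<subseteq> T" using assms open_contains_ball by blast
  then show ?thesis by (intro exI[of _ \<delta>]) (auto simp: subset_iff dist_real_def)
qed

text \<open>Near 0 both curves stay in the chart and solve the same differential equation with the
  same initial value. Powers carry the agreement from a neighbourhood of 0 to all times.\<close>

lemma one_parameter_subgroup_unique:
  assumes g: "one_parameter_subgroup G L \<gamma>" and h: "one_parameter_subgroup G L \<eta>"
    and v: "velocity L \<gamma> 0 = velocity L \<eta> 0"
  shows "\<gamma> = \<eta>"
proof
  fix t
  let ?V = "left_invariant_field (velocity L \<eta> 0 c)"
  obtain r K where r: "r > 0" "K \<ge> 0" "cball unit_coord r \<subseteq> coord_dom"
    "\<And>x y. x \<in> cball unit_coord r \<Longrightarrow> y \<in> cball unit_coord r \<Longrightarrow> norm (?V x - ?V y) \<le> K * norm (x - y)"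
    using smooth_on_locally_lipschitz[OF coords coord_dom_open unit_in left_invariant_field_smooth]
        by blast
  have nb: "\<exists>\<delta>>0. \<forall>s. \<bar>s\<bar> < \<delta> \<longrightarrow> \<sigma> s \<in> chart_dom c \<and> snd c (\<sigma> s) \<in> ball unit_coord r"
    if "one_parameter_subgroup G L \<sigma>" for \<sigma>
  proof -
    note D = one_parameter_subgroupD[OF that]
    have "open {s. \<sigma> s \<in> chart_dom c \<and> snd c (\<sigma> s) \<in> ball unit_coord r}"
      by (rule smooth_curve_open[OF atlas_L D(1) c_atlas open_ball])
    from open_zero_interval[OF this] show ?thesis using r(1)
        by (simp add: D(4) one_dom unit_coord_def)
  qed
  obtain d1 d2 where d: "d1 > 0" "d2 > 0"
    "\<And>s. \<bar>s\<bar> < d1 \<Longrightarrow> \<gamma> s \<in> chart_dom c \<and> snd c (\<gamma> s) \<in> ball unit_coord r"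
    "\<And>s. \<bar>s\<bar> < d2 \<Longrightarrow> \<eta> s \<in> chart_dom c \<and> snd c (\<eta> s) \<in> ball unit_coord r"
    using nb[OF g] nb[OF h] by metis
  \<comment> \<open>The halves keep both curves in the chart and in the Lipschitz ball on the closed
    interval; the last bound is the one required by \<open>ode_unique\<close>.\<close>
  define \<tau> where "\<tau> = min (d1 / 2) (min (d2 / 2) (1 / (2 * (K + 1))))"
  have \<tau>: "\<tau> > 0" "\<tau> < d1" "\<tau> < d2" using d r(2) by (auto simp: \<tau>_def)
  have "K * \<tau> \<le> K * (1 / (2 * (K + 1)))" using r(2) by (intro mult_left_mono) (auto simp: \<tau>_def)
  also have "\<dots> \<le> 1 / 2" using r(2) by (simp add: field_simps)
  finally have K\<tau>: "K * \<tau> \<le> 1 / 2" .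
  have eq: "\<gamma> s = \<eta> s" if s: "\<bar>s\<bar> \<le> \<tau>" for s
  proof -
    have "snd c (\<gamma> s) = snd c (\<eta> s)"
    proof (rule ode_unique[OF r(2) K\<tau> _ r(4), where v = "\<lambda>s. snd c (\<gamma> s)"
        and w = "\<lambda>s. snd c (\<eta> s)"])
      show "snd c (\<gamma> s) \<in> cball unit_coord r \<and> ((\<lambda>s. snd c (\<gamma> s)) has_vector_derivative ?V (snd c (\<gamma>
          s))) (at s)"
        if "\<bar>s\<bar> \<le> \<tau>" for s
        using d(3)[of s] that \<tau> one_parameter_subgroup_ode[OF g, of s] v by auto
      show "snd c (\<eta> s) \<in> cball unit_coord r \<and> ((\<lambda>s. snd c (\<eta> s)) has_vector_derivative ?V (snd c (\<eta>
          s))) (at s)"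
        if "\<bar>s\<bar> \<le> \<tau>" for s
        using d(4)[of s] that \<tau> one_parameter_subgroup_ode[OF h, of s] by auto
    qed (use s \<tau> one_parameter_subgroupD(4)[OF g] one_parameter_subgroupD(4)[OF h] in auto)
    then show ?thesis
      using d(3)[of s] d(4)[of s] s \<tau> chart_inj[OF atlas_L c_atlas] by (auto simp: inj_on_def)
  qed
  \<comment> \<open>So large that \<open>t / k\<close> lies in the interval of agreement;
    \<open>t\<close> is then reached by a power with exponent \<open>k\<close>.\<close>
  define k where "k = Suc (nat \<lceil>\<bar>t\<bar> / \<tau>\<rceil>)"
  have "\<bar>t\<bar> / \<tau> \<le> real k" unfolding k_def using real_nat_ceiling_ge[of "\<bar>t\<bar> / \<tau>"] by simp
  moreover have "real k > 0" by (simp add: k_def)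
  ultimately have "\<bar>t / real k\<bar> \<le> \<tau>" using \<tau>(1) by (simp add: field_simps)
  from eq[OF this] one_parameter_subgroup_pow[OF g, of k
      "t / real k"] one_parameter_subgroup_pow[OF h, of k "t / real k"]
  show "\<gamma> t = \<eta> t" by (simp add: k_def)
qed

text \<open>For fixed \<open>s\<close>, the shifted solution and its left translate by
  \<open>u s\<close> both solve the equation, the latter by left invariance. They agree at time 0,
  and uniqueness gives the local homomorphism property.\<close>

lemma local_one_parameter_subgroup:
  "\<exists>\<delta>>0. \<exists>u. u 0 = unit_coord \<and>
     (\<forall>t. \<bar>t\<bar> \<le> 2 * \<delta> \<longrightarrow> u t \<in> coord_dom \<and> (u has_vector_derivative left_invariant_field \<xi> (u t))
         (at t)) \<and>
     (\<forall>s t. \<bar>s\<bar> \<le> \<delta> \<longrightarrow> \<bar>t\<bar> \<le> \<delta> \<longrightarrow> (u s, u t) \<in> mul_dom \<and> u (s + t) = mul (u s, u t))"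
proof -
  let ?V = "left_invariant_field \<xi>"
  obtain r K where r: "r > 0" "K \<ge> 0" "cball unit_coord r \<subseteq> coord_dom"
    and lip: "\<And>x y. x \<in> cball unit_coord r \<Longrightarrow> y \<in> cball unit_coord r \<Longrightarrow>
        norm (?V x - ?V y) \<le> K * norm (x - y)"
    using smooth_on_locally_lipschitz[OF coords coord_dom_open unit_in left_invariant_field_smooth]
        by blast
  obtain \<tau> u where \<tau>: "\<tau> > 0" and u0: "u 0 = unit_coord"
    and u: "\<And>t. \<bar>t\<bar> < \<tau> \<Longrightarrow> u t \<in> cball unit_coord r \<and> (u has_vector_derivative ?V (u t)) (at t)"
    using ode_solution[OF coords r(1,2) lip] by blast
  \<comment> \<open>Products have to remain in the ball where the Lipschitz bound holds, because
    \<open>ode_unique\<close> is applied to a translated curve.\<close>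
  let ?Z = "{z \<in> mul_dom. mul z \<in> ball unit_coord r}"
  have Z: "open ?Z" by (rule open_smooth_preimage[OF mul_smooth mul_dom_open open_ball])
  have "(unit_coord, unit_coord) \<in> ?Z" using mul_unit_right[OF unit_in] r(1) by simp
  then obtain A B where "open A" "open B" "(unit_coord, unit_coord) \<in> A \<times> B" "A \<times> B \<subseteq> ?Z"
    by (rule open_prod_elim[OF Z])
  then have AB: "open A" "open B" "unit_coord \<in> A" "unit_coord \<in> B" "A \<times> B \<subseteq> ?Z" by auto
  have "smooth_on {-\<tau><..<\<tau>} u"
    by (rule ode_solution_smooth[OF coords coord_dom_open left_invariant_field_smooth[of \<xi>]])
        (use u r(3) in auto)
  from open_smooth_preimage[OF this open_greaterThanLessThan open_Int[OF AB(1,2)]]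
  obtain d where d: "d > 0" "\<And>s. \<bar>s\<bar> < d \<Longrightarrow> u s \<in> A \<inter> B"
    using open_zero_interval[of "{t \<in> {-\<tau><..<\<tau>}. u t \<in> A \<inter> B}"] \<tau> AB u0 by auto
  \<comment> \<open>\<open>\<tau> / 3\<close> leaves room for sums of two times before the solution
    ends, \<open>d / 2\<close> keeps products in \<open>?Z\<close>, and the last bound is for
    \<open>ode_unique\<close>.\<close>
  define \<delta> where "\<delta> = min (\<tau> / 3) (min (d / 2) (1 / (2 * (K + 1))))"
  have \<delta>: "\<delta> > 0" "2 * \<delta> < \<tau>" "\<delta> < d" using \<tau> d r(2) by (auto simp: \<delta>_def)
  have "K * \<delta> \<le> K * (1 / (2 * (K + 1)))" using r(2) by (intro mult_left_mono) (auto simp: \<delta>_def)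
  also have "\<dots> \<le> 1 / 2" using r(2) by (simp add: field_simps)
  finally have K\<delta>: "K * \<delta> \<le> 1 / 2" .
  have inZ: "(u s, u t) \<in> mul_dom" "mul (u s, u t) \<in> cball unit_coord r" if "\<bar>s\<bar> \<le> \<delta>" "\<bar>t\<bar> \<le> \<delta>"
      for s t
  proof -
    have "(u s, u t) \<in> ?Z" using d(2)[of s] d(2)[of t] that \<delta> AB(5) by auto
    then show "(u s, u t) \<in> mul_dom" "mul (u s, u t) \<in> cball unit_coord r" by auto
  qed
  have "u (s + t) = mul (u s, u t)" if s: "\<bar>s\<bar> \<le> \<delta>" and t: "\<bar>t\<bar> \<le> \<delta>" for s t
  proof (rule ode_unique[OF r(2) K\<delta> _ lip, where v = "\<lambda>t. u (s + t)" and w = "\<lambda>t. mul (u s, u t)"])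
    fix t assume t: "\<bar>t\<bar> \<le> \<delta>"
    have st: "\<bar>s + t\<bar> < \<tau>" using s t \<delta> by linarith
    have "((\<lambda>t. s + t) has_vector_derivative 1) (at t)" by (auto intro!: derivative_eq_intros)
    from vector_diff_chain_at[OF this conjunct2[OF u[OF st]]]
    show "u (s + t) \<in> cball unit_coord r \<and> ((\<lambda>t. u (s + t)) has_vector_derivative ?V (u (s
        + t))) (at t)"
      using u[OF st] by (simp add: o_def)
    have "(u has_vector_derivative ?V (u t)) (at t)" using u t \<delta> by auto
    from mul_has_vector_derivative[of "u s" u t, OF inZ(1)[OF s t] this]
    show "mul (u s, u t) \<in> cball unit_coord r \<and> ((\<lambda>t. mul (u s, u t)) has_vector_derivative ?V (mul
        (u s, u t))) (at t)"
      using inZ(2)[OF s t] left_invariant_field_invariant[OF inZ(1)[OF s t]] by simp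
  next
    have "u s \<in> coord_dom" using u[of s] s \<delta> r(3) by auto
    then show "u (s + 0) = mul (u s, u 0)" by (simp add: u0 mul_unit_right)
  qed (use \<delta> t in auto)
  moreover have "u t \<in> coord_dom \<and> (u has_vector_derivative ?V (u t)) (at t)" if "\<bar>t\<bar> \<le> 2 * \<delta>" for t
    using u[of t] that \<delta> r(3) by auto
  ultimately show ?thesis using \<delta>(1) u0 inZ(1) by blast
qed

lemma smooth_left_mult: "a \<in> carrier G \<Longrightarrow> smooth_map L L (\<lambda>x. a \<otimes> x)"
  using smooth_map_compose[OF atlas_L smooth_atlas_prod[OF atlas_L atlas_L] atlas_L
      smooth_map_pair[OF atlas_L atlas_L atlas_L smooth_map_const[OF atlas_L atlas_L, of a]
          smooth_map_ident[OF atlas_L]]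
      smooth_mult]
  by (simp add: points_L)

text \<open>The local solution is multiplicative for small times and extends to all times by powers.
  The extension says nothing about smoothness away from 0; there the curve is a left translate of
  its part near 0.\<close>

lemma one_parameter_subgroup_exists:
  assumes X: "X \<in> lie_algebra G L"
  shows "\<exists>\<gamma>. one_parameter_subgroup G L \<gamma> \<and> velocity L \<gamma> 0 = X"
proof -
  have X1: "X \<in> tangent_space L \<one>" using X by (simp add: lie_algebra_def)
  obtain \<delta> u where \<delta>: "\<delta> > 0" and u0: "u 0 = unit_coord"
    and u: "\<And>t. \<bar>t\<bar> \<le> 2 * \<delta> \<Longrightarrow> u t \<in> coord_dom \<and> (u has_vector_derivative left_invariant_field (X c)
        (u t)) (at t)"
    and um: "\<And>s t. \<bar>s\<bar> \<le> \<delta> \<Longrightarrow> \<bar>t\<bar> \<le> \<delta> \<Longrightarrow> (u s, u t) \<in> mul_dom \<and> u (s + t) = mul (u s, u t)"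
    using local_one_parameter_subgroup[of "X c"] by blast
  have "\<exists>\<gamma>. (\<forall>t. \<gamma> t \<in> carrier G) \<and> (\<forall>s t. \<gamma> (s + t) = \<gamma> s \<otimes> \<gamma> t) \<and> (\<forall>t. \<bar>t\<bar> \<le> \<delta> \<longrightarrow>
      \<gamma> t = chart_inv c (u t))"
  proof (rule extend_local_hom[OF \<delta>])
    show "chart_inv c (u t) \<in> carrier G" if "\<bar>t\<bar> \<le> \<delta>" for t
      using u[of t] that \<delta> by (intro chart_inv_carrier) auto
    show "chart_inv c (u (s + t)) = chart_inv c (u s) \<otimes> chart_inv c (u t)" if "\<bar>s\<bar> \<le> \<delta>" "\<bar>t\<bar> \<le> \<delta>"
        for s t
      using um[OF that] mul_domD(4) by simp
  qed
  then obtain \<gamma> where g: "\<And>t. \<gamma> t \<in> carrier G" "\<And>s t. \<gamma> (s + t) = \<gamma> s \<otimes> \<gamma> t" "\<And>t. \<bar>t\<bar> \<le> \<delta> \<Longrightarrow>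
      \<gamma> t = chart_inv c (u t)"
    by blast
  have us: "smooth_on {-\<delta><..<\<delta>} u"
    by (rule ode_solution_smooth[OF coords coord_dom_open left_invariant_field_smooth[of
        "X c"]]) (use u \<delta> in auto)
  have sm: "smooth_map real_line L \<gamma>"
  proof (rule smooth_curveI[OF atlas_L])
    fix t
    have gt: "\<gamma> t \<in> points L" using g(1) points_L by simp
    obtain c' where c': "c' \<in> charts_at L (\<gamma> t)" using chart_at_in[OF atlas_L gt] by blast
    then have c'a: "c' \<in> atlas L" by (simp add: charts_at_iff)
    let ?l = "\<lambda>x. \<gamma> t \<otimes> x"
    note l = smooth_left_mult[OF g(1)[of t]]
    note o = rep_dom_open[OF atlas_L atlas_L l c_atlas c'a]
    let ?T' = "{s \<in> {-\<delta><..<\<delta>}. u s \<in> rep_dom c c' ?l}"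
    have o': "open ?T'" by (rule open_smooth_preimage[OF us open_greaterThanLessThan o])
    let ?T = "(\<lambda>s. s - t) -` ?T'"
    have oT: "open ?T" by (intro open_vimage o' continuous_intros)
    have "\<gamma> t \<otimes> \<one> \<in> chart_dom c'" using c' g(1) by (simp add: charts_at_iff)
    then have "unit_coord \<in> rep_dom c c' ?l" using one_dom by (auto simp: unit_coord_def)
    then have tT: "t \<in> ?T" using \<delta> u0 by simp
    \<comment> \<open>Near \<open>t\<close> the curve is the local solution, shifted in time and
      translated by the fixed element \<open>\<gamma> t\<close>; this makes it smooth there.\<close>
    have e: "\<gamma> s = \<gamma> t \<otimes> chart_inv c (u (s - t))" if "s \<in> ?T" for s
      using g(2)[of t "s - t"] g(3)[of "s - t"] that by auto
    have "smooth_on ?T' (\<lambda>s. local_rep c c' ?l (u s))"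
      by (rule smooth_on_compose[OF coords o' o _ smooth_on_subset[OF us]
          local_rep_smooth[OF l c_atlas c'a]]) auto
    moreover have "smooth_on ?T (\<lambda>s. s - t)"
      using smooth_on_add[OF oT smooth_on_ident smooth_on_const, of "- t"] by simp
    moreover have "coordinates 1 (\<lambda>_. 1) (\<lambda>_ x :: real. x)"
        by (auto simp: coordinates_def bounded_linear_ident)
    ultimately have "smooth_on ?T (\<lambda>s. local_rep c c' ?l (u (s - t)))"
      using smooth_on_compose[OF _ oT o', of 1 "\<lambda>_. 1" "\<lambda>_ x. x" "\<lambda>s. s - t"
          "\<lambda>s. local_rep c c' ?l (u s)"] by auto
    then have "smooth_on ?T (\<lambda>s. snd c' (\<gamma> s))"
      by (rule smooth_on_cong[OF oT, rotated]) (rule arg_cong[OF e, where f = "snd c'", symmetric])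
    moreover have "\<forall>s\<in>?T. \<gamma> s \<in> chart_dom c'"
    proof
      fix s assume s: "s \<in> ?T"
      then have "u (s - t) \<in> rep_dom c c' ?l" by simp
      from rep_dom_inv(2)[OF atlas_L c_atlas this] show "\<gamma> s \<in> chart_dom c'" unfolding e[OF s] .
    qed
    ultimately show "\<exists>c\<in>charts_at L (\<gamma> t). \<exists>T. open T \<and> t \<in> T \<and> (\<forall>s\<in>T. \<gamma> s \<in> chart_dom c)
        \<and> smooth_on T (\<lambda>s. snd c (\<gamma> s))"
      using c' oT tT by blast
  qed
  have op: "one_parameter_subgroup G L \<gamma>" using sm g(2) by (simp add: one_parameter_subgroup_def)
  note D = one_parameter_subgroupD[OF op]
  have "velocity L \<gamma> 0 c = X c"
  proof (rule vector_derivative_unique_at)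
    show "((\<lambda>s. snd c (\<gamma> s)) has_vector_derivative velocity L \<gamma> 0 c) (at 0)"
      by (rule velocity_has_vector_derivative[OF atlas_L sm]) (simp add: D(4) c)
    have "(u has_vector_derivative X c) (at 0)" using u[of 0] \<delta>
        by (simp add: u0 left_invariant_field_unit)
    then show "((\<lambda>s. snd c (\<gamma> s)) has_vector_derivative X c) (at 0)"
      by (rule has_vector_derivative_transform_within_open[of _ _ _ "{-\<delta><..<\<delta>}"])
        (use \<delta> g(3) u chart_chart_inv_coord in auto)
  qed
  moreover have "velocity L \<gamma> 0 \<in> tangent_space L \<one>" using velocity_tangent[OF atlas_L sm, of 0]
      by (simp add: D(4))
  ultimately have "velocity L \<gamma> 0 = X" using tangent_eqI[OF _ X1 c] by blast
  then show ?thesis using op by blast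
qed

text \<open>\<open>lie_exp\<close> is a definite description, so its value at a multiple of
  \<open>X\<close> is known only through uniqueness. The one-parameter subgroup for \<open>t\<close>
  times \<open>X\<close> is \<gamma> with its time scaled by \<open>t\<close>, and at time 1 it is
  at \<open>\<gamma> t\<close>.\<close>

lemma lie_exp_curve:
  assumes X: "X \<in> lie_algebra G L"
  shows "\<exists>\<gamma>. smooth_map real_line L \<gamma> \<and> \<gamma> 0 = \<one> \<and> (\<forall>t. lie_exp G L (\<lambda>c. t *\<^sub>R X c) = \<gamma> t)"
proof -
  obtain \<gamma> where g: "one_parameter_subgroup G L \<gamma>" and v: "velocity L \<gamma> 0 = X"
    using one_parameter_subgroup_exists[OF X] by blast
  note D = one_parameter_subgroupD[OF g]
  have "lie_exp G L (\<lambda>c. t *\<^sub>R X c) = \<gamma> t" for t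
  proof -
    let ?h = "\<lambda>s. \<gamma> (t * s)"
    have "smooth_map real_line real_line (\<lambda>s. t * s)"
      by (rule smooth_curveI[OF smooth_atlas_real_line], intro bexI[of _
          "(UNIV, id)"] exI[of _ UNIV])
        (auto simp: charts_at_real_line intro!: smooth_on_linear bounded_linear_mult_right)
    then have hs: "smooth_map real_line L ?h"
      by (rule smooth_map_compose[OF smooth_atlas_real_line smooth_atlas_real_line atlas_L _ D(1)])
    then have h: "one_parameter_subgroup G L ?h" by (simp add: one_parameter_subgroup_def
        distrib_left D(2))
    have vh: "velocity L ?h 0 = (\<lambda>c. t *\<^sub>R X c)"
    proof
      fix k
      show "velocity L ?h 0 k = t *\<^sub>R X k"
      proof (cases "k \<in> charts_at L (\<gamma> 0)")
        case True
        have "((\<lambda>s. t * s) has_vector_derivative t) (at 0)"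
          by (auto intro!: derivative_eq_intros simp: has_real_derivative_iff_has_vector_derivative[symmetric])
        moreover have "((\<lambda>s. snd k (\<gamma> s)) has_vector_derivative X k) (at (t * 0))"
          using velocity_has_vector_derivative[OF atlas_L D(1) True] v by simp
        ultimately have "((\<lambda>s. snd k (?h s)) has_vector_derivative t *\<^sub>R X k) (at 0)"
          using vector_diff_chain_at[of "\<lambda>s. t * s" t 0 "\<lambda>s. snd k (\<gamma> s)" "X k"]
              by (simp add: o_def)
        then show ?thesis using True by (simp add: velocity_def vector_derivative_at)
      next
        case False
        then show ?thesis using v[symmetric] by (simp add: velocity_def)
      qed
    qed
    show ?thesis
      unfolding lie_exp_def
    proof (rule the_equality)
      show "\<exists>\<gamma>'. one_parameter_subgroup G L \<gamma>' \<and> velocity L \<gamma>' 0 = (\<lambda>c. t *\<^sub>R X c) \<and> \<gamma> t = \<gamma>' 1"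
        using h vh by (intro exI[of _ ?h]) simp
      fix a assume "\<exists>\<gamma>'. one_parameter_subgroup G L \<gamma>' \<and> velocity L \<gamma>' 0 = (\<lambda>c. t *\<^sub>R X c) \<and> a
          = \<gamma>' 1"
      then obtain \<gamma>' where "one_parameter_subgroup G L \<gamma>'" "velocity L \<gamma>' 0 = (\<lambda>c. t *\<^sub>R X c)"
          "a = \<gamma>' 1" by blast
      then show "a = \<gamma> t" using one_parameter_subgroup_unique[OF _ h, of \<gamma>'] vh by simp
    qed
  qed
  then show ?thesis using D(1,4) by blast
qed

end

section \<open>Actions and fundamental vector fields\<close>

lemma smooth_action_map:
  assumes L: "smooth_atlas L" and M: "smooth_atlas M" and act: "smooth_action G L M \<phi>"
      and a: "a \<in> points L"
  shows "smooth_map M M (\<phi> a)"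
proof -
  have "smooth_map (prod_manifold L M) M (\<lambda>(a, p). \<phi> a p)" using act
      by (simp add: smooth_action_def)
  from smooth_map_compose[OF M smooth_atlas_prod[OF L M] M
      smooth_map_pair[OF M L M smooth_map_const[OF M L a] smooth_map_ident[OF M]] this]
  show ?thesis by simp
qed

text \<open>All further use of the exponential map goes through these three facts: they make the
  fundamental field the velocity at \<open>p\<close> of a smooth curve in the orbit.\<close>

lemma exp_orbit:
  fixes L :: "('g, 'k::real_normed_vector) manifold" and M :: "('a, 'e::real_normed_vector)
      manifold"
  assumes lie: "lie_group G L" and M: "smooth_atlas M" and act: "smooth_action G L M \<phi>"
    and X: "X \<in> lie_algebra G L" and p: "p \<in> points M"
  shows "smooth_map real_line M (\<lambda>t. \<phi> (lie_exp G L (\<lambda>c. t *\<^sub>R X c)) p)"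
    and "\<phi> (lie_exp G L (\<lambda>c. 0 *\<^sub>R X c)) p = p"
    and "lie_exp G L (\<lambda>c. t *\<^sub>R X c) \<in> carrier G"
proof -
  have L: "smooth_atlas L" and pL: "points L = carrier G" and G: "group G"
    using lie smooth_manifold_atlas by (auto simp: lie_group_def)
  interpret group G by (rule G)
  interpret group_action G "points M" \<phi> using act by (simp add: smooth_action_def)
  obtain n b and w :: "nat \<Rightarrow> 'k \<Rightarrow> real" where w: "coordinates n b w"
      using smooth_atlas_coordinates[OF L] by blast
  have "\<one>\<^bsub>G\<^esub> \<in> points L" by (simp add: pL)
  from chart_at_in[OF L this] interpret lie_group_chart G L "chart_at L \<one>\<^bsub>G\<^esub>" n b w
    using lie w by unfold_locales auto
  obtain \<gamma> where g: "smooth_map real_line L \<gamma>" "\<gamma> 0 = \<one>\<^bsub>G\<^esub>"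
      and e: "\<And>t. lie_exp G L (\<lambda>c. t *\<^sub>R X c) = \<gamma> t"
    using lie_exp_curve[OF X] by blast
  have "smooth_map (prod_manifold L M) M (\<lambda>(a, p). \<phi> a p)" using act
      by (simp add: smooth_action_def)
  from smooth_map_compose[OF smooth_atlas_real_line smooth_atlas_prod[OF L M] M
      smooth_map_pair[OF smooth_atlas_real_line L M g(1) smooth_map_const[OF smooth_atlas_real_line
          M p]] this]
  show "smooth_map real_line M (\<lambda>t. \<phi> (lie_exp G L (\<lambda>c. t *\<^sub>R X c)) p)" unfolding e by simp
  have "\<phi> \<one>\<^bsub>G\<^esub> p = p" using p by (simp flip: id_eq_one)
  then show "\<phi> (lie_exp G L (\<lambda>c. 0 *\<^sub>R X c)) p = p" unfolding e g(2) .
  show "lie_exp G L (\<lambda>c. t *\<^sub>R X c) \<in> carrier G"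
    unfolding e using smooth_map_points[OF g(1), of t] by (simp add: points_real_line pL)
qed

lemma fundamental_field_tangent:
  assumes "lie_group G L" "smooth_atlas M" "smooth_action G L M \<phi>" "X \<in> lie_algebra G L"
      "p \<in> points M"
  shows "fundamental_field G L M \<phi> X p \<in> tangent_space M p"
  using velocity_tangent[OF assms(2) exp_orbit(1)[OF assms], of 0] exp_orbit(2)[OF assms]
  unfolding fundamental_field_def by simp

text \<open>Phrased for a single orbit curve, with no action assumed on either side. In this form it
  applies to equivariant maps, to the slices of the cylinder and to the homotopy.\<close>

lemma fundamental_field_natural:
  assumes M: "smooth_atlas M" and N: "smooth_atlas N" and f: "smooth_map M N f"
    and orb: "smooth_map real_line M (\<lambda>t. \<phi> (lie_exp G L (\<lambda>c. t *\<^sub>R X c)) p)"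
        "\<phi> (lie_exp G L (\<lambda>c. 0 *\<^sub>R X c)) p = p"
    and eq: "\<And>t. f (\<phi> (lie_exp G L (\<lambda>c. t *\<^sub>R X c)) p) = \<psi> (lie_exp G L (\<lambda>c. t *\<^sub>R X c)) (f p)"
  shows "fundamental_field G L N \<psi> X (f p) = differential M N f p (fundamental_field G L M \<phi> X p)"
  using velocity_compose[OF M N orb(1) f, of 0] orb(2) unfolding fundamental_field_def eq by simp

lemma fundamental_field_equivariant:
  assumes lie: "lie_group G L" and M: "smooth_atlas M" and N: "smooth_atlas N"
      and act: "smooth_action G L M \<phi>"
    and f: "equivariant_map G M \<phi> N \<psi> f" and X: "X \<in> lie_algebra G L" and p: "p \<in> points M"
  shows "fundamental_field G L N \<psi> X (f p) = differential M N f p (fundamental_field G L M \<phi> X p)"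
proof (rule fundamental_field_natural[where f = f and p = p
    and \<phi> = \<phi>, OF M N _ exp_orbit(1,2)[OF lie M act X p]])
  show "smooth_map M N f" using f by (simp add: equivariant_map_def)
  show "f (\<phi> (lie_exp G L (\<lambda>c. t *\<^sub>R X c)) p) = \<psi> (lie_exp G L (\<lambda>c. t *\<^sub>R X c)) (f p)" for t
    using f exp_orbit(3)[OF lie M act X p] p by (simp add: equivariant_map_def)
qed

lemma line_action_apply: "p \<in> points M \<Longrightarrow> line_action M \<phi> a (p, t) = (\<phi> a p, t)"
  by (simp add: line_action_def)

lemma fundamental_field_line_action:
  assumes lie: "lie_group G L" and M: "smooth_atlas M" and act: "smooth_action G L M \<phi>"
    and X: "X \<in> lie_algebra G L" and p: "p \<in> points M"
  shows "fundamental_field G L (cyl M) (line_action M \<phi>) X (p, t)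
      = differential M (cyl M) (\<lambda>p. (p, t)) p (fundamental_field G L M \<phi> X p)"
  by (rule fundamental_field_natural[where f = "\<lambda>p. (p, t)" and p = p and \<phi> = \<phi>,
        OF M smooth_atlas_cyl[OF M] smooth_map_slice[OF M] exp_orbit(1,2)[OF lie M act X p]])
    (simp add: line_action_apply[OF p])

text \<open>An orbit in the cylinder is an orbit of \<open>M\<close> at constant height, and so its
  curve is smooth as a composition with the slice inclusion.\<close>

lemma fundamental_field_homotopy:
  assumes lie: "lie_group G L" and M: "smooth_atlas M" and N: "smooth_atlas N"
      and act: "smooth_action G L M \<phi>"
    and F: "equivariant_map G (cyl M) (line_action M \<phi>) N \<psi> F" and X: "X \<in> lie_algebra G L"
        and p: "p \<in> points M"
  shows "fundamental_field G L N \<psi> X (F (p, t)) =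
    differential (cyl M) N F (p, t) (fundamental_field G L (cyl M) (line_action M \<phi>) X (p, t))"
proof (rule fundamental_field_natural[where f = F and p = "(p, t)", OF smooth_atlas_cyl[OF M] N])
  note orb = exp_orbit[OF lie M act X p]
  show "smooth_map (cyl M) N F" using F by (simp add: equivariant_map_def)
  show "smooth_map real_line (cyl M) (\<lambda>s. line_action M \<phi> (lie_exp G L (\<lambda>c. s *\<^sub>R X c)) (p, t))"
    unfolding line_action_apply[OF p]
    by (rule smooth_map_compose[OF smooth_atlas_real_line M smooth_atlas_cyl[OF M] orb(1)
        smooth_map_slice[OF M]])
  show "line_action M \<phi> (lie_exp G L (\<lambda>c. 0 *\<^sub>R X c)) (p, t) = (p, t)"
    unfolding line_action_apply[OF p] orb(2) ..
  show "F (line_action M \<phi> (lie_exp G L (\<lambda>c. s *\<^sub>R X c)) (p, t)) = \<psi> (lie_exp G L (\<lambda>c. s *\<^sub>R X c))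
      (F (p, t))" for s
    using F orb(3) p by (simp add: equivariant_map_def points_prod points_real_line)
qed

lemma pullback_interior_product:
  assumes Y: "\<And>p. p \<in> points M \<Longrightarrow> Y p \<in> tangent_space M p"
    and eq: "\<And>p. p \<in> points M \<Longrightarrow> Y' (f p) = differential M N f p (Y p)"
  shows "pullback M N f (interior_product Y' \<omega>) = interior_product Y (pullback M N f \<omega>)"
  by (intro ext) (auto simp: pullback_def interior_product_def Y eq)


section \<open>The Cartan complex\<close>

lemma degree_set_finite: "finite {(k::nat, l::nat). 2 * int k + int l = n}"
proof (rule finite_subset)
  show "{(k, l). 2 * int k + int l = n} \<subseteq> {..nat n} \<times> {..nat n}" by auto
qed simp

section \<open>Operators on homogeneous forms and the spaces of cochains\<close>

lemma forms_scale:
  assumes "smooth_atlas M" "\<omega> \<in> forms M l"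
  shows "(\<lambda>p vs. r * \<omega> p vs) \<in> forms M l"
  using all_forms_lincomb[OF assms(1), of \<omega> \<omega> r 0] assms(2) unfolding forms_iff by auto

lemma pullback_forms:
  assumes "smooth_atlas M" "smooth_atlas N" "smooth_map M N f" "\<omega> \<in> forms N l"
  shows "pullback M N f \<omega> \<in> forms M l"
proof -
  have "length vs = l" if "pullback M N f \<omega> p vs \<noteq> 0" for p vs
  proof -
    have "\<omega> (f p) (map (differential M N f p) vs) \<noteq> 0" using that
        by (auto simp: pullback_def split: if_splits)
    then have "length (map (differential M N f p) vs) = l" using assms(4) unfolding forms_iff
        by blast
    then show ?thesis by simp
  qed
  then show ?thesis using pullback_all_forms[OF assms(1-3)] assms(4) by (simp add: forms_iff)
qed

lemma fiber_integral_forms: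
  assumes M: "smooth_atlas M" and th: "\<theta> \<in> forms (cyl M) (Suc l)"
  shows "fiber_integral M \<theta> \<in> forms M l"
proof -
  have "length vs = l" if nz: "fiber_integral M \<theta> p vs \<noteq> 0" for p vs
  proof (rule ccontr)
    assume "length vs \<noteq> l"
    then have "\<theta> (p, t) (time_field M (p, t) # map (differential M (cyl M) (\<lambda>p. (p, t)) p) vs) = 0"
        for t
      using th unfolding forms_iff by fastforce
    then show False using nz by (simp add: fiber_integral_def split: if_splits)
  qed
  then show ?thesis using fiber_integral_all_forms[OF M] th by (simp add: forms_iff)
qed

text \<open>The integrand is evaluated at lists that contain at least d/dt, and a form of degree 0
  vanishes on these.\<close>

lemma fiber_integral_zero_forms:
  assumes th: "\<theta> \<in> forms (cyl M) 0"
  shows "fiber_integral M \<theta> p vs = 0"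
proof -
  have "\<theta> (p, t) (time_field M (p, t) # map (differential M (cyl M) (\<lambda>p. (p, t)) p) vs) = 0" for t
    using th unfolding forms_iff by fastforce
  then show ?thesis by (simp add: fiber_integral_def)
qed

lemma pullback_sum: "pullback M N f (\<lambda>p vs. \<Sum>j\<in>J. a j * \<omega> j p vs)
    = (\<lambda>p vs. \<Sum>j\<in>J. a j * pullback M N f (\<omega> j) p vs)"
proof (intro ext)
  fix p vs
  show "pullback M N f (\<lambda>p vs. \<Sum>j\<in>J. a j * \<omega> j p vs) p vs = (\<Sum>j\<in>J. a j * pullback M N f (\<omega> j) p vs)"
    by (cases "p \<in> points M \<and> set vs \<subseteq> tangent_space M p")
      (simp add: pullback_def, simp only: pullback_def if_False mult_zero_right sum.neutral_const)
qed

lemma pullback_diff: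
  "pullback M N f (\<lambda>p vs. \<omega> p vs - \<eta> p vs) = (\<lambda>p vs. pullback M N f \<omega> p vs - pullback M N f \<eta> p vs)"
  by (intro ext) (simp add: pullback_def)

lemma sym_power_zero: "P \<in> sym_power G L k \<Longrightarrow> X \<notin> lie_algebra G L \<Longrightarrow> P X = 0"
  unfolding sym_power_def by auto

lemma sym_forms_all_forms:
  assumes M: "smooth_atlas M" and a: "\<alpha> \<in> sym_forms G L M k l"
  shows "\<alpha> X \<in> forms M l" and "X \<notin> lie_algebra G L \<Longrightarrow> \<alpha> X p vs = 0"
proof -
  obtain m :: nat and P \<omega> where P: "\<And>j. j < m \<Longrightarrow> P j \<in> sym_power G L k" "\<And>j. j < m \<Longrightarrow> \<omega> j \<in> forms M l"
    and al: "\<alpha> = (\<lambda>X p vs. \<Sum>j<m. P j X * \<omega> j p vs)"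
    using a unfolding sym_forms_def by blast
  have "\<alpha> X \<in> all_forms M" unfolding al by (rule all_forms_sum[OF M]) (use P(2)
      in \<open>auto simp: forms_iff\<close>)
  moreover have "length vs = l" if "\<alpha> X p vs \<noteq> 0" for p vs
  proof (rule ccontr)
    assume "length vs \<noteq> l"
    then have "\<omega> j p vs = 0" if "j < m" for j using P(2)[OF that] unfolding forms_iff by blast
    then show False using that unfolding al by simp
  qed
  ultimately show "\<alpha> X \<in> forms M l" by (simp add: forms_iff)
  show "\<alpha> X p vs = 0" if "X \<notin> lie_algebra G L"
    unfolding al using sym_power_zero[OF P(1) that] by simp
qed

text \<open>A linear operator on forms acts on the second tensor factor and leaves the polynomials
  on the Lie algebra alone. Linearity is asked for finite sums of forms of degree \<open>l\<close>,
  as the integral is additive only for integrable functions.\<close>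

lemma sym_forms_map:
  assumes a: "\<alpha> \<in> sym_forms G L N k l"
    and H: "\<And>\<omega>. \<omega> \<in> forms N l \<Longrightarrow> H \<omega> \<in> forms M l'"
    and Hsum: "\<And>(m::nat) a \<omega>. (\<And>j. j < m \<Longrightarrow> \<omega> j \<in> forms N l) \<Longrightarrow>
      H (\<lambda>p vs. \<Sum>j<m. a j * \<omega> j p vs) = (\<lambda>p vs. \<Sum>j<m. a j * H (\<omega> j) p vs)"
  shows "(\<lambda>X. H (\<alpha> X)) \<in> sym_forms G L M k l'"
proof -
  obtain m :: nat and P \<omega> where P: "\<And>j. j < m \<Longrightarrow> P j \<in> sym_power G L k" "\<And>j. j < m \<Longrightarrow> \<omega> j \<in> forms N l"
    and al: "\<alpha> = (\<lambda>X p vs. \<Sum>j<m. P j X * \<omega> j p vs)"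
    using a unfolding sym_forms_def by blast
  have "(\<lambda>X. H (\<alpha> X)) = (\<lambda>X p vs. \<Sum>j<m. P j X * H (\<omega> j) p vs)"
    unfolding al by (intro ext) (simp only: Hsum[OF P(2)])
  then show ?thesis unfolding sym_forms_def using P(1) H[OF P(2)]
    by (intro CollectI exI[of _ m] exI[of _ P] exI[of _ "\<lambda>j. H (\<omega> j)"]) auto
qed

lemma sym_forms_lincomb:
  assumes M: "smooth_atlas M" and a: "\<alpha> \<in> sym_forms G L M k l" and b: "\<beta> \<in> sym_forms G L M k l"
  shows "(\<lambda>X p vs. r * \<alpha> X p vs + s * \<beta> X p vs) \<in> sym_forms G L M k l"
proof -
  obtain m :: nat and P \<omega> where P: "\<And>j. j < m \<Longrightarrow> P j \<in> sym_power G L k" "\<And>j. j < m \<Longrightarrow> \<omega> j \<in> forms M l"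
    and al: "\<alpha> = (\<lambda>X p vs. \<Sum>j<m. P j X * \<omega> j p vs)"
    using a unfolding sym_forms_def by blast
  obtain m' :: nat and P' \<omega>' where P': "\<And>j. j < m' \<Longrightarrow> P' j \<in> sym_power G L k" "\<And>j. j < m' \<Longrightarrow>
      \<omega>' j \<in> forms M l"
    and be: "\<beta> = (\<lambda>X p vs. \<Sum>j<m'. P' j X * \<omega>' j p vs)"
    using b unfolding sym_forms_def by blast
  define Q where "Q = (\<lambda>j. if j < m then P j else P' (j - m))"
  define \<eta> where "\<eta> = (\<lambda>j. if j < m then (\<lambda>p vs. r * \<omega> j p vs) else (\<lambda>p vs. s * \<omega>' (j - m) p vs))"
  have sp: "(\<Sum>j<m + m'. h j) = (\<Sum>j<m. h j) + (\<Sum>j<m'. h (m + j))" for h :: "nat \<Rightarrow> real"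
    by (induction m') (auto simp: add.assoc)
  have "(\<lambda>X p vs. r * \<alpha> X p vs + s * \<beta> X p vs) = (\<lambda>X p vs. \<Sum>j<m + m'. Q j X * \<eta> j p vs)"
    unfolding sp al be by (intro ext) (simp add: Q_def \<eta>_def sum_distrib_left mult_ac)
  moreover have "\<forall>j<m + m'. Q j \<in> sym_power G L k \<and> \<eta> j \<in> forms M l"
    using P P' forms_scale[OF M] by (auto simp: Q_def \<eta>_def)
  ultimately show ?thesis unfolding sym_forms_def by blast
qed

lemma invariant_sym_forms_lincomb:
  assumes M: "smooth_atlas M" and a: "\<alpha> \<in> invariant_sym_forms G L M \<phi> k l"
      and b: "\<beta> \<in> invariant_sym_forms G L M \<phi> k l"
  shows "(\<lambda>X p vs. r * \<alpha> X p vs + s * \<beta> X p vs) \<in> invariant_sym_forms G L M \<phi> k l"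
  using sym_forms_lincomb[OF M, of \<alpha> G L k l \<beta> r s] a b
  unfolding invariant_sym_forms_def by (auto simp: pullback_def fun_eq_iff)

lemma cochains_lincomb:
  assumes M: "smooth_atlas M" and a: "\<alpha> \<in> cochains G L M \<phi> n" and b: "\<beta> \<in> cochains G L M \<phi> n"
  shows "(\<lambda>X p vs. r * \<alpha> X p vs + s * \<beta> X p vs) \<in> cochains G L M \<phi> n"
proof -
  obtain A B where A: "\<And>k l. A k l \<in> invariant_sym_forms G L M \<phi> k l"
      "\<alpha> = (\<lambda>X p vs. \<Sum>(k, l) \<in> {(k, l). 2 * int k + int l = n}. A k l X p vs)"
    and B: "\<And>k l. B k l \<in> invariant_sym_forms G L M \<phi> k l"
      "\<beta> = (\<lambda>X p vs. \<Sum>(k, l) \<in> {(k, l). 2 * int k + int l = n}. B k l X p vs)"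
    using a b unfolding cochains_def by blast
  have "(\<lambda>X p vs. r * \<alpha> X p vs + s * \<beta> X p vs) =
      (\<lambda>X p vs. \<Sum>(k, l) \<in> {(k, l). 2 * int k + int l = n}. r * A k l X p vs + s * B k l X p vs)"
    unfolding A(2) B(2) by (intro ext) (simp add: sum_distrib_left sum.distrib case_prod_unfold)
  moreover have "\<forall>k l. (\<lambda>X p vs. r * A k l X p vs + s * B k l X p vs)
      \<in> invariant_sym_forms G L M \<phi> k l"
    using invariant_sym_forms_lincomb[OF M A(1) B(1)] by blast
  ultimately show ?thesis unfolding cochains_def
    by (intro CollectI exI[of _ "\<lambda>k l X p vs. r * A k l X p vs + s * B k l X p vs"]) blast
qed

text \<open>Cochains are functions on a whole type. Their vanishing off the Lie algebra settles
  identities between cochains at those arguments, where fundamental fields are not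
  controlled.\<close>

lemma cochains_all_forms:
  assumes M: "smooth_atlas M" and a: "\<alpha> \<in> cochains G L M \<phi> n"
  shows "\<alpha> X \<in> all_forms M" and "X \<notin> lie_algebra G L \<Longrightarrow> \<alpha> X = (\<lambda>p vs. 0)"
proof -
  obtain A where A: "\<And>k l. A k l \<in> sym_forms G L M k l"
      "\<alpha> = (\<lambda>X p vs. \<Sum>(k, l) \<in> {(k, l). 2 * int k + int l = n}. A k l X p vs)"
    using a unfolding cochains_def invariant_sym_forms_def by blast
  have "(\<lambda>p vs. \<Sum>z\<in>{(k, l). 2 * int k + int l = n}. 1 * A (fst z) (snd z) X p vs) \<in> all_forms M"
    by (rule all_forms_sum[OF M]) (use sym_forms_all_forms(1)[OF M A(1)] in \<open>auto simp: forms_iff\<close>)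
  then show "\<alpha> X \<in> all_forms M" unfolding A(2) by (simp add: case_prod_unfold)
  show "\<alpha> X = (\<lambda>p vs. 0)" if "X \<notin> lie_algebra G L"
    unfolding A(2) using sym_forms_all_forms(2)[OF M A(1) that] by simp
qed

lemma cartan_differential_lincomb:
  assumes M: "smooth_atlas M" and a: "\<alpha> \<in> cochains G L M \<phi> n" and b: "\<beta> \<in> cochains G L M \<phi> n"
  shows "cartan_differential G L M \<phi> (\<lambda>X p vs. r * \<alpha> X p vs + s * \<beta> X p vs) =
    (\<lambda>X p vs. r * cartan_differential G L M \<phi> \<alpha> X p vs + s * cartan_differential G L M \<phi> \<beta> X p vs)"
  unfolding cartan_differential_def
  by (intro ext) (simp add: ext_deriv_lincomb[OF M cochains_all_forms(1)[OF M a]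
      cochains_all_forms(1)[OF M b]]
      interior_product_def algebra_simps)

lemma ext_deriv_zero: "ext_deriv M (\<lambda>p vs. 0) = (\<lambda>p vs. 0)"
  by (intro ext) (simp add: ext_deriv_def local_form_def[abs_def] Let_def)

lemma cartan_differential_zero: "\<alpha> X = (\<lambda>p vs. 0) \<Longrightarrow> cartan_differential G L M \<phi> \<alpha> X = (\<lambda>p vs. 0)"
  by (simp add: cartan_differential_def ext_deriv_zero interior_product_def)

text \<open>Since \<open>f\<close> intertwines the two actions of the inverse of \<open>a\<close>,
  both sides of the invariance condition are pullbacks along one and the same map from
  \<open>M\<close> to \<open>N\<close>.\<close>

lemma cochain_pullback_cochains:
  assumes M: "smooth_atlas M" and N: "smooth_atlas N" and L: "smooth_atlas L" and G: "group G"
      and pL: "points L = carrier G"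
    and actM: "smooth_action G L M \<phi>" and actN: "smooth_action G L N \<psi>"
    and f: "equivariant_map G M \<phi> N \<psi> f" and a: "\<alpha> \<in> cochains G L N \<psi> n"
  shows "cochain_pullback M N f \<alpha> \<in> cochains G L M \<phi> n"
proof -
  have fs: "smooth_map M N f" and fe: "\<And>a p. a \<in> carrier G \<Longrightarrow> p \<in> points M \<Longrightarrow> f (\<phi> a p) = \<psi> a (f p)"
    using f by (auto simp: equivariant_map_def)
  interpret group G by (rule G)
  obtain A where A: "\<And>k l. A k l \<in> invariant_sym_forms G L N \<psi> k l"
      "\<alpha> = (\<lambda>X p vs. \<Sum>(k, l) \<in> {(k, l). 2 * int k + int l = n}. A k l X p vs)"
    using a unfolding cochains_def by blast
  have As: "A k l \<in> sym_forms G L N k l" and Ai: "\<And>a X. a \<in> carrier G \<Longrightarrow> X \<in> lie_algebra G L \<Longrightarrow>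
     A k l (Ad G L a X) = pullback N N (\<psi> (inv\<^bsub>G\<^esub> a)) (A k l X)" for k l
    using A(1)[of k l] unfolding invariant_sym_forms_def by blast+
  have "(\<lambda>X. pullback M N f (A k l X)) \<in> invariant_sym_forms G L M \<phi> k l" for k l
    unfolding invariant_sym_forms_def
  proof (intro CollectI conjI ballI)
    show "(\<lambda>X. pullback M N f (A k l X)) \<in> sym_forms G L M k l"
      by (rule sym_forms_map[OF As pullback_forms[OF M N fs] pullback_sum])
    fix a X assume a: "a \<in> carrier G" and X: "X \<in> lie_algebra G L"
    have ia: "inv\<^bsub>G\<^esub> a \<in> points L" using a by (simp add: pL)
    note sM = smooth_action_map[OF L M actM ia] and sN = smooth_action_map[OF L N actN ia]
    have "pullback M N f (A k l (Ad G L a X)) = pullback M N (\<lambda>p. \<psi> (inv\<^bsub>G\<^esub> a) (f p)) (A k l X)"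
      unfolding Ai[OF a X] by (rule pullback_compose[OF M N N fs sN])
    also have "\<dots> = pullback M N (\<lambda>p. f (\<phi> (inv\<^bsub>G\<^esub> a) p)) (A k l X)"
      by (rule pullback_cong[OF M]) (use fe a in simp)
    also have "\<dots> = pullback M M (\<phi> (inv\<^bsub>G\<^esub> a)) (pullback M N f (A k l X))"
      by (rule pullback_compose[OF M M N sM fs, symmetric])
    finally show "pullback M N f (A k l (Ad G L a X)) = pullback M M (\<phi> (inv\<^bsub>G\<^esub> a))
        (pullback M N f (A k l X))" .
  qed
  moreover have "cochain_pullback M N f \<alpha> =
      (\<lambda>X p vs. \<Sum>(k, l) \<in> {(k, l). 2 * int k + int l = n}. pullback M N f (A k l X) p vs)"
    unfolding cochain_pullback_def A(2)
    using pullback_sum[where a = "\<lambda>_. 1" and \<omega> = "\<lambda>z. A (fst z) (snd z) _"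
        and J = "{(k, l). 2 * int k + int l = n}" and M = M and N = N and f = f]
    by (intro ext) (simp add: case_prod_unfold)
  ultimately show ?thesis unfolding cochains_def
    by (intro CollectI exI[of _ "\<lambda>k l X. pullback M N f (A k l X)"]) blast
qed

text \<open>On the Lie algebra \<open>f\<close> relates the fundamental fields of the two actions,
  so the pullback commutes with the contraction as it does with \<open>ext_deriv\<close>. Off the
  Lie algebra both sides are 0.\<close>

lemma cartan_differential_pullback:
  assumes M: "smooth_atlas M" and N: "smooth_atlas N" and lie: "lie_group G L"
    and actM: "smooth_action G L M \<phi>"
    and f: "equivariant_map G M \<phi> N \<psi> f" and a: "\<alpha> \<in> cochains G L N \<psi> n"
  shows "cartan_differential G L M \<phi> (cochain_pullback M N f \<alpha>) =
    cochain_pullback M N f (cartan_differential G L N \<psi> \<alpha>)"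
proof
  fix X
  have fs: "smooth_map M N f" using f by (auto simp: equivariant_map_def)
  show "cartan_differential G L M \<phi> (cochain_pullback M N f \<alpha>) X
      = cochain_pullback M N f (cartan_differential G L N \<psi> \<alpha>) X"
  proof (cases "X \<in> lie_algebra G L")
    case True
    have "pullback M N f (interior_product (fundamental_field G L N \<psi> X) (\<alpha> X)) =
      interior_product (fundamental_field G L M \<phi> X) (pullback M N f (\<alpha> X))"
      by (rule pullback_interior_product[OF fundamental_field_tangent[OF lie M actM True]
            fundamental_field_equivariant[OF lie M N actM f True]])
    then show ?thesis
      unfolding cartan_differential_def cochain_pullback_def
        pullback_ext_deriv[OF M N fs cochains_all_forms(1)[OF N a]] pullback_diff by simp
  next
    case False
    note z = cochains_all_forms(2)[OF N a False]
    have z': "pullback M N f (\<lambda>p vs. 0) = (\<lambda>p vs. 0)" by (intro ext) (simp add: pullback_def)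
    show ?thesis
      using cartan_differential_zero[where \<alpha> = \<alpha> and X = X, OF z] cartan_differential_zero[where \<alpha> =
          "cochain_pullback M N f \<alpha>" and X = X]
      by (simp add: cochain_pullback_def z z')
  qed
qed


section \<open>The homotopy operator\<close>

definition homotopy_operator ::
  "('a, 'e::real_normed_vector) manifold \<Rightarrow> ('b, 'f::real_normed_vector) manifold \<Rightarrow> ('a \<times> real \<Rightarrow> 'b)
    \<Rightarrow> ('g, 'k, 'b, 'f) cochain \<Rightarrow> ('g, 'k, 'a, 'e) cochain" where
  "homotopy_operator M N F \<alpha> = (\<lambda>X. fiber_integral M (pullback (cyl M) N F (\<alpha> X)))"

lemma homotopy_operator_sum:
  assumes M: "smooth_atlas M" and N: "smooth_atlas N" and F: "smooth_map (cyl M) N F"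
    and w: "\<And>j. j \<in> J \<Longrightarrow> \<omega> j \<in> all_forms N" and J: "finite J"
  shows "fiber_integral M (pullback (cyl M) N F (\<lambda>p vs. \<Sum>j\<in>J. a j * \<omega> j p vs)) =
    (\<lambda>p vs. \<Sum>j\<in>J. a j * fiber_integral M (pullback (cyl M) N F (\<omega> j)) p vs)"
  unfolding pullback_sum
  by (intro ext fiber_integral_sum[OF M _ J] pullback_all_forms[OF smooth_atlas_cyl[OF M] N F] w)

text \<open>The component of bidegree \<open>(k, Suc l)\<close> is sent to bidegree
  \<open>(k, l)\<close>, and components with forms of degree 0 are killed; hence the total degree
  drops by one. For invariance, the group element is moved from \<open>N\<close> through
  \<open>F\<close> to the cylinder, where \<open>fiber_integral_pullback\<close> takes it out of the
  integral.\<close>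

lemma homotopy_operator_cochains:
  assumes M: "smooth_atlas M" and N: "smooth_atlas N" and L: "smooth_atlas L" and G: "group G"
      and pL: "points L = carrier G"
    and actM: "smooth_action G L M \<phi>" and actN: "smooth_action G L N \<psi>"
    and F: "equivariant_map G (cyl M) (line_action M \<phi>) N \<psi> F" and a: "\<alpha> \<in> cochains G L N \<psi> n"
  shows "homotopy_operator M N F \<alpha> \<in> cochains G L M \<phi> (n - 1)"
proof -
  note P = smooth_atlas_cyl[OF M]
  have Fs: "smooth_map (cyl M) N F"
    and Fe: "\<And>a p t. a \<in> carrier G \<Longrightarrow> p \<in> points M \<Longrightarrow> F (\<phi> a p, t) = \<psi> a (F (p, t))"
    using F by (auto simp: equivariant_map_def points_prod points_real_line line_action_def)
  interpret group G by (rule G)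
  obtain A where A: "\<And>k l. A k l \<in> invariant_sym_forms G L N \<psi> k l"
      "\<alpha> = (\<lambda>X p vs. \<Sum>(k, l) \<in> {(k, l). 2 * int k + int l = n}. A k l X p vs)"
    using a unfolding cochains_def by blast
  have As: "A k l \<in> sym_forms G L N k l" and Ai: "\<And>a X. a \<in> carrier G \<Longrightarrow> X \<in> lie_algebra G L \<Longrightarrow>
     A k l (Ad G L a X) = pullback N N (\<psi> (inv\<^bsub>G\<^esub> a)) (A k l X)" for k l
    using A(1)[of k l] unfolding invariant_sym_forms_def by blast+
  let ?H = "\<lambda>\<omega>. fiber_integral M (pullback (cyl M) N F \<omega>)"
  have inv: "(\<lambda>X. ?H (A k (Suc l) X)) \<in> invariant_sym_forms G L M \<phi> k l" for k l
    unfolding invariant_sym_forms_def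
  proof (intro CollectI conjI ballI)
    show "(\<lambda>X. ?H (A k (Suc l) X)) \<in> sym_forms G L M k l"
    proof (rule sym_forms_map[OF As fiber_integral_forms[OF M pullback_forms[OF P N Fs]]])
      show "?H (\<lambda>p vs. \<Sum>j<m. a j * \<omega> j p vs) = (\<lambda>p vs. \<Sum>j<m. a j * ?H (\<omega> j) p vs)"
        if "\<And>j. j < m \<Longrightarrow> \<omega> j \<in> forms N (Suc l)" for m :: nat and a \<omega>
        by (rule homotopy_operator_sum[OF M N Fs]) (use that in \<open>auto simp: forms_iff\<close>)
    qed
    fix a X assume a: "a \<in> carrier G" and X: "X \<in> lie_algebra G L"
    have ia: "inv\<^bsub>G\<^esub> a \<in> points L" using a by (simp add: pL)
    note sM = smooth_action_map[OF L M actM ia] and sN = smooth_action_map[OF L N actN ia]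
    let ?K = "\<lambda>z. (\<phi> (inv\<^bsub>G\<^esub> a) (fst z), snd z)"
    note K = smooth_map_cyl[OF M sM]
    have "pullback (cyl M) N F (A k (Suc l) (Ad G L a X)) = pullback (cyl M) N (\<lambda>z. \<psi> (inv\<^bsub>G\<^esub> a)
        (F z)) (A k (Suc l) X)"
      unfolding Ai[OF a X] by (rule pullback_compose[OF P N N Fs sN])
    also have "\<dots> = pullback (cyl M) N (\<lambda>z. F (?K z)) (A k (Suc l) X)"
      by (rule pullback_cong[OF P]) (use Fe a in \<open>auto simp: points_prod\<close>)
    also have "\<dots> = pullback (cyl M) (cyl M) ?K (pullback (cyl M) N F (A k (Suc l) X))"
      by (rule pullback_compose[OF P P N K Fs, symmetric])
    finally show "?H (A k (Suc l) (Ad G L a X)) = pullback M M (\<phi> (inv\<^bsub>G\<^esub> a)) (?H (A k (Suc l) X))"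
      by (simp only: fiber_integral_pullback[OF M sM])
  qed
  have "?H (\<alpha> X) p vs = (\<Sum>(k, l) \<in> {(k, l). 2 * int k + int l = n - 1}. ?H (A k (Suc l) X) p vs)"
      for X p vs
  proof -
    let ?S = "{(k :: nat, l :: nat). 2 * int k + int l = n}"
        and ?T = "{(k :: nat, l :: nat). 2 * int k + int l = n - 1}"
    let ?g = "\<lambda>z. ?H (A (fst z) (snd z) X) p vs" and ?i = "\<lambda>z :: nat \<times> nat. (fst z, Suc (snd z))"
    have "?H (\<alpha> X) = ?H (\<lambda>p vs. \<Sum>z\<in>?S. 1 * A (fst z) (snd z) X p vs)"
      unfolding A(2) by (simp add: case_prod_unfold)
    also have "\<dots> = (\<lambda>p vs. \<Sum>z\<in>?S. 1 * ?H (A (fst z) (snd z) X) p vs)"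
      by (rule homotopy_operator_sum[OF M N Fs _ degree_set_finite])
        (use sym_forms_all_forms(1)[OF N As] in \<open>auto simp: forms_iff\<close>)
    finally have "?H (\<alpha> X) p vs = (\<Sum>z\<in>?S. ?g z)" by simp
    \<comment> \<open>The bidegrees of total degree \<open>n\<close> outside the image of the shift
      \<open>?i\<close> are those with \<open>l = 0\<close>; their terms vanish by
      \<open>fiber_integral_zero_forms\<close>.\<close>
    also have "\<dots> = (\<Sum>z\<in>?i ` ?T. ?g z)"
    proof (rule sum.mono_neutral_right[OF degree_set_finite])
      show "?i ` ?T \<subseteq> ?S" by auto
      show "\<forall>z\<in>?S - ?i ` ?T. ?g z = 0"
      proof
        fix z assume z: "z \<in> ?S - ?i ` ?T"
        have "snd z = 0"
        proof (rule ccontr)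
          assume "snd z \<noteq> 0"
          then obtain l where "snd z = Suc l" using not0_implies_Suc by blast
          then have "z = ?i (fst z, l)" "(fst z, l) \<in> ?T" using z by (auto simp: prod_eq_iff)
          then show False using z by blast
        qed
        then show "?g z = 0"
          using fiber_integral_zero_forms[OF pullback_forms[OF P N Fs sym_forms_all_forms(1)[OF N
              As[of "fst z" 0]]]] by simp
      qed
    qed
    also have "\<dots> = (\<Sum>z\<in>?T. ?g (?i z))"
      by (subst sum.reindex) (auto simp: inj_on_def prod_eq_iff)
    finally show ?thesis by (simp add: case_prod_unfold)
  qed
  then have "homotopy_operator M N F \<alpha> =
     (\<lambda>X p vs. \<Sum>(k, l) \<in> {(k, l). 2 * int k + int l = n - 1}. ?H (A k (Suc l) X) p vs)"
    unfolding homotopy_operator_def by (intro ext)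
  then show ?thesis unfolding cochains_def using inv
    by (intro CollectI exI[of _ "\<lambda>k l X. ?H (A k (Suc l) X)"]) blast
qed

text \<open>The fundamental field of the cylinder is related to that of \<open>N\<close> by
  \<open>F\<close> and to that of \<open>M\<close> by the slices. The cocycle condition turns the
  exterior derivative of \<theta> into the contraction with it, and the integral of this contraction
  supplies the second part of the Cartan differential.\<close>

lemma homotopy_operator_cocycle:
  assumes M: "smooth_atlas M" and N: "smooth_atlas N" and lie: "lie_group G L"
    and actM: "smooth_action G L M \<phi>"
    and F: "equivariant_map G (cyl M) (line_action M \<phi>) N \<psi> F"
    and F01: "\<And>p. p \<in> points M \<Longrightarrow> F (p, 0) = f p" "\<And>p. p \<in> points M \<Longrightarrow> F (p, 1) = g p"
    and a: "\<alpha> \<in> cochains G L N \<psi> n" and z: "cartan_differential G L N \<psi> \<alpha> = (\<lambda>X p vs. 0)"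
  shows "cartan_differential G L M \<phi> (homotopy_operator M N F \<alpha>) X p vs =
    cochain_pullback M N g \<alpha> X p vs - cochain_pullback M N f \<alpha> X p vs"
proof (cases "X \<in> lie_algebra G L")
  case True
  note P = smooth_atlas_cyl[OF M]
  have Fs: "smooth_map (cyl M) N F" using F by (simp add: equivariant_map_def)
  define \<theta> where "\<theta> = pullback (cyl M) N F (\<alpha> X)"
  note w = cochains_all_forms(1)[OF N a, of X]
  have th: "\<theta> \<in> all_forms (cyl M)" unfolding \<theta>_def by (rule pullback_all_forms[OF P N Fs w])
  let ?YM = "fundamental_field G L M \<phi> X" and ?YN = "fundamental_field G L N \<psi> X"
    and ?YP = "fundamental_field G L (cyl M) (line_action M \<phi>) X"
  note tM = fundamental_field_tangent[OF lie M actM True]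
  note YP = fundamental_field_line_action[OF lie M actM True]
  \<comment> \<open>Tangency on the cylinder is read off from its description as an image under the
    slice inclusion.\<close>
  have tP: "?YP z \<in> tangent_space (cyl M) z" if "z \<in> points (cyl M)" for z
    using that YP differential_tangent[OF M P smooth_map_slice[OF M]] by (auto simp: points_prod)
  have "ext_deriv N (\<alpha> X) = interior_product ?YN (\<alpha> X)"
    using fun_cong[OF z, of X] by (simp add: cartan_differential_def fun_eq_iff)
  then have "ext_deriv (cyl M) \<theta> = pullback (cyl M) N F (interior_product ?YN (\<alpha> X))"
    unfolding \<theta>_def pullback_ext_deriv[OF P N Fs w] by simp
  also have "\<dots> = interior_product ?YP \<theta>"
    unfolding \<theta>_def
    by (rule pullback_interior_product[OF tP]) (use fundamental_field_homotopy[OF lie M N actM F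
        True] in \<open>auto simp: points_prod\<close>)
  finally have "fiber_integral M (ext_deriv (cyl M) \<theta>) p vs
      = - interior_product ?YM (fiber_integral M \<theta>) p vs"
    using fiber_integral_interior_product[OF M th tM YP] by simp
  moreover have "pullback M (cyl M) (\<lambda>p. (p, t)) \<theta> = pullback M N (\<lambda>p. F (p, t)) (\<alpha> X)" for t
    unfolding \<theta>_def by (rule pullback_compose[OF M P N smooth_map_slice[OF M] Fs])
  moreover have "pullback M N (\<lambda>p. F (p, 0)) (\<alpha> X) = pullback M N f (\<alpha> X)"
    "pullback M N (\<lambda>p. F (p, 1)) (\<alpha> X) = pullback M N g (\<alpha> X)"
    by (rule pullback_cong[OF M], simp add: F01)+
  ultimately show ?thesis
    using homotopy_formula[OF M th, of p vs]
    by (simp add: cartan_differential_def homotopy_operator_def cochain_pullback_def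
        \<theta>_def[symmetric])
next
  case False
  note z = cochains_all_forms(2)[OF N a False]
  have z': "pullback M' N' h (\<lambda>p vs. 0) = (\<lambda>p vs. 0)" for M' N' h
      by (intro ext) (simp add: pullback_def)
  have "fiber_integral M (\<lambda>p vs. 0) = (\<lambda>p vs. 0)" by (intro ext) (simp add: fiber_integral_def)
  then have "cartan_differential G L M \<phi> (homotopy_operator M N F \<alpha>) X = (\<lambda>p vs. 0)"
    by (intro cartan_differential_zero) (simp add: homotopy_operator_def z z')
  then show ?thesis by (simp add: cochain_pullback_def z z')
qed

text \<open>One inclusion of cosets, obtained by absorbing \<zeta> into the coboundary. The reverse
  inclusion is an instance with a primitive of opposite sign.\<close>

lemma coset_cong:
  assumes M: "smooth_atlas M" and zeta: "\<zeta> \<in> cochains G L M \<phi> (n - 1)"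
    and eq: "\<And>X p vs. \<beta> X p vs = \<alpha> X p vs + cartan_differential G L M \<phi> \<zeta> X p vs"
  shows "coboundaries G L M \<phi> n #>\<^bsub>cocycles G L M \<phi> n\<^esub> \<beta>
      \<subseteq> coboundaries G L M \<phi> n #>\<^bsub>cocycles G L M \<phi> n\<^esub> \<alpha>"
proof
  fix x assume "x \<in> coboundaries G L M \<phi> n #>\<^bsub>cocycles G L M \<phi> n\<^esub> \<beta>"
  then obtain \<kappa> where chi: "\<kappa> \<in> cochains G L M \<phi> (n - 1)"
    and x: "x = (\<lambda>X p vs. cartan_differential G L M \<phi> \<kappa> X p vs + \<beta> X p vs)"
    unfolding r_coset_def coboundaries_def cocycles_def by auto
  let ?\<kappa> = "\<lambda>X p vs. 1 * \<kappa> X p vs + 1 * \<zeta> X p vs"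
  have "x = (\<lambda>X p vs. cartan_differential G L M \<phi> ?\<kappa> X p vs + \<alpha> X p vs)"
    unfolding x cartan_differential_lincomb[OF M chi zeta] eq by (intro ext) simp
  then show "x \<in> coboundaries G L M \<phi> n #>\<^bsub>cocycles G L M \<phi> n\<^esub> \<alpha>"
    unfolding r_coset_def coboundaries_def cocycles_def using cochains_lincomb[OF M chi zeta, of 1
        1] by auto
qed

theorem theorem6p1:
  fixes G :: "'g monoid"
    and L :: "('g, 'k::real_normed_vector) manifold"
    and M :: "('a, 'e::real_normed_vector) manifold"
    and N :: "('b, 'f::real_normed_vector) manifold"
    and \<phi> :: "'g \<Rightarrow> 'a \<Rightarrow> 'a" and \<psi> :: "'g \<Rightarrow> 'b \<Rightarrow> 'b"
    and f g :: "'a \<Rightarrow> 'b"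
  assumes "compact_lie_group G L"
    and "smooth_manifold M" and "smooth_manifold N"
    and "smooth_action G L M \<phi>" and "smooth_action G L N \<psi>"
    and "equivariant_map G M \<phi> N \<psi> f" and "equivariant_map G M \<phi> N \<psi> g"
    and "equivariantly_homotopic G M \<phi> N \<psi> f g"
  shows "cohomology_pullback G L M \<phi> N \<psi> f = cohomology_pullback G L M \<phi> N \<psi> g"
proof -
  have lie: "lie_group G L" using assms(1) by (simp add: compact_lie_group_def)
  have L: "smooth_atlas L" and pL: "points L = carrier G" and G: "group G"
    using lie smooth_manifold_atlas by (auto simp: lie_group_def)
  have M: "smooth_atlas M" and N: "smooth_atlas N" using assms(2,3) smooth_manifold_atlas by blast+
  note actM = assms(4) and actN = assms(5) and f = assms(6) and g = assms(7)
  obtain F where F: "equivariant_map G (cyl M) (line_action M \<phi>) N \<psi> F"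
    and F01: "\<And>p. p \<in> points M \<Longrightarrow> F (p, 0) = f p" "\<And>p. p \<in> points M \<Longrightarrow> F (p, 1) = g p"
    using assms(8) by (auto simp: equivariantly_homotopic_def)
  \<comment> \<open>\<open>cohomology_pullback\<close> is a union over all representatives in the
    class, and the two unions are compared member by member. No independence of the representative
    enters.\<close>
  have coset: "coboundaries G L M \<phi> n #>\<^bsub>cocycles G L M \<phi> n\<^esub> cochain_pullback M N f \<alpha> =
      coboundaries G L M \<phi> n #>\<^bsub>cocycles G L M \<phi> n\<^esub> cochain_pullback M N g \<alpha>"
    if K: "K \<in> carrier (equivariant_cohomology G L N \<psi> n)" and al: "\<alpha> \<in> K" for K \<alpha> n
  proof -
    obtain \<alpha>0 where K0: "K = coboundaries G L N \<psi> n #>\<^bsub>cocycles G L N \<psi> n\<^esub> \<alpha>0"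
      and a0: "\<alpha>0 \<in> cochains G L N \<psi> n" "cartan_differential G L N \<psi> \<alpha>0 = (\<lambda>X p vs. 0)"
      using K unfolding equivariant_cohomology_def FactGroup_def RCOSETS_def
          by (auto simp: cocycles_def)
    obtain \<eta> where eta: "\<eta> \<in> cochains G L N \<psi> (n - 1)"
      and al': "\<alpha> = (\<lambda>X p vs. cartan_differential G L N \<psi> \<eta> X p vs + \<alpha>0 X p vs)"
      using al unfolding K0 r_coset_def coboundaries_def cocycles_def by auto
    let ?f = "cochain_pullback M N f" and ?g = "cochain_pullback M N g"
    let ?d = "cartan_differential G L M \<phi>" and ?h = "homotopy_operator M N F \<alpha>0"
    note fe = cochain_pullback_cochains[OF M N L G pL actM actN f eta]
      and ge = cochain_pullback_cochains[OF M N L G pL actM actN g eta]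
      and h = homotopy_operator_cochains[OF M N L G pL actM actN F a0(1)]
    \<comment> \<open>The representative is a cocycle \<open>\<alpha>0\<close> plus the differential
      of \<eta>. The difference of the two pullbacks of \<eta> is a primitive for the second
      summand, and the homotopy operator applied to \<open>\<alpha>0\<close> is one for the
      first.\<close>
    let ?\<eta> = "\<lambda>X p vs. 1 * ?g \<eta> X p vs + (- 1) * ?f \<eta> X p vs"
    \<comment> \<open>The total primitive and its negative, one for each of the two inclusions; the
      explicit factors give both the shape that \<open>cochains_lincomb\<close> expects.\<close>
    let ?\<zeta> = "\<lambda>X p vs. 1 * ?\<eta> X p vs + 1 * ?h X p vs" and ?\<zeta>' = "\<lambda>X p vs. (- 1) * ?\<eta> X p vs
        + (- 1) * ?h X p vs"
    note e = cochains_lincomb[OF M ge fe, of 1 "- 1"]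
    have zeta: "?\<zeta> \<in> cochains G L M \<phi> (n - 1)" "?\<zeta>' \<in> cochains G L M \<phi> (n - 1)"
      by (rule cochains_lincomb[OF M e h])+
    have pl: "cochain_pullback M N k \<alpha> X p vs = cochain_pullback M N k (cartan_differential G L N \<psi>
        \<eta>) X p vs + cochain_pullback M N k \<alpha>0 X p vs"
      for k X p vs unfolding al' by (simp add: cochain_pullback_def pullback_def)
    have dz: "?d ?\<zeta> X p vs = ?g \<alpha> X p vs - ?f \<alpha> X p vs" "?d ?\<zeta>' X p vs = ?f \<alpha> X p vs - ?g \<alpha> X p vs"
        for X p vs
      unfolding cartan_differential_lincomb[OF M e h] cartan_differential_lincomb[OF M ge fe]
        cartan_differential_pullback[OF M N lie actM f eta] cartan_differential_pullback[OF M N lie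
            actM g eta]
        homotopy_operator_cocycle[OF M N lie actM F F01 a0] pl
      by (simp_all add: homotopy_operator_cocycle[OF M N lie actM F F01 a0])
    show ?thesis
    proof (rule subset_antisym)
      show "coboundaries G L M \<phi> n #>\<^bsub>cocycles G L M \<phi> n\<^esub> ?f \<alpha>
          \<subseteq> coboundaries G L M \<phi> n #>\<^bsub>cocycles G L M \<phi> n\<^esub> ?g \<alpha>"
      proof (rule coset_cong[OF M zeta(2)])
        fix X p vs
        show "?f \<alpha> X p vs = ?g \<alpha> X p vs + ?d ?\<zeta>' X p vs" using dz(2)[of X p vs] by linarith
      qed
      show "coboundaries G L M \<phi> n #>\<^bsub>cocycles G L M \<phi> n\<^esub> ?g \<alpha>
          \<subseteq> coboundaries G L M \<phi> n #>\<^bsub>cocycles G L M \<phi> n\<^esub> ?f \<alpha>"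
      proof (rule coset_cong[OF M zeta(1)])
        fix X p vs
        show "?g \<alpha> X p vs = ?f \<alpha> X p vs + ?d ?\<zeta> X p vs" using dz(1)[of X p vs] by linarith
      qed
    qed
  qed
  show ?thesis
  proof (intro ext)
    fix n K
    show "cohomology_pullback G L M \<phi> N \<psi> f n K = cohomology_pullback G L M \<phi> N \<psi> g n K"
    proof (cases "K \<in> carrier (equivariant_cohomology G L N \<psi> n)")
      case True
      then show ?thesis unfolding cohomology_pullback_def by (simp add: coset cong: SUP_cong)
    \<comment> \<open>Off the carrier both sides are the default value of a restricted function;
      within it, \<open>coset\<close> identifies the two families of cosets.\<close>
    qed (simp add: cohomology_pullback_def)
  qed
qed

end
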